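(* Let $q>1$, let $\Omega$ be any domain of $\mathbb{R}^N$, $T\in(0,\infty]$, and let $u$ be any nonnegative weak solution of (E) in $Q_{\Omega,T}$. Then there exist a set $\mathcal{S}\subset\Omega$ such that $\mathcal{R}=\Omega\setminus\mathcal{S}$ is open, and a measure $u_0\in\mathcal{M}^+(\mathcal{R})$, such that (a) for every $\psi\in C_c(\mathcal{R})$, $\lim_{t\to0}\int_{\mathcal{R}}u(\cdot,t)\psi\,dx=\int_{\mathcal{R}}\psi\,du_0$; (b) for every $x_0\in\mathcal{S}$ and every $\varepsilon>0$, $\lim_{t\to0}\int_{B(x_0,\varepsilon)\cap\Omega}u(\cdot,t)\,dx=\infty$.
   Context: Equation (E) is $u_t-\Delta u+|\nabla u|^q=0$ and $Q_{\Omega,T}=\Omega\times(0,T)$. A weak solution of (E) in $Q_{\Omega,T}$ is a function $u\in C((0,T);L^1_{loc}(\Omega))\cap L^1_{loc}((0,T);W^{1,1}_{loc}(\Omega))$ with $|\nabla u|^q\in L^1_{loc}(Q_{\Omega,T})$ such that $\int_0^T\int_\Omega(-u\varphi_t-u\Delta\varphi+|\nabla u|^q\varphi)\,dx\,dt=0$ for all $\varphi\in C_c^\infty(Q_{\Omega,T})$. $\mathcal{M}^+(A)$ denotes the nonnegative Radon measures on an open set $A$. *)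

theory Defs
  imports "HOL-Analysis.Analysis"
begin

fun dderiv :: "'a::euclidean_space list \<Rightarrow> ('a \<Rightarrow> real) \<Rightarrow> 'a \<Rightarrow> real" where
  "dderiv [] f = f"
| "dderiv (v # vs) f = (\<lambda>x. frechet_derivative (dderiv vs f) (at x) v)"

definition smooth :: "('a::euclidean_space \<Rightarrow> real) \<Rightarrow> bool" where
  "smooth f \<longleftrightarrow> (\<forall>vs. set vs \<subseteq> Basis \<longrightarrow>
      (\<forall>x. dderiv vs f differentiable at x) \<and> continuous_on UNIV (dderiv vs f))"

definition test_fun :: "'a::euclidean_space set \<Rightarrow> ('a \<Rightarrow> real) \<Rightarrow> bool" where
  "test_fun A \<phi> \<longleftrightarrow> smooth \<phi> \<and> compact (closure {z. \<phi> z \<noteq> 0})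
      \<and> closure {z. \<phi> z \<noteq> 0} \<subseteq> A"

definition tint :: "ereal \<Rightarrow> real set" where
  "tint T = {t. 0 < t \<and> ereal t < T}"

definition cyl :: "'a set \<Rightarrow> ereal \<Rightarrow> ('a \<times> real) set" where
  "cyl \<Omega> T = \<Omega> \<times> tint T"

text \<open>Weak solution of u_t - Delta u + |grad u|^q = 0 in Q = Omega x (0,T).
  u is written u x t.  g is the (distributional) spatial gradient of u.\<close>
definition weak_solution :: "real \<Rightarrow> 'a::euclidean_space set \<Rightarrow> ereal \<Rightarrow> ('a \<Rightarrow> real \<Rightarrow> real) \<Rightarrow> bool" where
  "weak_solution q \<Omega> T u \<longleftrightarrow>
    \<comment> \<open>u in C((0,T); L^1_loc(Omega))\<close>
    (\<forall>K t. compact K \<and> K \<subseteq> \<Omega> \<and> t \<in> tint T \<longrightarrow>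
        set_integrable lborel K (\<lambda>x. u x t) \<and>
        ((\<lambda>s. LINT x:K|lborel. \<bar>u x s - u x t\<bar>) \<longlongrightarrow> 0) (at t within tint T)) \<and>
    (\<exists>g :: 'a \<Rightarrow> real \<Rightarrow> 'a.
       \<comment> \<open>u, grad u in L^1_loc, and |grad u|^q in L^1_loc(Q)\<close>
       (\<forall>K. compact K \<and> K \<subseteq> cyl \<Omega> T \<longrightarrow>
          set_integrable lborel K (\<lambda>z. u (fst z) (snd z)) \<and>
          set_integrable lborel K (\<lambda>z. g (fst z) (snd z)) \<and>
          set_integrable lborel K (\<lambda>z. norm (g (fst z) (snd z)) powr q)) \<and>
       \<comment> \<open>g is the weak spatial gradient of u\<close>
       (\<forall>\<phi> b. test_fun (cyl \<Omega> T) \<phi> \<and> b \<in> Basis \<longrightarrow>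
          (LINT z|lborel. u (fst z) (snd z) * dderiv [(b, 0)] \<phi> z)
            = - (LINT z|lborel. (g (fst z) (snd z) \<bullet> b) * \<phi> z)) \<and>
       \<comment> \<open>the weak form of the equation\<close>
       (\<forall>\<phi>. test_fun (cyl \<Omega> T) \<phi> \<longrightarrow>
          (LINT z|lborel. - u (fst z) (snd z) * dderiv [(0, 1)] \<phi> z
              - u (fst z) (snd z) * (\<Sum>b\<in>Basis. dderiv [(b, 0), (b, 0)] \<phi> z)
              + norm (g (fst z) (snd z)) powr q * \<phi> z) = 0))"

text \<open>Nonnegative Radon measures on an open set R, realised as Borel measures on the
  whole space that vanish outside R and are finite on compact subsets of R.\<close>
definition radon_pos_on :: "'a::euclidean_space set \<Rightarrow> 'a measure \<Rightarrow> bool" where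
  "radon_pos_on R \<mu> \<longleftrightarrow> sets \<mu> = sets borel \<and> emeasure \<mu> (UNIV - R) = 0 \<and>
     (\<forall>K. compact K \<and> K \<subseteq> R \<longrightarrow> emeasure \<mu> K < \<infinity>)"

text \<open>C_c(R): continuous on R with compact support inside R (values off R irrelevant).\<close>
definition Cc_on :: "'a::euclidean_space set \<Rightarrow> ('a \<Rightarrow> real) \<Rightarrow> bool" where
  "Cc_on R \<psi> \<longleftrightarrow> continuous_on R \<psi> \<and> (\<exists>K. compact K \<and> K \<subseteq> R \<and> (\<forall>x\<in>R - K. \<psi> x = 0))"

end

theory Submission
  imports Defs
begin

text \<open>
  Call a point of \<open>\<Omega>\<close> regular if \<open>|\<nabla>u|^q\<close> is integrable on \<open>B \<times> (0,\<tau>)\<close> for some ball \<open>B\<close> around it and some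
  \<open>\<tau>\<close>; the regular points form the open set \<open>R\<close>, and \<open>S\<close> is the rest of \<open>\<Omega>\<close>.  For a test function
  \<open>\<xi>\<close> in space, testing the equation with \<open>\<xi>(x) \<theta>(t)\<close>, where \<open>\<theta>\<close> approximates the indicator of an interval,
  gives \<open>\<integral>u(s)\<xi> - \<integral>u(t)\<xi> = \<integral>_s^t \<integral> (\<nabla>u \<cdot> \<nabla>\<xi> + |\<nabla>u|^q \<xi>)\<close>.

  If \<open>\<xi>\<close> is supported near a regular point, the right-hand side is dominated by \<open>1 + |\<nabla>u|^q\<close>, so
  \<open>\<integral>u(s)\<xi>\<close> converges as \<open>s \<rightarrow> 0\<close>.  For \<open>\<psi> \<in> C_c(R)\<close> take a smooth cutoff \<open>\<zeta>\<close> positive on the support of \<open>\<psi>\<close>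
  and approximate \<open>\<psi>/\<zeta>\<close> uniformly by polynomials \<open>p\<close>: the error \<open>|\<psi> - \<zeta>p| \<le> \<epsilon>\<zeta>\<close> is controlled because
  \<open>\<integral>u(s)\<zeta>\<close> stays bounded.  The limit is a positive functional, hence a Radon measure.

  Near a point of \<open>S\<close> take \<open>\<xi> = \<eta>^m\<close> with \<open>m\<close> large; then \<open>|\<nabla>u \<cdot> \<nabla>\<xi>| \<le> |\<nabla>u|^q \<xi> / 2 + C\<close>, and
  \<open>\<integral>u(s)\<xi>\<close> grows at least like half the divergent integral of \<open>|\<nabla>u|^q \<xi>\<close>.
\<close>


text \<open>Everything is decided by the energy \<open>|\<nabla>u|^q\<close> near time 0 and not by
  the mass of \<open>u\<close>. The weak gradient takes one derivative off the test function in the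
  Laplace term, so \<open>u\<close> itself disappears from the right-hand side of the increment
  formula. What remains is linear in \<open>|\<nabla>u|\<close> or equal to
  \<open>|\<nabla>u|^q \<xi>\<close>, and \<open>q > 1\<close> lets the second kind of term control
  the first: from above by \<open>a \<le> 1 + a^q\<close> at regular points, by absorption at
  singular ones.

  One obstacle is that all data are integrable only locally in the open time interval, so no
  integral down to time 0 is available beforehand. Integrals are truncated to
  \<open>(s, \<tau>]\<close>, and finiteness means a bound uniform in \<open>s\<close>.

  A second obstacle is that the equation accepts only smooth test functions, with iterated partial
  derivatives of every order. Cut-offs are therefore built from explicit families that are closed
  under differentiation, and polynomials, being smooth, take the place of mollification.\<close>

section \<open>Smooth functions\<close>

text \<open>Continuity is automatic from differentiability, so membership in a family closed under partial derivatives suffices.\<close>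
lemma smoothI_family:
  assumes "f \<in> F"
    and diff: "\<And>f x. f \<in> F \<Longrightarrow> f differentiable at x"
    and closed: "\<And>f b. f \<in> F \<Longrightarrow> b \<in> Basis \<Longrightarrow> (\<lambda>x. frechet_derivative f (at x) b) \<in> F"
  shows "smooth f"
proof -
  have mem: "dderiv vs f \<in> F" if "set vs \<subseteq> Basis" for vs
    using that by (induction vs) (auto simp: assms)
  show ?thesis
    unfolding smooth_def
  proof (intro allI impI conjI)
    fix vs :: "'a list" and x assume vs: "set vs \<subseteq> Basis"
    show "dderiv vs f differentiable at x"
      using mem[OF vs] diff by blast
    show "continuous_on UNIV (dderiv vs f)"
      by (rule differentiable_imp_continuous_on)
        (use mem[OF vs] diff in \<open>auto simp: differentiable_on_def intro: differentiable_at_withinI\<close>)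
  qed
qed

lemma smooth_differentiable: "smooth f \<Longrightarrow> f differentiable at x"
  unfolding smooth_def by (metis dderiv.simps(1) empty_subsetI list.set(1))

lemma smooth_continuous_on: "smooth f \<Longrightarrow> continuous_on A f"
  by (meson differentiable_at_withinI differentiable_imp_continuous_on differentiable_on_def
      smooth_differentiable)

lemma dderiv_append: "dderiv (vs @ ws) f = dderiv vs (dderiv ws f)"
  by (induction vs) auto

lemma smooth_dderiv: "smooth f \<Longrightarrow> b \<in> Basis \<Longrightarrow> smooth (dderiv [b] f)"
  unfolding smooth_def
  by (metis Un_insert_right bot.extremum dderiv_append insert_subset list.set(1,2) set_append sup_bot.right_neutral)

section \<open>Rings of functions closed under partial derivatives\<close>

inductive_set func_ring :: "('a \<Rightarrow> real) set \<Rightarrow> ('a \<Rightarrow> real) set" for G where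
  base: "f \<in> G \<Longrightarrow> f \<in> func_ring G"
| const: "(\<lambda>_. c) \<in> func_ring G"
| add: "f \<in> func_ring G \<Longrightarrow> h \<in> func_ring G \<Longrightarrow> (\<lambda>x. f x + h x) \<in> func_ring G"
| mult: "f \<in> func_ring G \<Longrightarrow> h \<in> func_ring G \<Longrightarrow> (\<lambda>x. f x * h x) \<in> func_ring G"

lemma func_ring_sum:
  "(\<And>i. i \<in> I \<Longrightarrow> f i \<in> func_ring G) \<Longrightarrow> (\<lambda>x. \<Sum>i\<in>I. f i x) \<in> func_ring G"
  by (induction I rule: infinite_finite_induct) (auto intro: func_ring.intros)

text \<open>A derivative of a generator need not be a generator; it only has to lie in the generated
  ring. The sum and product rules extend this by induction to all elements, so the ring is a family
  as in \<open>smoothI_family\<close>.\<close>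

lemma smooth_func_ring:
  fixes G :: "('a::euclidean_space \<Rightarrow> real) set"
  assumes "f \<in> func_ring G"
    and diff: "\<And>f x. f \<in> G \<Longrightarrow> f differentiable at x"
    and closed: "\<And>f b. f \<in> G \<Longrightarrow> b \<in> Basis \<Longrightarrow> (\<lambda>x. frechet_derivative f (at x) b) \<in> func_ring G"
  shows "smooth f"
proof (rule smoothI_family[OF assms(1)])
  have D: "(\<forall>x. f differentiable at x) \<and> (\<forall>b\<in>Basis. (\<lambda>x. frechet_derivative f (at x) b) \<in> func_ring G)"
    if "f \<in> func_ring G" for f
    using that
  proof induction
    case (base f)
    then show ?case using diff closed by blast
  next
    case (const c)
    then show ?case by (auto simp: frechet_derivative_const intro: func_ring.const)
  next
    case (add f h)
    have "frechet_derivative (\<lambda>x. f x + h x) (at x) = (\<lambda>v. frechet_derivative f (at x) v + frechet_derivative h (at x) v)" for x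
      by (rule frechet_derivative_at[symmetric], rule has_derivative_add)
        (use add in \<open>auto simp: frechet_derivative_works[symmetric]\<close>)
    then show ?case using add by (auto intro: func_ring.add)
  next
    case (mult f h)
    have "frechet_derivative (\<lambda>x. f x * h x) (at x)
        = (\<lambda>v. f x * frechet_derivative h (at x) v + frechet_derivative f (at x) v * h x)" for x
      by (rule frechet_derivative_at[symmetric], rule has_derivative_mult)
        (use mult in \<open>auto simp: frechet_derivative_works[symmetric]\<close>)
    then show ?case using mult by (auto intro!: func_ring.add func_ring.mult)
  qed
  show "f differentiable at x" if "f \<in> func_ring G" for f x using D that by blast
  show "(\<lambda>x. frechet_derivative f (at x) b) \<in> func_ring G" if "f \<in> func_ring G" "b \<in> Basis" for f b
    using D that by blast
qed

lemma frechet_derivative_compose_affine: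
  fixes f :: "'b::euclidean_space \<Rightarrow> real" and A :: "'a::euclidean_space \<Rightarrow> 'b"
  assumes "f differentiable at (A x + c)" "bounded_linear A"
  shows "((\<lambda>x. f (A x + c)) has_derivative (\<lambda>v. frechet_derivative f (at (A x + c)) (A v))) (at x)"
proof -
  have 1: "((\<lambda>x. A x + c) has_derivative A) (at x)"
    using assms(2) by (auto intro!: derivative_eq_intros bounded_linear_imp_has_derivative)
  have 2: "(f has_derivative frechet_derivative f (at (A x + c))) (at (A x + c))"
    using assms(1) frechet_derivative_works by blast
  show ?thesis
    using has_derivative_compose[OF 1 2] .
qed

text \<open>By the chain rule a partial derivative of \<open>h (A x + c)\<close> is a combination,
  with constant coefficients, of the functions \<open>dderiv [i] h (A x + c)\<close>, and these are
  generators again because \<open>dderiv [i] h\<close> is smooth. Closure of smoothness under sums,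
  products and affine substitution all follow from this one argument.\<close>

lemma smooth_affine_func_ring:
  fixes f :: "'a::euclidean_space \<Rightarrow> real"
  assumes "f \<in> func_ring {\<lambda>x. h (A x + c) |(h :: 'b::euclidean_space \<Rightarrow> real) A c. smooth h \<and> bounded_linear A}"
  shows "smooth f"
  using assms
proof (rule smooth_func_ring)
  let ?G = "{\<lambda>x. h (A x + c) |(h :: 'b \<Rightarrow> real) (A :: 'a \<Rightarrow> 'b) c. smooth h \<and> bounded_linear A}"
  show "f differentiable at x" if "f \<in> ?G" for f x
    using that frechet_derivative_compose_affine smooth_differentiable
    unfolding differentiable_def by blast
  show "(\<lambda>x. frechet_derivative f (at x) b) \<in> func_ring ?G" if fG: "f \<in> ?G" and b: "b \<in> Basis" for f b
  proof -
    obtain h A c where f: "f = (\<lambda>x. h (A x + c))" and h: "smooth h" and A: "bounded_linear (A :: 'a \<Rightarrow> 'b)"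
      using fG by blast
    have "frechet_derivative f (at x) b = (\<Sum>i\<in>Basis. (A b \<bullet> i) * dderiv [i] h (A x + c))" for x
    proof -
      have "frechet_derivative f (at x) b = frechet_derivative h (at (A x + c)) (A b)"
        unfolding f using frechet_derivative_at[OF frechet_derivative_compose_affine[OF smooth_differentiable[OF h] A]] by metis
      also have "\<dots> = frechet_derivative h (at (A x + c)) (\<Sum>i\<in>Basis. (A b \<bullet> i) *\<^sub>R i)"
        by (simp add: euclidean_representation)
      also have "\<dots> = (\<Sum>i\<in>Basis. (A b \<bullet> i) * dderiv [i] h (A x + c))"
        using linear_frechet_derivative[OF smooth_differentiable[OF h]]
        by (simp add: linear_sum linear_scale)
      finally show ?thesis .
    qed
    then have eq: "(\<lambda>x. frechet_derivative f (at x) b) = (\<lambda>x. \<Sum>i\<in>Basis. (A b \<bullet> i) * dderiv [i] h (A x + c))"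
      by blast
    show ?thesis
      unfolding eq
    proof (intro func_ring_sum func_ring.mult[OF func_ring.const] func_ring.base)
      fix i :: 'b assume "i \<in> Basis"
      then show "(\<lambda>x. dderiv [i] h (A x + c)) \<in> ?G"
        using smooth_dderiv[OF h] A by blast
    qed
  qed
qed

lemma smooth_const: "smooth (\<lambda>_. c)"
  by (rule smooth_affine_func_ring) (rule func_ring.const)

lemma smooth_affine_compose:
  "smooth h \<Longrightarrow> bounded_linear A \<Longrightarrow> smooth (\<lambda>x. h (A x + c))"
  by (rule smooth_affine_func_ring) (auto intro!: func_ring.base)

lemma smooth_mem_ring:
  "smooth f \<Longrightarrow> f \<in> func_ring {\<lambda>x. h (A x + c) |(h :: 'b::euclidean_space \<Rightarrow> real) (A :: 'b \<Rightarrow> 'b) c. smooth h \<and> bounded_linear A}"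
  by (rule func_ring.base, rule CollectI, rule exI[of _ f], rule exI[of _ "\<lambda>x. x"], rule exI[of _ 0])
    (simp add: bounded_linear_ident)

lemma smooth_mult: "smooth f \<Longrightarrow> smooth h \<Longrightarrow> smooth (\<lambda>x. f x * h x)"
  by (rule smooth_affine_func_ring, rule func_ring.mult) (rule smooth_mem_ring; assumption)+

lemma smooth_add: "smooth f \<Longrightarrow> smooth h \<Longrightarrow> smooth (\<lambda>x. f x + h x)"
  by (rule smooth_affine_func_ring, rule func_ring.add) (rule smooth_mem_ring; assumption)+

lemma smooth_diff: "smooth f \<Longrightarrow> smooth h \<Longrightarrow> smooth (\<lambda>x. f x - h x)"
  using smooth_add[of f "\<lambda>x. -1 * h x"] smooth_mult[OF smooth_const[of "-1"], of h] by simp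

lemma smooth_prod: "(\<And>i. i \<in> I \<Longrightarrow> smooth (f i)) \<Longrightarrow> smooth (\<lambda>x. \<Prod>i\<in>I. f i x)"
  by (induction I rule: infinite_finite_induct) (auto intro: smooth_const smooth_mult)

lemma smooth_power: "smooth f \<Longrightarrow> smooth (\<lambda>x. f x ^ n)"
  by (induction n) (auto intro: smooth_const smooth_mult)

lemma smooth_real_linear:
  fixes f :: "'a::euclidean_space \<Rightarrow> real"
  assumes "bounded_linear f"
  shows "smooth f"
proof (rule smoothI_family[of f "insert f (range (\<lambda>c _. c))"])
  have D: "(f has_derivative f) (at x)" for x
    by (rule bounded_linear_imp_has_derivative[OF assms])
  show "h differentiable at x" if "h \<in> insert f (range (\<lambda>c _. c))" for h x
    using that D by (auto intro: differentiableI)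
  show "(\<lambda>x. frechet_derivative h (at x) b) \<in> insert f (range (\<lambda>c _. c))"
    if "h \<in> insert f (range (\<lambda>c _. c))" for h b
    using that frechet_derivative_at[OF D, symmetric] by (auto simp: frechet_derivative_const)
qed auto

lemma smooth_real_polynomial_function:
  fixes f :: "'a::euclidean_space \<Rightarrow> real"
  assumes "real_polynomial_function f"
  shows "smooth f"
  using assms
  by (induction rule: real_polynomial_function.induct)
    (auto intro: smooth_const smooth_add smooth_mult smooth_real_linear)

lemma frechet_derivative_real:
  "(f has_real_derivative D) (at x) \<Longrightarrow> frechet_derivative f (at x) 1 = D"
  using frechet_derivative_at[of f "(*) D" x] by (metis has_field_derivative_def mult.right_neutral)

lemma smooth_real_derivative:
  assumes "smooth (f :: real \<Rightarrow> real)"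
  shows "(f has_real_derivative dderiv [1] f x) (at x)"
proof -
  obtain D where D: "(f has_real_derivative D) (at x)"
    using smooth_differentiable[OF assms, of x] by (auto simp: real_differentiable_def)
  then show ?thesis
    using frechet_derivative_real[OF D] by simp
qed

text \<open>Adding one function to the class of all smooth functions keeps the class closed under
  derivatives, provided its derivative is smooth. This serves the step function, which is given as
  an integral.\<close>

lemma smooth_antiderivative:
  assumes D: "\<And>x. (f has_real_derivative f' x) (at x)" and "smooth f'"
  shows "smooth f"
proof (rule smoothI_family[of f "insert f {h. smooth h}"])
  show "h differentiable at x" if "h \<in> insert f {h. smooth h}" for h x
    using that D real_differentiable_def smooth_differentiable by blast
  show "(\<lambda>x. frechet_derivative h (at x) b) \<in> insert f {h. smooth h}"
    if "h \<in> insert f {h. smooth h}" "b \<in> Basis" for h b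
    using that smooth_dderiv[of h b] frechet_derivative_real[OF D] \<open>smooth f'\<close> by auto
qed auto

section \<open>A flat function, smooth steps and bumps\<close>

lemma tendsto_poly_mult_exp_minus: "((\<lambda>y::real. poly p y * exp (- y)) \<longlongrightarrow> 0) at_top"
proof -
  have "((\<lambda>y::real. \<Sum>i\<le>degree p. coeff p i * (y ^ i / exp y)) \<longlongrightarrow> (\<Sum>i\<le>degree p. coeff p i * 0)) at_top"
    by (intro tendsto_intros tendsto_power_div_exp_0)
  then show ?thesis
    by (simp add: poly_altdef exp_minus sum_divide_distrib divide_inverse[symmetric])
qed

text \<open>The functions \<open>p(1/s) exp(-1/s)\<close>, extended by 0 to
  \<open>s \<le> 0\<close>, form a family closed under differentiation: for \<open>s > 0\<close> the
  derivative has the same form with \<open>X^2 (p - p')\<close> in place of \<open>p\<close>, and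
  this is the map called \<open>p'\<close> below. Only the derivative at 0 needs a limit.\<close>

lemma smooth_flat:
  "smooth (\<lambda>s::real. if 0 < s then exp (- inverse s) else 0)"
proof -
  define f :: "real poly \<Rightarrow> real \<Rightarrow> real" where
    "f p = (\<lambda>s. if 0 < s then poly p (inverse s) * exp (- inverse s) else 0)" for p
  define p' :: "real poly \<Rightarrow> real poly" where "p' p = [:0,0,1:] * (p - pderiv p)" for p
  have D: "(f p has_real_derivative f (p' p) s) (at s)" for p s
  proof -
    consider "s > 0" | "s < 0" | "s = 0" by linarith
    then show ?thesis
    proof cases
      case 1
      have "((\<lambda>s. poly p (inverse s) * exp (- inverse s)) has_real_derivative f (p' p) s) (at s)"
        using 1 by (auto intro!: derivative_eq_intros DERIV_chain2[OF poly_DERIV]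
            simp: f_def p'_def power2_eq_square algebra_simps)
      moreover have "eventually (\<lambda>s. poly p (inverse s) * exp (- inverse s) = f p s) (nhds s)"
        using eventually_nhds_in_open[of "{0<..}" s] 1 by (auto simp: f_def elim: eventually_mono)
      ultimately show ?thesis using DERIV_cong_ev[OF refl _ refl] by iprover
    next
      case 2
      have "eventually (\<lambda>s. 0 = f p s) (nhds s)"
        using eventually_nhds_in_open[of "{..<0}" s] 2 by (auto simp: f_def elim: eventually_mono)
      moreover have "((\<lambda>s::real. 0::real) has_real_derivative f (p' p) s) (at s)"
        using 2 by (auto simp: f_def)
      ultimately show ?thesis using DERIV_cong_ev[OF refl _ refl] by iprover
    next
      case 3
      have L: "((\<lambda>x. f p x / x) \<longlongrightarrow> 0) (at_left 0)"
        by (rule tendsto_eventually) (auto simp: f_def eventually_at_left_field intro: exI[of _ "-1"])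
      \<comment> \<open>The difference quotient at 0 is again of the form
        \<open>(X p)(1/x) exp(-1/x)\<close>, so the substitution \<open>y = 1/x\<close> reduces it
        to exponential decay beating a polynomial.\<close>
      have "((\<lambda>x. poly ([:0,1:] * p) (inverse x) * exp (- inverse x)) \<longlongrightarrow> 0) (at_right (0::real))"
        by (rule filterlim_compose[OF tendsto_poly_mult_exp_minus filterlim_inverse_at_top_right])
      moreover have "eventually (\<lambda>x. poly ([:0,1:] * p) (inverse x) * exp (- inverse x) = f p x / x) (at_right 0)"
        by (auto simp: f_def field_simps eventually_at_right_field intro: exI[of _ 1])
      ultimately have "((\<lambda>x. f p x / x) \<longlongrightarrow> 0) (at_right 0)"
        by (rule Lim_transform_eventually)
      with L have "((\<lambda>x. f p x / x) \<longlongrightarrow> 0) (at 0)"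
        by (simp add: filterlim_at_split)
      then show ?thesis
        using 3 by (simp add: has_field_derivative_iff f_def)
    qed
  qed
  have "smooth (f p)" for p
  proof (rule smoothI_family[of "f p" "range f"])
    show "h differentiable at x" if "h \<in> range f" for h x
      using that D by (auto simp: real_differentiable_def)
    show "(\<lambda>x. frechet_derivative h (at x) b) \<in> range f" if "h \<in> range f" "b \<in> Basis" for h b
      using that by (auto simp: frechet_derivative_real[OF D])
  qed auto
  from this[of 1] show ?thesis by (simp add: f_def cong: if_cong)
qed

lemma smooth_step_exists:
  "\<exists>H :: real \<Rightarrow> real. smooth H \<and> (\<forall>s\<le>0. H s = 0) \<and> (\<forall>s\<ge>1. H s = 1) \<and>
    (\<forall>s. dderiv [1] H s \<ge> 0) \<and> (\<forall>s. 0 \<le> H s) \<and> (\<forall>s. H s \<le> 1)"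
proof -
  define h :: "real \<Rightarrow> real" where "h s = (if 0 < s then exp (- inverse s) else 0)" for s
  define \<rho> where "\<rho> s = h s * h (1 - s)" for s
  have h: "smooth h" using smooth_flat by (simp add: h_def[abs_def])
  have \<rho>: "smooth \<rho>"
    unfolding \<rho>_def
    using smooth_affine_compose[OF h, of "\<lambda>s. - s" 1]
    by (intro smooth_mult h) (auto simp: bounded_linear_minus bounded_linear_ident algebra_simps)
  have \<rho>0: "\<rho> s \<ge> 0" for s by (auto simp: \<rho>_def h_def)
  have \<rho>z: "\<rho> s = 0" if "s \<le> 0 \<or> s \<ge> 1" for s using that by (auto simp: \<rho>_def h_def)
  \<comment> \<open>The lower limit -1 lies left of the support of \<open>\<rho>\<close>. Hence at
    \<open>s = 0\<close> the upper limit is interior to \<open>{-1..s+1}\<close> and the derivative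
    obtained there is two-sided.\<close>
  define H where "H s = integral {-1..s} \<rho>" for s
  have Hz: "H s = 0" if "s \<le> 0" for s
    unfolding H_def using that by (intro integral_unique has_integral_is_0) (auto intro!: \<rho>z)
  have D: "(H has_real_derivative \<rho> s) (at s)" for s
  proof (cases "s < 0")
    case True
    have "eventually (\<lambda>s. 0 = H s) (nhds s)"
      using eventually_nhds_in_open[of "{..<0}" s] True by (auto simp: Hz elim: eventually_mono)
    moreover have "((\<lambda>s::real. 0::real) has_real_derivative \<rho> s) (at s)"
      using True by (auto simp: \<rho>z)
    ultimately show ?thesis using DERIV_cong_ev[OF refl _ refl] by iprover
  next
    case False
    have "(H has_real_derivative \<rho> s) (at s within {-1..s+1})"
      unfolding H_def[abs_def]
      using False by (intro integral_has_real_derivative smooth_continuous_on \<rho>) auto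
    then show ?thesis
      using False at_within_Icc_at[of "-1" s "s+1"] by simp
  qed
  have c1: "H s = H 1" if s1: "s \<ge> 1" for s
  proof -
    have "H s - H 1 = 0"
    proof (cases "s = 1")
      case False
      then obtain z where "z > 1" "H s - H 1 = (s - 1) * \<rho> z"
        using MVT2[of 1 s H \<rho>] D s1 by auto
      then show ?thesis using \<rho>z by simp
    qed auto
    then show ?thesis by simp
  qed
  have cpos: "H 1 > 0"
  proof -
    obtain z where "0 < z" "z < 1" "H 1 - H 0 = (1 - 0) * \<rho> z"
      using MVT2[of 0 1 H \<rho>] D by auto
    then show ?thesis by (auto simp: Hz \<rho>_def h_def)
  qed
  have sH: "smooth H" by (rule smooth_antiderivative[OF D \<rho>])
  have sK: "smooth (\<lambda>s. H s / H 1)"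
    using smooth_mult[OF smooth_const[of "inverse (H 1)"] sH] by (simp add: field_simps)
  have "((\<lambda>s. H s / H 1) has_real_derivative \<rho> s / H 1) (at s)" for s
    by (rule DERIV_cdivide[OF D])
  then have "dderiv [1] (\<lambda>s. H s / H 1) s = \<rho> s / H 1" for s
    using frechet_derivative_real by simp
  with \<rho>0 cpos have "dderiv [1] (\<lambda>s. H s / H 1) s \<ge> 0" for s by simp
  have mono: "H s \<le> H t" if "s \<le> t" for s t
    by (rule DERIV_nonneg_imp_nondecreasing[OF that]) (use D \<rho>0 in blast)
  show ?thesis
  proof (intro exI conjI allI impI)
    show "smooth (\<lambda>s. H s / H 1)" by (rule sK)
    show "dderiv [1] (\<lambda>s. H s / H 1) s \<ge> 0" for s by fact
    show "H s / H 1 = 0" if "s \<le> 0" for s using Hz[OF that] by simp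
    show "H s / H 1 = 1" if "s \<ge> 1" for s using c1[OF that] cpos by simp
    show "0 \<le> H s / H 1" for s
      using mono[of "min s 0" s] Hz[of "min s 0"] cpos by simp
    show "H s / H 1 \<le> 1" for s
      using mono[of s "max s 1"] c1[of "max s 1"] cpos by simp
  qed
qed

text \<open>The bump is a product over the coordinates, so that every factor is the flat function
  composed with an affine map and \<open>smooth_affine_compose\<close> applies. Its positivity set
  is an open cube around \<open>x0\<close>.\<close>

lemma smooth_bump_exists:
  fixes x0 :: "'a::euclidean_space"
  assumes "\<epsilon> > 0"
  shows "\<exists>(\<eta> :: 'a \<Rightarrow> real) r. smooth \<eta> \<and> (\<forall>x. 0 \<le> \<eta> x) \<and> (\<forall>x. \<eta> x \<le> 1) \<and>
    (\<forall>x. x \<notin> cball x0 \<epsilon> \<longrightarrow> \<eta> x = 0) \<and> r > 0 \<and> (\<forall>x\<in>cball x0 r. \<eta> x > 0)"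
proof -
  define h :: "real \<Rightarrow> real" where "h s = (if 0 < s then exp (- inverse s) else 0)" for s
  have h: "smooth h" using smooth_flat by (simp add: h_def[abs_def])
  have h01: "0 \<le> h s" "h s \<le> 1" for s by (auto simp: h_def)
  \<comment> \<open>Half the side length of the cube. The norm is at most the sum of the absolute
    coordinates, hence at most \<open>DIM('a) * d = \<epsilon>\<close> inside the cube.\<close>
  define d where "d = \<epsilon> / DIM('a)"
  have d: "d > 0" using assms by (simp add: d_def)
  define \<eta> :: "'a \<Rightarrow> real" where
    "\<eta> x = (\<Prod>b\<in>Basis. h (x \<bullet> b + (d - x0 \<bullet> b)) * h (x \<bullet> (- b) + (d + x0 \<bullet> b)))" for x
  show ?thesis
  proof (rule exI[of _ \<eta>], rule exI[of _ "d/2"], intro conjI allI ballI impI)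
    show "smooth \<eta>"
      unfolding \<eta>_def by (intro smooth_prod smooth_mult smooth_affine_compose h bounded_linear_inner_left)
    show "0 \<le> \<eta> x" for x by (auto simp: \<eta>_def h01 intro!: prod_nonneg)
    show "\<eta> x \<le> 1" for x
      unfolding \<eta>_def by (intro prod_le_1) (auto simp: h01 mult_le_one)
    show "d / 2 > 0" using d by simp
    show "\<eta> x > 0" if "x \<in> cball x0 (d/2)" for x
      unfolding \<eta>_def
    proof (intro prod_pos ballI)
      fix b :: 'a assume b: "b \<in> Basis"
      have "\<bar>(x - x0) \<bullet> b\<bar> \<le> d/2"
        using Basis_le_norm[OF b, of "x - x0"] that by (simp add: dist_norm norm_minus_commute)
      then have "0 < x \<bullet> b + (d - x0 \<bullet> b)" "0 < x \<bullet> (- b) + (d + x0 \<bullet> b)"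
        using d unfolding abs_le_iff inner_diff_left inner_minus_right by linarith+
      then show "0 < h (x \<bullet> b + (d - x0 \<bullet> b)) * h (x \<bullet> (- b) + (d + x0 \<bullet> b))"
        by (simp add: h_def)
    qed
    show "\<eta> x = 0" if "x \<notin> cball x0 \<epsilon>" for x
    proof (rule ccontr)
      assume n: "\<eta> x \<noteq> 0"
      have "\<bar>(x - x0) \<bullet> b\<bar> \<le> d" if "b \<in> Basis" for b
        using n that by (auto simp: \<eta>_def h_def inner_diff_left split: if_splits)
      then have "norm (x - x0) \<le> (\<Sum>b\<in>(Basis::'a set). d)"
        using norm_le_l1[of "x - x0"] sum_mono[of Basis "\<lambda>b. \<bar>(x - x0) \<bullet> b\<bar>" "\<lambda>_. d"] by fastforce
      then show False using that by (simp add: d_def dist_norm norm_minus_commute)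
    qed
  qed
qed

section \<open>The Riesz representation theorem for positive functionals\<close>

text \<open>In contrast to \<open>Cc_on\<close>, the functions are continuous on the whole space and
  vanish everywhere off the compact set. Integrals against them can then be taken over the whole
  space, and \<open>Cc R\<close> grows with \<open>R\<close>.\<close>

definition Cc :: "'a::euclidean_space set \<Rightarrow> ('a \<Rightarrow> real) set" where
  "Cc R = {f. continuous_on UNIV f \<and> (\<exists>K. compact K \<and> K \<subseteq> R \<and> (\<forall>x. x \<notin> K \<longrightarrow> f x = 0))}"

lemma Cc_I: "continuous_on UNIV f \<Longrightarrow> compact K \<Longrightarrow> K \<subseteq> R \<Longrightarrow> (\<And>x. x \<notin> K \<Longrightarrow> f x = 0) \<Longrightarrow> f \<in> Cc R"
  by (auto simp: Cc_def)

lemma Cc_E: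
  assumes "f \<in> Cc R"
  obtains K where "compact K" "K \<subseteq> R" "\<And>x. x \<notin> K \<Longrightarrow> f x = 0"
  using assms by (auto simp: Cc_def)

lemma Cc_continuous: "f \<in> Cc R \<Longrightarrow> continuous_on UNIV f"
  by (simp add: Cc_def)

lemma Cc_zero: "(\<lambda>_. 0) \<in> Cc R"
  by (rule Cc_I[of _ "{}"]) auto

lemma Cc_mult:
  assumes "f \<in> Cc R" "continuous_on UNIV g"
  shows "(\<lambda>x. f x * g x) \<in> Cc R"
proof -
  obtain K where "compact K" "K \<subseteq> R" "\<And>x. x \<notin> K \<Longrightarrow> f x = 0"
    using Cc_E[OF assms(1)] by blast
  then show ?thesis
    by (intro Cc_I[of _ K] continuous_intros Cc_continuous[OF assms(1)] assms(2)) auto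
qed

lemma Cc_cmult: "f \<in> Cc R \<Longrightarrow> (\<lambda>x. c * f x) \<in> Cc R"
  using Cc_mult[of f R "\<lambda>_. c"] by (simp add: mult.commute)

lemma Cc_add:
  assumes "f \<in> Cc R" "g \<in> Cc R"
  shows "(\<lambda>x. f x + g x) \<in> Cc R"
proof -
  obtain K where K: "compact K" "K \<subseteq> R" "\<And>x. x \<notin> K \<Longrightarrow> f x = 0"
    using Cc_E[OF assms(1)] by blast
  obtain K' where K': "compact K'" "K' \<subseteq> R" "\<And>x. x \<notin> K' \<Longrightarrow> g x = 0"
    using Cc_E[OF assms(2)] by blast
  show ?thesis
    by (rule Cc_I[of _ "K \<union> K'"]) (use K K' assms in \<open>auto intro!: continuous_intros dest: Cc_continuous\<close>)
qed

lemma Cc_diff: "f \<in> Cc R \<Longrightarrow> g \<in> Cc R \<Longrightarrow> (\<lambda>x. f x - g x) \<in> Cc R"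
  using Cc_add[of f R "\<lambda>x. -1 * g x"] Cc_cmult[of g R "-1"] by simp

lemma Cc_sum: "(\<And>i. i \<in> I \<Longrightarrow> f i \<in> Cc R) \<Longrightarrow> (\<lambda>x. \<Sum>i\<in>I. f i x) \<in> Cc R"
  by (induction I rule: infinite_finite_induct) (auto intro: Cc_zero Cc_add)

lemma Cc_min_const:
  assumes "f \<in> Cc R" "0 \<le> c"
  shows "(\<lambda>x. min (f x) c) \<in> Cc R"
proof -
  obtain K where K: "compact K" "K \<subseteq> R" "\<And>x. x \<notin> K \<Longrightarrow> f x = 0"
    using Cc_E[OF assms(1)] by blast
  show ?thesis
    by (rule Cc_I[OF _ K(1,2)]) (use K assms in \<open>auto intro!: continuous_intros dest: Cc_continuous\<close>)
qed

lemma Cc_max_zero: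
  assumes "f \<in> Cc R"
  shows "(\<lambda>x. max (f x) 0) \<in> Cc R"
proof -
  obtain K where K: "compact K" "K \<subseteq> R" "\<And>x. x \<notin> K \<Longrightarrow> f x = 0"
    using Cc_E[OF assms(1)] by blast
  show ?thesis
    by (rule Cc_I[OF _ K(1,2)]) (use K assms in \<open>auto intro!: continuous_intros dest: Cc_continuous\<close>)
qed

lemma Cc_bounded:
  assumes "f \<in> Cc R"
  obtains B where "B > 0" "\<And>x. \<bar>f x\<bar> \<le> B"
proof -
  obtain K where K: "compact K" "K \<subseteq> R" "\<And>x. x \<notin> K \<Longrightarrow> f x = 0"
    using Cc_E[OF assms] by blast
  have "bounded (f ` K)"
    by (intro compact_imp_bounded compact_continuous_image K continuous_on_subset[OF Cc_continuous[OF assms]]) auto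
  then obtain B where B: "B > 0" "\<And>x. x \<in> K \<Longrightarrow> \<bar>f x\<bar> \<le> B"
    unfolding bounded_pos by auto
  have "\<bar>f x\<bar> \<le> B" for x
    by (cases "x \<in> K") (use B K(3) in auto)
  with B(1) show ?thesis by (rule that)
qed

lemma Cc_cutoff:
  assumes "open R" "compact K" "K \<subseteq> R"
  obtains \<zeta> where "\<zeta> \<in> Cc R" "\<And>x. 0 \<le> \<zeta> x" "\<And>x. x \<in> K \<Longrightarrow> \<zeta> x = 1"
\<comment> \<open>\<open>infdist x {}\<close> is 0 by convention, so for empty \<open>K\<close> the
  tent function used below would be constantly 1 and not compactly supported.\<close>
proof (cases "K = {}")
  case True
  then show ?thesis using that[OF Cc_zero] by auto
next
  case False
  obtain e where e: "e > 0" "(\<Union>x\<in>K. cball x e) \<subseteq> R"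
    using compact_subset_open_imp_cball_epsilon_subset[OF assms(2,1,3)] by blast
  have cont: "continuous_on UNIV (\<lambda>x. max 0 (1 - infdist x K / e))"
    by (intro continuous_intros) (use e in auto)
  have sub: "{x. infdist x K \<le> e} \<subseteq> R"
  proof
    fix x assume x: "x \<in> {x. infdist x K \<le> e}"
    obtain y where "y \<in> K" "infdist x K = dist x y"
      using infdist_attains_inf[OF compact_imp_closed[OF assms(2)] False] by blast
    then have "x \<in> cball y e" using x by (simp add: dist_commute)
    with \<open>y \<in> K\<close> e(2) show "x \<in> R" by blast
  qed
  show ?thesis
  proof (rule that[of "\<lambda>x. max 0 (1 - infdist x K / e)"])
    show "(\<lambda>x. max 0 (1 - infdist x K / e)) \<in> Cc R"
      by (rule Cc_I[OF cont compact_infdist_le[OF False assms(2) e(1)] sub]) (use e in \<open>auto simp: field_simps\<close>)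
  qed (use e in auto)
qed

section \<open>The outer measure of a positive functional\<close>

locale positive_functional =
  fixes R :: "'a::euclidean_space set" and L :: "('a \<Rightarrow> real) \<Rightarrow> real"
  assumes open_R: "open R"
    and L_add: "f \<in> Cc R \<Longrightarrow> g \<in> Cc R \<Longrightarrow> L (\<lambda>x. f x + g x) = L f + L g"
    and L_cmult: "f \<in> Cc R \<Longrightarrow> L (\<lambda>x. c * f x) = c * L f"
    and L_nonneg: "f \<in> Cc R \<Longrightarrow> (\<And>x. 0 \<le> f x) \<Longrightarrow> 0 \<le> L f"
begin

lemma L_zero: "L (\<lambda>_. 0) = 0"
  using L_cmult[OF Cc_zero, of 0] by simp

lemma L_diff: "f \<in> Cc R \<Longrightarrow> g \<in> Cc R \<Longrightarrow> L (\<lambda>x. f x - g x) = L f - L g"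
  using L_add[of f "\<lambda>x. -1 * g x"] Cc_cmult[of g R "-1"] L_cmult[of g "-1"] by simp

lemma L_mono: "f \<in> Cc R \<Longrightarrow> g \<in> Cc R \<Longrightarrow> (\<And>x. f x \<le> g x) \<Longrightarrow> L f \<le> L g"
  using L_nonneg[of "\<lambda>x. g x - f x"] L_diff[of g f] Cc_diff[of g R f] by auto

lemma L_sum: "(\<And>i. i \<in> I \<Longrightarrow> f i \<in> Cc R) \<Longrightarrow> L (\<lambda>x. \<Sum>i\<in>I. f i x) = (\<Sum>i\<in>I. L (f i))"
  by (induction I rule: infinite_finite_induct) (auto simp: L_zero intro!: L_add[THEN trans] Cc_sum)

text \<open>A Dini argument: the sets \<open>W N\<close>, where the partial sum exceeds
  \<open>f - \<epsilon>\<close>, are open, increase with \<open>N\<close> and cover the compact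
  support \<open>K\<close> of \<open>f\<close>. So one finite sum plus
  \<open>\<epsilon> \<zeta>\<close> dominates \<open>f\<close>, and positivity of \<open>L\<close>
  finishes. The cutoff \<open>\<zeta>\<close> stands for the constant 1, which need not belong to
  \<open>Cc R\<close>. All of countable additivity rests on this estimate.\<close>

lemma countable_domination:
  assumes f: "f \<in> Cc R" "\<And>x. 0 \<le> f x"
    and F: "\<And>n. F n \<in> Cc R" "\<And>n x. 0 \<le> F n x"
    and le: "\<And>x. x \<in> R \<Longrightarrow> ennreal (f x) \<le> (\<Sum>n. ennreal (F n x))"
  shows "ennreal (L f) \<le> (\<Sum>n. ennreal (L (F n)))"
proof -
  obtain K where K: "compact K" "K \<subseteq> R" "\<And>x. x \<notin> K \<Longrightarrow> f x = 0"
    using Cc_E[OF f(1)] by blast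
  obtain \<zeta> where \<zeta>: "\<zeta> \<in> Cc R" "\<And>x. 0 \<le> \<zeta> x" "\<And>x. x \<in> K \<Longrightarrow> \<zeta> x = 1"
    using Cc_cutoff[OF open_R K(1,2)] by blast
  have L\<zeta>: "0 \<le> L \<zeta>" by (rule L_nonneg[OF \<zeta>(1,2)])
  have eps: "ennreal (L f) \<le> (\<Sum>n. ennreal (L (F n))) + ennreal (\<epsilon> * L \<zeta>)" if \<epsilon>: "\<epsilon> > 0" for \<epsilon>
  proof -
    define W where "W N = {x. f x - \<epsilon> < (\<Sum>n<N. F n x)}" for N
    have opn: "open (W N)" for N
      unfolding W_def
      by (intro open_Collect_less continuous_intros Cc_continuous[OF f(1)] Cc_continuous[OF F(1)])
    have cover: "K \<subseteq> (\<Union>N\<in>UNIV. W N)"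
    proof
      fix x assume x: "x \<in> K"
      show "x \<in> (\<Union>N\<in>UNIV. W N)"
      proof (cases "f x - \<epsilon> < 0")
        case True
        then have "x \<in> W 0" by (simp add: W_def)
        then show ?thesis by blast
      next
        case False
        have "ennreal (f x - \<epsilon>) < ennreal (f x)"
          using False \<epsilon> by (intro ennreal_lessI) auto
        also have "\<dots> \<le> (SUP N. \<Sum>n<N. ennreal (F n x))"
          using le[of x] x K(2) by (auto simp: suminf_eq_SUP)
        finally have "\<exists>N\<in>UNIV. ennreal (f x - \<epsilon>) < (\<Sum>n<N. ennreal (F n x))"
          unfolding less_SUP_iff .
        then obtain N where "ennreal (f x - \<epsilon>) < (\<Sum>n<N. ennreal (F n x))"
          by blast
        then have "ennreal (f x - \<epsilon>) < ennreal (\<Sum>n<N. F n x)"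
          using F(2) by (simp add: sum_ennreal)
        then have "x \<in> W N"
          using False by (simp add: W_def ennreal_less_iff)
        then show ?thesis by blast
      qed
    qed
    obtain D where D: "finite D" "K \<subseteq> (\<Union>N\<in>D. W N)"
      by (rule compactE_image[OF K(1) opn cover])
    define N where "N = (if D = {} then 0 else Max D)"
    have WN: "x \<in> W N" if x: "x \<in> K" for x
    proof -
      obtain M where M: "M \<in> D" "x \<in> W M" using D(2) x by blast
      then have "M \<le> N" using D(1) by (auto simp: N_def)
      then have "(\<Sum>n<M. F n x) \<le> (\<Sum>n<N. F n x)"
        by (intro sum_mono2) (auto simp: F(2))
      with M(2) show ?thesis by (simp add: W_def)
    qed
    have "L f \<le> L (\<lambda>x. (\<Sum>n<N. F n x) + \<epsilon> * \<zeta> x)"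
    proof (rule L_mono[OF f(1)])
      show "(\<lambda>x. (\<Sum>n<N. F n x) + \<epsilon> * \<zeta> x) \<in> Cc R"
        by (intro Cc_add Cc_sum Cc_cmult F(1) \<zeta>(1))
      show "f x \<le> (\<Sum>n<N. F n x) + \<epsilon> * \<zeta> x" for x
      proof (cases "x \<in> K")
        case True
        then show ?thesis using WN[OF True] \<zeta>(3) by (simp add: W_def)
      next
        case False
        have "0 \<le> (\<Sum>n<N. F n x) + \<epsilon> * \<zeta> x"
          using F(2) \<zeta>(2) \<epsilon> by (intro add_nonneg_nonneg sum_nonneg mult_nonneg_nonneg) auto
        then show ?thesis using K(3)[OF False] by simp
      qed
    qed
    also have "\<dots> = (\<Sum>n<N. L (F n)) + \<epsilon> * L \<zeta>"
      using L_add[OF Cc_sum[of "{..<N}" F, OF F(1)] Cc_cmult[OF \<zeta>(1)]] L_sum[of "{..<N}" F, OF F(1)] L_cmult[OF \<zeta>(1)]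
      by simp
    finally have "ennreal (L f) \<le> ennreal ((\<Sum>n<N. L (F n)) + \<epsilon> * L \<zeta>)"
      by (rule ennreal_leI)
    also have "\<dots> = (\<Sum>n<N. ennreal (L (F n))) + ennreal (\<epsilon> * L \<zeta>)"
      using L_nonneg[OF F] L\<zeta> \<epsilon> by (simp add: ennreal_plus sum_nonneg sum_ennreal)
    also have "\<dots> \<le> (\<Sum>n. ennreal (L (F n))) + ennreal (\<epsilon> * L \<zeta>)"
      by (intro add_right_mono sum_le_suminf) auto
    finally show ?thesis .
  qed
  show ?thesis
  proof (rule ennreal_le_epsilon)
    fix e :: real assume e: "0 < e"
    \<comment> \<open>The summand 1 keeps the denominator positive when
      \<open>L \<zeta> = 0\<close>.\<close>
    have "e / (L \<zeta> + 1) * L \<zeta> \<le> e"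
      using e L\<zeta> by (simp add: field_simps)
    then have "(\<Sum>n. ennreal (L (F n))) + ennreal (e / (L \<zeta> + 1) * L \<zeta>) \<le> (\<Sum>n. ennreal (L (F n))) + ennreal e"
      by (intro add_left_mono ennreal_leI)
    then show "ennreal (L f) \<le> (\<Sum>n. ennreal (L (F n))) + ennreal e"
      using eps[of "e / (L \<zeta> + 1)"] e L\<zeta> by (meson add_nonneg_pos divide_pos_pos order_trans zero_less_one)
  qed
qed

text \<open>
  Covering by continuous functions instead of open sets makes countable subadditivity immediate;
  only \<open>A \<inter> R\<close> has to be covered, so the complement of \<open>R\<close> is null.
\<close>
definition covers :: "'a set \<Rightarrow> (nat \<Rightarrow> 'a \<Rightarrow> real) set" where
  "covers A = {F. (\<forall>n. F n \<in> Cc R \<and> (\<forall>x. 0 \<le> F n x)) \<and> (\<forall>x\<in>A \<inter> R. 1 \<le> (\<Sum>n. ennreal (F n x)))}"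

definition riesz_outer :: "'a set \<Rightarrow> ennreal" where
  "riesz_outer A = (INF F\<in>covers A. \<Sum>n. ennreal (L (F n)))"

lemma riesz_outer_le: "F \<in> covers A \<Longrightarrow> riesz_outer A \<le> (\<Sum>n. ennreal (L (F n)))"
  unfolding riesz_outer_def by (rule INF_lower)

lemma riesz_outer_mono: "A \<subseteq> B \<Longrightarrow> riesz_outer A \<le> riesz_outer B"
  unfolding riesz_outer_def by (rule INF_superset_mono) (auto simp: covers_def)

lemma riesz_outer_le_single:
  assumes "f \<in> Cc R" "\<And>x. 0 \<le> f x" "\<And>x. x \<in> A \<inter> R \<Longrightarrow> 1 \<le> f x"
  shows "riesz_outer A \<le> ennreal (L f)"
proof -
  define F where "F n = (if n = 0 then f else (\<lambda>_. 0))" for n :: nat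
  have S: "(\<Sum>n. h (F n)) = h f" if "h (\<lambda>_. 0) = 0" for h :: "_ \<Rightarrow> ennreal"
  proof -
    have "(\<Sum>n. h (F n)) = (\<Sum>n\<in>{0}. h (F n))"
      by (rule suminf_finite) (simp_all add: F_def that)
    then show ?thesis by (simp add: F_def)
  qed
  have "1 \<le> (\<Sum>n. ennreal (F n x))" if "x \<in> A \<inter> R" for x
    using S[of "\<lambda>f. ennreal (f x)"] assms(3)[OF that] by (simp add: ennreal_ge_1)
  moreover have "F n \<in> Cc R" "0 \<le> F n x" for n x
    using assms(1,2) by (auto simp: F_def Cc_zero)
  ultimately have "F \<in> covers A"
    unfolding covers_def by simp
  from riesz_outer_le[OF this] show ?thesis
    using S[of "\<lambda>f. ennreal (L f)"] by (simp add: L_zero)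
qed

text \<open>A function below the indicator of \<open>A\<close> is dominated by every cover of
  \<open>A\<close>, so \<open>countable_domination\<close> bounds \<open>L f\<close> by every
  competitor in the infimum. Together with \<open>riesz_outer_le_single\<close> this sandwiches the
  outer measure between values of \<open>L\<close>.\<close>

lemma riesz_outer_ge_single:
  assumes "f \<in> Cc R" "\<And>x. 0 \<le> f x" "\<And>x. f x \<le> 1" "\<And>x. x \<notin> A \<Longrightarrow> f x = 0"
  shows "ennreal (L f) \<le> riesz_outer A"
  unfolding riesz_outer_def
proof (rule INF_greatest)
  fix F assume F: "F \<in> covers A"
  show "ennreal (L f) \<le> (\<Sum>n. ennreal (L (F n)))"
  proof (rule countable_domination)
    fix x assume x: "x \<in> R"
    show "ennreal (f x) \<le> (\<Sum>n. ennreal (F n x))"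
    proof (cases "x \<in> A")
      case True
      have "ennreal (f x) \<le> 1" using assms(3) by (simp add: ennreal_le_1)
      also have "\<dots> \<le> (\<Sum>n. ennreal (F n x))" using F True x by (auto simp: covers_def)
      finally show ?thesis .
    qed (use assms(4) in auto)
  qed (use F assms in \<open>auto simp: covers_def\<close>)
qed

lemma riesz_outer_empty: "riesz_outer {} = 0"
  using riesz_outer_le_single[OF Cc_zero, of "{}"] by (simp add: L_zero)

lemma riesz_outer_countably_subadditive: "riesz_outer (\<Union>n. A n) \<le> (\<Sum>n. riesz_outer (A n))"
proof (rule ennreal_le_epsilon)
  fix e :: real assume e: "0 < e" and fin: "(\<Sum>n. riesz_outer (A n)) < top"
  have "\<exists>F. F \<in> covers (A n) \<and> (\<Sum>i. ennreal (L (F i))) \<le> riesz_outer (A n) + ennreal (e * (1/2) ^ Suc n)" for n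
  proof -
    have "riesz_outer (A n) < riesz_outer (A n) + ennreal (e * (1/2) ^ Suc n)"
      using fin e by (auto simp: less_top dest!: ennreal_suminf_lessD)
    then obtain F where "F \<in> covers (A n)" "(\<Sum>i. ennreal (L (F i))) < riesz_outer (A n) + ennreal (e * (1/2) ^ Suc n)"
      unfolding riesz_outer_def INF_less_iff by blast
    then show ?thesis using less_imp_le by blast
  qed
  then obtain F where F: "\<And>n. F n \<in> covers (A n)"
    and le: "\<And>n. (\<Sum>i. ennreal (L (F n i))) \<le> riesz_outer (A n) + ennreal (e * (1/2) ^ Suc n)"
    by metis
  define G where "G i = case_prod F (prod_decode i)" for i
  \<comment> \<open>Stated for an arbitrary \<open>h\<close>, as the rearrangement is used twice:
    for evaluation at a point and for \<open>L\<close>.\<close>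
  have sumG: "(\<Sum>i. h (G i)) = (\<Sum>n. \<Sum>i. h (F n i))" for h :: "_ \<Rightarrow> ennreal"
    unfolding G_def
    by (subst suminf_ennreal_2dimen[of "\<lambda>n. \<Sum>i. h (F n i)" "\<lambda>p. h (case_prod F p)", symmetric]) simp_all
  have "G \<in> covers (\<Union>n. A n)"
    unfolding covers_def
  proof (intro CollectI conjI allI ballI)
    show "G i \<in> Cc R" "0 \<le> G i x" for i x
      using F by (auto simp: G_def covers_def split: prod.split)
    fix x assume "x \<in> (\<Union>n. A n) \<inter> R"
    then obtain n where "x \<in> A n" "x \<in> R" by blast
    then have "1 \<le> (\<Sum>i. ennreal (F n i x))" using F[of n] by (auto simp: covers_def)
    also have "\<dots> \<le> (\<Sum>n. \<Sum>i. ennreal (F n i x))"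
      using sum_le_suminf[of "\<lambda>n. \<Sum>i. ennreal (F n i x)" "{n}"] by simp
    also have "\<dots> = (\<Sum>i. ennreal (G i x))" using sumG[of "\<lambda>f. ennreal (f x)"] by simp
    finally show "1 \<le> (\<Sum>i. ennreal (G i x))" .
  qed
  then have "riesz_outer (\<Union>n. A n) \<le> (\<Sum>n. \<Sum>i. ennreal (L (F n i)))"
    using riesz_outer_le[of G] sumG[of "\<lambda>f. ennreal (L f)"] by simp
  also have "\<dots> \<le> (\<Sum>n. riesz_outer (A n) + ennreal (e * (1/2) ^ Suc n))"
    by (intro suminf_le le) auto
  also have "\<dots> = (\<Sum>n. riesz_outer (A n)) + (\<Sum>n. ennreal e * ennreal ((1/2) ^ Suc n))"
    using e by (subst suminf_add[symmetric]) (auto simp del: ennreal_suminf_cmult simp add: ennreal_mult[symmetric])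
  also have "\<dots> = (\<Sum>n. riesz_outer (A n)) + ennreal e"
    unfolding ennreal_suminf_cmult
    by (subst suminf_ennreal_eq[OF zero_le_power power_half_series]) auto
  finally show "riesz_outer (\<Union>n. A n) \<le> (\<Sum>n. riesz_outer (A n)) + ennreal e" .
qed

text \<open>The nontrivial half of Caratheodory's condition for open \<open>V\<close>, with
  \<open>A\<close> arbitrary. A continuous cut-off splits every member of a cover exactly, because
  \<open>L\<close> is additive; the passage from the cut-offs to the indicator of \<open>V\<close>
  is monotone convergence of the series.\<close>

lemma riesz_outer_split_open:
  assumes V: "open V"
  shows "riesz_outer (A \<inter> V) + riesz_outer (A - V) \<le> riesz_outer A"
\<comment> \<open>For \<open>V = UNIV\<close> the complement is empty, its \<open>infdist\<close> is
  0, and all functions \<open>g k\<close> below would vanish.\<close>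
proof (cases "V = UNIV")
  case True
  then show ?thesis by (simp add: riesz_outer_empty)
next
  case False
  \<comment> \<open>\<open>g k\<close> increases to the indicator of \<open>V\<close>; a cover \<open>F\<close> of \<open>A\<close> splits into \<open>F (1 - g k)\<close>, covering
    \<open>A - V\<close>, and the increments \<open>F (g (j+1) - g j)\<close>, which together cover \<open>A \<inter> V\<close>.\<close>
  define g where "g k x = min 1 (real k * infdist x (- V))" for k x
  have gc: "continuous_on UNIV (g k)" for k
    unfolding g_def by (intro continuous_intros)
  have g01: "0 \<le> g k x" "g k x \<le> 1" for k x
    by (auto simp: g_def infdist_nonneg)
  have ginc: "g k x \<le> g (Suc k) x" for k x
    unfolding g_def by (intro min.mono mult_right_mono infdist_nonneg) auto
  have gV: "\<exists>k. g k x = 1" if x: "x \<in> V" for x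
  proof -
    have "infdist x (- V) > 0"
      using x V False in_closed_iff_infdist_zero[of "- V" x] infdist_nonneg[of x "- V"] by force
    then obtain k :: nat where "1 < real k * infdist x (- V)"
      using reals_Archimedean3 by blast
    then show ?thesis by (auto simp: g_def intro!: exI[of _ k])
  qed
  have gC: "g k x = 0" if "x \<notin> V" for k x
    using that by (simp add: g_def)
  have main: "riesz_outer (A \<inter> V) + riesz_outer (A - V) \<le> (\<Sum>n. ennreal (L (F n)))" if F: "F \<in> covers A" for F
  proof -
    have FC: "F n \<in> Cc R" and F0: "0 \<le> F n x" for n x using F by (auto simp: covers_def)
    define D where "D n j = (\<lambda>x. F n x * (g (Suc j) x - g j x))" for n j
    have DC: "D n j \<in> Cc R" for n j
      unfolding D_def by (intro Cc_mult FC continuous_intros gc)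
    have D0: "0 \<le> D n j x" for n j x
      using F0 ginc by (simp add: D_def)
    have FgC: "(\<lambda>x. F n x * g k x) \<in> Cc R" "(\<lambda>x. F n x * (1 - g k x)) \<in> Cc R" for n k
      by (intro Cc_mult FC continuous_intros gc)+
    \<comment> \<open>\<open>g 0 = 0\<close>, so the first \<open>k\<close> increments add up to
      \<open>g k\<close>.\<close>
    have tel: "(\<Sum>j<k. D n j x) = F n x * g k x" for n k x
      unfolding D_def sum_distrib_left[symmetric] sum_lessThan_telescope[of "\<lambda>j. g j x"] by (simp add: g_def[of 0])
    have LD: "(\<Sum>j. ennreal (L (D n j))) = (SUP k. ennreal (L (\<lambda>x. F n x * g k x)))" for n
    proof -
      have "(\<Sum>j<k. ennreal (L (D n j))) = ennreal (L (\<lambda>x. F n x * g k x))" for k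
        using L_sum[of "{..<k}" "D n", OF DC] L_nonneg[OF DC D0] by (simp add: tel sum_ennreal)
      then show ?thesis by (simp add: suminf_eq_SUP)
    qed
    define G where "G i = case_prod D (prod_decode i)" for i
    have sumG: "(\<Sum>i. h (G i)) = (\<Sum>n. \<Sum>j. h (D n j))" for h :: "_ \<Rightarrow> ennreal"
      unfolding G_def
      by (subst suminf_ennreal_2dimen[of "\<lambda>n. \<Sum>i. h (D n i)" "\<lambda>p. h (case_prod D p)", symmetric]) simp_all
    have "G \<in> covers (A \<inter> V)"
      unfolding covers_def
    proof (intro CollectI conjI allI ballI)
      show "G i \<in> Cc R" "0 \<le> G i x" for i x
        using DC D0 by (auto simp: G_def split: prod.split)
      fix x assume x: "x \<in> A \<inter> V \<inter> R"
      obtain k where k: "g k x = 1" using gV x by blast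
      have "1 \<le> (\<Sum>n. ennreal (F n x))" using F x by (auto simp: covers_def)
      also have "\<dots> \<le> (\<Sum>n. \<Sum>j. ennreal (D n j x))"
      proof (intro suminf_le)
        fix n
        have "ennreal (F n x) = (\<Sum>j<k. ennreal (D n j x))"
          using tel[of n x k] k D0 by (simp add: sum_ennreal)
        also have "\<dots> \<le> (\<Sum>j. ennreal (D n j x))" by (intro sum_le_suminf) auto
        finally show "ennreal (F n x) \<le> (\<Sum>j. ennreal (D n j x))" .
      qed auto
      finally show "1 \<le> (\<Sum>i. ennreal (G i x))"
        using sumG[of "\<lambda>f. ennreal (f x)"] by simp
    qed
    then have "riesz_outer (A \<inter> V) \<le> (\<Sum>n. \<Sum>j. ennreal (L (D n j)))"
      using riesz_outer_le[of G] sumG[of "\<lambda>f. ennreal (L f)"] by simp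
    also have "\<dots> = (\<Sum>n. SUP k. ennreal (L (\<lambda>x. F n x * g k x)))"
      by (simp add: LD)
    also have "\<dots> = (SUP k. \<Sum>n. ennreal (L (\<lambda>x. F n x * g k x)))"
      by (intro ennreal_suminf_SUP_eq incseq_SucI ennreal_leI L_mono FgC mult_left_mono ginc F0)
    finally have 1: "riesz_outer (A \<inter> V) \<le> (SUP k. \<Sum>n. ennreal (L (\<lambda>x. F n x * g k x)))" .
    have 2: "(\<Sum>n. ennreal (L (\<lambda>x. F n x * g k x))) + riesz_outer (A - V) \<le> (\<Sum>n. ennreal (L (F n)))" for k
    proof -
      have "(\<lambda>n x. F n x * (1 - g k x)) \<in> covers (A - V)"
        unfolding covers_def
        using F by (auto simp: FgC F0 g01 gC covers_def)
      then have "riesz_outer (A - V) \<le> (\<Sum>n. ennreal (L (\<lambda>x. F n x * (1 - g k x))))"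
        by (rule riesz_outer_le)
      then have "(\<Sum>n. ennreal (L (\<lambda>x. F n x * g k x))) + riesz_outer (A - V)
        \<le> (\<Sum>n. ennreal (L (\<lambda>x. F n x * g k x))) + (\<Sum>n. ennreal (L (\<lambda>x. F n x * (1 - g k x))))"
        by (rule add_left_mono)
      also have "\<dots> = (\<Sum>n. ennreal (L (\<lambda>x. F n x * g k x)) + ennreal (L (\<lambda>x. F n x * (1 - g k x))))"
        by (rule suminf_add) auto
      also have "\<dots> = (\<Sum>n. ennreal (L (F n)))"
      proof (rule arg_cong[where f=suminf], rule ext)
        fix n
        have "L (F n) = L (\<lambda>x. F n x * g k x) + L (\<lambda>x. F n x * (1 - g k x))"
          using L_add[OF FgC(1)[of n k] FgC(2)[of n k]] by (simp add: algebra_simps)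
        moreover have "0 \<le> L (\<lambda>x. F n x * g k x)" "0 \<le> L (\<lambda>x. F n x * (1 - g k x))"
          by (auto intro!: L_nonneg FgC mult_nonneg_nonneg simp: F0 g01)
        ultimately show "ennreal (L (\<lambda>x. F n x * g k x)) + ennreal (L (\<lambda>x. F n x * (1 - g k x))) = ennreal (L (F n))"
          by simp
      qed
      finally show ?thesis .
    qed
    have "riesz_outer (A \<inter> V) + riesz_outer (A - V)
        \<le> (SUP k. \<Sum>n. ennreal (L (\<lambda>x. F n x * g k x))) + riesz_outer (A - V)"
      by (rule add_right_mono[OF 1])
    also have "\<dots> = (SUP k. (\<Sum>n. ennreal (L (\<lambda>x. F n x * g k x))) + riesz_outer (A - V))"
      by (rule ennreal_SUP_add_left[symmetric]) simp
    also have "\<dots> \<le> (\<Sum>n. ennreal (L (F n)))"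
      by (rule SUP_least) (rule 2)
    finally show ?thesis .
  qed
  show ?thesis
    unfolding riesz_outer_def[of A] by (rule INF_greatest) (rule main)
qed

definition riesz_measure :: "'a measure" where
  "riesz_measure = measure_of UNIV (sets borel) riesz_outer"

lemma sets_riesz_measure: "sets riesz_measure = sets borel"
  unfolding riesz_measure_def using sets.sigma_sets_eq[of "borel :: 'a measure"] by simp

lemma emeasure_riesz_measure:
  assumes "A \<in> sets borel"
  shows "emeasure riesz_measure A = riesz_outer A"
proof -
  have oms: "outer_measure_space (Pow UNIV) riesz_outer"
    unfolding outer_measure_space_def positive_def increasing_def countably_subadditive_def
    using riesz_outer_empty riesz_outer_mono riesz_outer_countably_subadditive by auto
  have ms: "measure_space UNIV (lambda_system UNIV (Pow UNIV) riesz_outer) riesz_outer"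
    by (rule sigma_algebra.caratheodory_lemma[OF sigma_algebra_Pow oms])
  have opn: "V \<in> lambda_system UNIV (Pow UNIV) riesz_outer" if "open V" for V
  proof -
    have "riesz_outer (V \<inter> A) + riesz_outer ((UNIV - V) \<inter> A) = riesz_outer A" for A
    proof (rule antisym)
      have eq: "(UNIV - V) \<inter> A = A - V" by blast
      show "riesz_outer (V \<inter> A) + riesz_outer ((UNIV - V) \<inter> A) \<le> riesz_outer A"
        using riesz_outer_split_open[OF that, of A] unfolding eq by (simp add: Int_commute)
      \<comment> \<open>Padding with empty sets turns countable into binary subadditivity.\<close>
      define B where "B n = (if n = 0 then V \<inter> A else if n = 1 then A - V else {})" for n :: nat
      have "(\<Union>n. B n) = A"
      proof -
        have "B 0 \<union> B 1 = A" by (auto simp: B_def)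
        moreover have "B n \<subseteq> B 0 \<union> B 1" for n by (auto simp: B_def)
        ultimately show ?thesis by blast
      qed
      moreover have "(\<Sum>n. riesz_outer (B n)) = (\<Sum>n\<in>{0,1}. riesz_outer (B n))"
        by (rule suminf_finite) (auto simp: B_def riesz_outer_empty)
      ultimately show "riesz_outer A \<le> riesz_outer (V \<inter> A) + riesz_outer ((UNIV - V) \<inter> A)"
        using riesz_outer_countably_subadditive[of B] unfolding eq by (simp add: B_def)
    qed
    then show ?thesis by (simp add: lambda_system_def)
  qed
  have sa: "sigma_algebra UNIV (lambda_system UNIV (Pow UNIV) riesz_outer)"
    using ms by (simp add: measure_space_def)
  have "sets borel \<subseteq> lambda_system UNIV (Pow UNIV) riesz_outer"
    unfolding borel_def using sigma_algebra.sigma_sets_subset[OF sa, of "Collect open"] opn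
    by (simp add: sets_measure_of_conv subset_iff)
  then have "measure_space UNIV (sets borel) riesz_outer"
    using measure_down[OF ms] sets.sigma_algebra_axioms[of "borel :: 'a measure"] by simp
  then show ?thesis
    unfolding riesz_measure_def
    using assms by (intro emeasure_measure_of_sigma) (auto simp: measure_space_def)
qed

lemma radon_riesz_measure: "radon_pos_on R riesz_measure"
  unfolding radon_pos_on_def
proof (intro conjI allI impI)
  show "sets riesz_measure = sets borel" by (rule sets_riesz_measure)
  have "emeasure riesz_measure (UNIV - R) \<le> ennreal (L (\<lambda>_. 0))"
    using open_R by (subst emeasure_riesz_measure) (auto intro!: riesz_outer_le_single Cc_zero)
  then show "emeasure riesz_measure (UNIV - R) = 0"
    by (simp add: L_zero)
  fix K assume K: "compact K \<and> K \<subseteq> R"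
  obtain \<zeta> where \<zeta>: "\<zeta> \<in> Cc R" "\<And>x. 0 \<le> \<zeta> x" "\<And>x. x \<in> K \<Longrightarrow> \<zeta> x = 1"
    using Cc_cutoff[OF open_R] K by blast
  have "emeasure riesz_measure K \<le> ennreal (L \<zeta>)"
    using K by (subst emeasure_riesz_measure)
      (auto intro!: riesz_outer_le_single \<zeta> borel_compact simp: \<zeta>(3))
  also have "\<dots> < \<infinity>" by simp
  finally show "emeasure riesz_measure K < \<infinity>" .
qed

end

section \<open>Identifying the functional with an integral\<close>

lemma integrable_Cc:
  assumes \<mu>: "radon_pos_on R \<mu>" and f: "f \<in> Cc R"
  shows "integrable \<mu> f"
proof -
  have sets: "sets \<mu> = sets borel" using \<mu> by (simp add: radon_pos_on_def)
  obtain K where K: "compact K" "K \<subseteq> R" "\<And>x. x \<notin> K \<Longrightarrow> f x = 0"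
    using Cc_E[OF f] by blast
  obtain B where B: "B > 0" "\<And>x. \<bar>f x\<bar> \<le> B" using Cc_bounded[OF f] by blast
  have m: "f \<in> borel_measurable \<mu>"
    using borel_measurable_continuous_onI[OF Cc_continuous[OF f]] measurable_cong_sets[OF sets refl] by blast
  have "integrable \<mu> (\<lambda>x. indicator K x *\<^sub>R B)"
    using \<mu> K by (auto simp: radon_pos_on_def sets intro!: integrable_real_indicator borel_compact)
  then show ?thesis
    by (rule Bochner_Integration.integrable_bound[OF _ m])
      (use B K(3) in \<open>auto simp: indicator_def intro!: AE_I2\<close>)
qed

lemma positive_functional_integral:
  assumes "open R" "radon_pos_on R \<mu>"
  shows "positive_functional R (integral\<^sup>L \<mu>)"
proof
  show "(LINT x|\<mu>. f x + g x) = integral\<^sup>L \<mu> f + integral\<^sup>L \<mu> g" if "f \<in> Cc R" "g \<in> Cc R" for f g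
    using that by (intro Bochner_Integration.integral_add integrable_Cc[OF assms(2)])
qed (use assms in \<open>auto intro!: integral_nonneg\<close>)

text \<open>Cut \<open>f\<close> horizontally into slabs of height \<open>\<epsilon>\<close>: with
  \<open>h k\<close> the \<open>k\<close>-th slab rescaled to values in \<open>[0,1]\<close>,
  \<open>f\<close> is \<open>\<epsilon>\<close> times the sum of the \<open>h k\<close>. Wherever
  slab \<open>k+1\<close> is positive, slab \<open>k\<close> is full, so \<open>layer\<close> bounds
  \<open>I (h (k+1))\<close> by \<open>J (h k)\<close>. The shift by one leaves the bottom slab
  without a partner; \<open>\<zeta>\<close> takes that role at the cost
  \<open>\<epsilon> * J \<zeta>\<close>.\<close>

lemma positive_functional_le_of_layers:
  assumes I: "positive_functional R I" and J: "positive_functional R J"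
    and layer: "\<And>h h'. h \<in> Cc R \<Longrightarrow> h' \<in> Cc R \<Longrightarrow> (\<And>x. 0 \<le> h x) \<Longrightarrow> (\<And>x. h x \<le> 1) \<Longrightarrow> (\<And>x. 0 \<le> h' x)
        \<Longrightarrow> (\<And>x. h x > 0 \<Longrightarrow> h' x \<ge> 1) \<Longrightarrow> I h \<le> J h'"
    and f: "f \<in> Cc R" "\<And>x. 0 \<le> f x"
  shows "I f \<le> J f"
proof -
  interpret I: positive_functional R I by (rule I)
  interpret J: positive_functional R J by (rule J)
  obtain K where K: "compact K" "K \<subseteq> R" "\<And>x. x \<notin> K \<Longrightarrow> f x = 0"
    using Cc_E[OF f(1)] by blast
  obtain \<zeta> where \<zeta>: "\<zeta> \<in> Cc R" "\<And>x. 0 \<le> \<zeta> x" "\<And>x. x \<in> K \<Longrightarrow> \<zeta> x = 1"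
    using Cc_cutoff[OF I.open_R K(1,2)] by blast
  have J\<zeta>: "0 \<le> J \<zeta>" by (rule J.L_nonneg[OF \<zeta>(1,2)])
  obtain B where B: "B > 0" "\<And>x. \<bar>f x\<bar> \<le> B" using Cc_bounded[OF f(1)] by blast
  have eps: "I f \<le> J f + \<epsilon> * J \<zeta>" if \<epsilon>: "\<epsilon> > 0" for \<epsilon>
  proof -
    obtain N :: nat where "B < real N * \<epsilon>"
      using reals_Archimedean3[OF \<epsilon>] by blast
    then have N: "f x \<le> real (Suc N) * \<epsilon>" for x
      using B(2)[of x] \<epsilon> by (simp add: algebra_simps abs_le_iff)
    define h where "h k x = (1/\<epsilon>) * (min (f x) (real (Suc k) * \<epsilon>) - min (f x) (real k * \<epsilon>))" for k x
    have hC: "h k \<in> Cc R" for k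
      unfolding h_def using \<epsilon> by (intro Cc_cmult Cc_diff Cc_min_const f) auto
    have h0: "0 \<le> h k x" for k x
      using \<epsilon> by (auto simp: h_def min_def field_simps)
    have h1: "h k x \<le> 1" for k x
      using \<epsilon> by (auto simp: h_def min_def field_simps)
    have fsum: "f x = (\<Sum>k<Suc N. \<epsilon> * h k x)" for x
    proof -
      have "(\<Sum>k<Suc N. \<epsilon> * h k x) = (\<Sum>k<Suc N. min (f x) (real (Suc k) * \<epsilon>) - min (f x) (real k * \<epsilon>))"
        using \<epsilon> by (simp add: h_def)
      also have "\<dots> = min (f x) (real (Suc N) * \<epsilon>) - min (f x) (real 0 * \<epsilon>)"
        by (rule sum_lessThan_telescope)
      finally show ?thesis using N[of x] f(2)[of x] by simp
    qed
    have step: "I (h (Suc k)) \<le> J (h k)" for k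
    proof (rule layer[OF hC hC h0 h1 h0])
      fix x assume "0 < h (Suc k) x"
      then have "f x > real (Suc k) * \<epsilon>"
        using \<epsilon> by (auto simp: h_def min_def zero_less_divide_iff algebra_simps split: if_splits)
      moreover from this have "f x > real k * \<epsilon>"
        using \<epsilon> by (auto simp: algebra_simps)
      ultimately show "1 \<le> h k x"
        using \<epsilon> by (auto simp: h_def min_def field_simps)
    qed
    have base: "I (h 0) \<le> J \<zeta>"
    proof (rule layer[OF hC \<zeta>(1) h0 h1 \<zeta>(2)])
      fix x assume "0 < h 0 x"
      then have "f x \<noteq> 0" using \<epsilon> by (auto simp: h_def)
      then show "1 \<le> \<zeta> x" using K(3) \<zeta>(3) by force
    qed
    have sumL: "M f = \<epsilon> * (\<Sum>k<Suc N. M (h k))" if "positive_functional R M" for M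
    proof -
      interpret M: positive_functional R M by (rule that)
      have "M f = M (\<lambda>x. \<Sum>k<Suc N. \<epsilon> * h k x)" by (simp only: fsum[symmetric])
      also have "\<dots> = (\<Sum>k<Suc N. M (\<lambda>x. \<epsilon> * h k x))"
        by (rule M.L_sum) (intro Cc_cmult hC)
      finally show ?thesis by (simp only: M.L_cmult[OF hC] sum_distrib_left)
    qed
    have "(\<Sum>k<Suc N. I (h k)) = I (h 0) + (\<Sum>k<N. I (h (Suc k)))"
      by (rule sum.lessThan_Suc_shift)
    also have "\<dots> \<le> J \<zeta> + (\<Sum>k<N. J (h k))"
      by (intro add_mono sum_mono base step)
    also have "\<dots> \<le> J \<zeta> + (\<Sum>k<Suc N. J (h k))"
      using J.L_nonneg[OF hC h0] by simp
    finally have "\<epsilon> * (\<Sum>k<Suc N. I (h k)) \<le> \<epsilon> * (J \<zeta> + (\<Sum>k<Suc N. J (h k)))"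
      using \<epsilon> by (intro mult_left_mono) auto
    then show ?thesis
      using sumL[OF I] sumL[OF J] by (simp only: distrib_left add.commute)
  qed
  show ?thesis
  proof (rule field_le_epsilon)
    fix e :: real assume e: "0 < e"
    have "e / (J \<zeta> + 1) * J \<zeta> \<le> e"
      using e J\<zeta> by (simp add: field_simps)
    then show "I f \<le> J f + e"
      using eps[of "e / (J \<zeta> + 1)"] e J\<zeta> by (smt (verit) divide_pos_pos)
  qed
qed

text \<open>The integral against the constructed measure is a positive functional too, so equality
  follows from two applications of the layer comparison. In both directions the measure of the open
  set \<open>{x. 0 < h x}\<close> is the quantity in between: \<open>L h\<close> and the integral of
  \<open>h\<close> lie below it, while \<open>L h'\<close> and the integral of \<open>h'\<close> lie
  above it.\<close>

lemma riesz_representation: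
  assumes "positive_functional R L"
  shows "\<exists>\<mu>. radon_pos_on R \<mu> \<and> (\<forall>f\<in>Cc R. integral\<^sup>L \<mu> f = L f)"
proof -
  interpret L: positive_functional R L by fact
  let ?\<mu> = "L.riesz_measure"
  note radon = L.radon_riesz_measure
  have J: "positive_functional R (integral\<^sup>L ?\<mu>)"
    by (rule positive_functional_integral[OF L.open_R radon])
  have lev: "{x. 0 < h x} \<in> sets borel" if "h \<in> Cc R" for h
    by (intro borel_open open_Collect_less continuous_intros Cc_continuous[OF that])
  have nn: "ennreal (integral\<^sup>L ?\<mu> h) = (\<integral>\<^sup>+ x. ennreal (h x) \<partial>?\<mu>)" if "h \<in> Cc R" "\<And>x. 0 \<le> h x" for h
    using nn_integral_eq_integral[OF integrable_Cc[OF radon that(1)]] that(2) by simp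
  have LJ: "L h \<le> integral\<^sup>L ?\<mu> h'"
    if h: "h \<in> Cc R" "h' \<in> Cc R" "\<And>x. 0 \<le> h x" "\<And>x. h x \<le> 1" "\<And>x. 0 \<le> h' x" "\<And>x. h x > 0 \<Longrightarrow> h' x \<ge> 1" for h h'
  proof -
    have "ennreal (L h) \<le> emeasure ?\<mu> {x. 0 < h x}"
      unfolding L.emeasure_riesz_measure[OF lev[OF h(1)]]
      by (rule L.riesz_outer_ge_single[OF h(1,3,4)]) (use h(3) in \<open>auto simp: not_less intro: antisym\<close>)
    also have "\<dots> = (\<integral>\<^sup>+ x. indicator {x. 0 < h x} x \<partial>?\<mu>)"
      using lev[OF h(1)] by (simp add: L.sets_riesz_measure)
    also have "\<dots> \<le> (\<integral>\<^sup>+ x. ennreal (h' x) \<partial>?\<mu>)"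
      using h(5,6) by (intro nn_integral_mono) (auto simp: indicator_def ennreal_ge_1)
    finally show ?thesis
      unfolding nn[OF h(2,5), symmetric]
      by (subst (asm) ennreal_le_iff) (use h in \<open>auto intro!: integral_nonneg\<close>)
  qed
  have JL: "integral\<^sup>L ?\<mu> h \<le> L h'"
    if h: "h \<in> Cc R" "h' \<in> Cc R" "\<And>x. 0 \<le> h x" "\<And>x. h x \<le> 1" "\<And>x. 0 \<le> h' x" "\<And>x. h x > 0 \<Longrightarrow> h' x \<ge> 1" for h h'
  proof -
    have "(\<integral>\<^sup>+ x. ennreal (h x) \<partial>?\<mu>) \<le> (\<integral>\<^sup>+ x. indicator {x. 0 < h x} x \<partial>?\<mu>)"
      using h(3,4) by (intro nn_integral_mono) (auto simp: indicator_def ennreal_le_1 not_less ennreal_neg)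
    also have "\<dots> = emeasure ?\<mu> {x. 0 < h x}"
      using lev[OF h(1)] by (simp add: L.sets_riesz_measure)
    also have "\<dots> \<le> ennreal (L h')"
      unfolding L.emeasure_riesz_measure[OF lev[OF h(1)]]
      by (rule L.riesz_outer_le_single[OF h(2,5)]) (use h(6) in auto)
    finally show ?thesis
      unfolding nn[OF h(1,3), symmetric]
      by (subst (asm) ennreal_le_iff) (use L.L_nonneg[OF h(2,5)] in simp_all)
  qed
  have eq0: "integral\<^sup>L ?\<mu> f = L f" if "f \<in> Cc R" "\<And>x. 0 \<le> f x" for f
  proof (rule antisym)
    show "integral\<^sup>L ?\<mu> f \<le> L f"
      by (rule positive_functional_le_of_layers[OF J assms JL that])
    show "L f \<le> integral\<^sup>L ?\<mu> f"
      by (rule positive_functional_le_of_layers[OF assms J LJ that])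
  qed
  have "integral\<^sup>L ?\<mu> f = L f" if f: "f \<in> Cc R" for f
  proof -
    let ?p = "\<lambda>x. max (f x) 0" and ?n = "\<lambda>x. max (-1 * f x) 0"
    have C: "?p \<in> Cc R" "?n \<in> Cc R"
      using Cc_max_zero[OF f] Cc_max_zero[OF Cc_cmult[OF f, of "-1"]] by auto
    have f': "(\<lambda>x. ?p x - ?n x) = f" by auto
    have "integral\<^sup>L ?\<mu> ?p = L ?p" "integral\<^sup>L ?\<mu> ?n = L ?n"
      by (rule eq0; use C in simp)+
    then show ?thesis
      using L.L_diff[OF C] positive_functional.L_diff[OF J C] unfolding f' by simp
  qed
  with radon show ?thesis by blast
qed

section \<open>The time evolution of spatial averages\<close>

lemma bounded_antimono_convergent_at_right:
  fixes A :: "real \<Rightarrow> real"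
  assumes "0 < \<tau>"
    and anti: "\<And>s t. 0 < s \<Longrightarrow> s \<le> t \<Longrightarrow> t < \<tau> \<Longrightarrow> A t \<le> A s"
    and bound: "\<And>s. 0 < s \<Longrightarrow> s < \<tau> \<Longrightarrow> A s \<le> M"
  shows "\<exists>l. (A \<longlongrightarrow> l) (at_right 0)"
proof (intro exI order_tendstoI)
  let ?l = "Sup (A ` {0<..<\<tau>})"
  have bdd: "bdd_above (A ` {0<..<\<tau>})" using bound by (auto intro!: bdd_aboveI2)
  have ne: "A ` {0<..<\<tau>} \<noteq> {}" using dense[OF \<open>0 < \<tau>\<close>] by auto
  fix a
  {
    assume "a < ?l"
    then obtain s where s: "0 < s" "s < \<tau>" "a < A s"
      using less_cSup_iff[OF ne bdd] by auto
    then have "a < A t" if "t > 0" "t < s" for t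
      using anti[of t s] that by force
    then show "\<forall>\<^sub>F t in at_right 0. a < A t"
      unfolding eventually_at_right_field using s(1) by blast
  next
    assume a: "?l < a"
    have "A t < a" if "t > 0" "t < \<tau>" for t
      using cSup_upper[OF _ bdd, of "A t"] a that by force
    then show "\<forall>\<^sub>F t in at_right 0. A t < a"
      unfolding eventually_at_right_field using \<open>0 < \<tau>\<close> by blast
  }
qed

text \<open>A Cauchy criterion along a filter, for functions that are known only to stay eventually
  close to some number at every precision. The approximate limits form a Cauchy sequence because two
  eventual properties hold simultaneously somewhere, which needs
  \<open>F \<noteq> bot\<close>.\<close>

lemma convergent_of_approx:
  fixes f :: "'b \<Rightarrow> real"
  assumes F: "F \<noteq> bot" and ap: "\<And>e. e > 0 \<Longrightarrow> \<exists>l. \<forall>\<^sub>F t in F. \<bar>f t - l\<bar> < e"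
  shows "\<exists>l. (f \<longlongrightarrow> l) F"
proof -
  have "\<forall>n. \<exists>l. \<forall>\<^sub>F t in F. \<bar>f t - l\<bar> < inverse (real (Suc n))"
    using ap by simp
  then obtain l where l: "\<And>n. \<forall>\<^sub>F t in F. \<bar>f t - l n\<bar> < inverse (real (Suc n))"
    by metis
  have dl: "\<bar>l m - l n\<bar> < inverse (real (Suc m)) + inverse (real (Suc n))" for m n
  proof -
    have "\<forall>\<^sub>F t in F. \<bar>l m - l n\<bar> < inverse (real (Suc m)) + inverse (real (Suc n))"
      using l[of m] l[of n] by eventually_elim linarith
    then show ?thesis using F eventually_const_iff by blast
  qed
  have small: "\<exists>N. \<forall>n\<ge>N. inverse (real (Suc n)) < e" if "e > 0" for e :: real
    using order_tendstoD(2)[OF LIMSEQ_inverse_real_of_nat that] by (simp add: eventually_sequentially)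
  have "Cauchy l"
  proof (rule metric_CauchyI)
    fix e :: real assume "0 < e"
    then obtain N where N: "\<forall>n\<ge>N. inverse (real (Suc n)) < e/2" using small[of "e/2"] by auto
    have "dist (l m) (l n) < e" if "m \<ge> N" "n \<ge> N" for m n
      using dl[of m n] N[rule_format, OF that(1)] N[rule_format, OF that(2)] unfolding dist_real_def by linarith
    then show "\<exists>M. \<forall>m\<ge>M. \<forall>n\<ge>M. dist (l m) (l n) < e" by blast
  qed
  then obtain c where c: "l \<longlonglongrightarrow> c" using real_Cauchy_convergent convergent_def by blast
  have "(f \<longlongrightarrow> c) F"
  proof (rule tendstoI)
    fix e :: real assume "0 < e"
    then obtain N where N: "\<forall>n\<ge>N. inverse (real (Suc n)) < e/2" using small[of "e/2"] by auto
    have "\<forall>\<^sub>F n in sequentially. dist (l n) c < e/2" using \<open>0 < e\<close> by (intro tendstoD[OF c]) simp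
    then obtain n where n: "n \<ge> N" "dist (l n) c < e/2"
      unfolding eventually_sequentially by (meson nle_le)
    show "\<forall>\<^sub>F t in F. dist (f t) c < e"
      using l[of n] by eventually_elim (use n N[rule_format, OF n(1)] in \<open>unfold dist_real_def, linarith\<close>)
  qed
  then show ?thesis by blast
qed

section \<open>Integrability and test functions of product form\<close>

lemma set_integrable_mult_continuous:
  fixes f h :: "'b::euclidean_space \<Rightarrow> real"
  assumes f: "set_integrable lborel K f" and K: "compact K" and h: "continuous_on UNIV h"
  shows "set_integrable lborel K (\<lambda>z. f z * h z)"
proof -
  have "bounded (h ` K)"
    by (intro compact_imp_bounded compact_continuous_image K continuous_on_subset[OF h]) auto
  then obtain B where B: "B > 0" "\<And>x. x \<in> K \<Longrightarrow> \<bar>h x\<bar> \<le> B"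
    unfolding bounded_pos by auto
  have int: "integrable lborel (\<lambda>z. indicator K z *\<^sub>R f z)"
    using f by (simp add: set_integrable_def)
  have "integrable lborel (\<lambda>z. indicator K z *\<^sub>R f z * h z)"
  proof (rule Bochner_Integration.integrable_bound)
    show "integrable lborel (\<lambda>z. B * (indicator K z *\<^sub>R f z))"
      using int by (rule integrable_mult_right)
    show "(\<lambda>z. indicator K z *\<^sub>R f z * h z) \<in> borel_measurable lborel"
      using borel_measurable_integrable[OF int] borel_measurable_continuous_onI[OF h]
      by (intro borel_measurable_times) auto
    show "AE z in lborel. norm (indicator K z *\<^sub>R f z * h z) \<le> norm (B * (indicator K z *\<^sub>R f z))"
      using B by (intro AE_I2) (auto simp: abs_mult indicator_def mult.commute[of B] intro!: mult_left_mono)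
  qed
  then show ?thesis by (simp add: set_integrable_def mult.assoc)
qed

lemma integrable_mult_compact_support:
  fixes f h :: "'b::euclidean_space \<Rightarrow> real"
  assumes "set_integrable lborel K f" "compact K"
    and "continuous_on UNIV h" "\<And>z. z \<notin> K \<Longrightarrow> h z = 0"
  shows "integrable lborel (\<lambda>z. f z * h z)"
proof -
  have eq: "(\<lambda>z. indicator K z *\<^sub>R (f z * h z)) = (\<lambda>z. f z * h z)"
    by (rule ext) (use assms(4) in \<open>auto split: split_indicator\<close>)
  show ?thesis
    using set_integrable_mult_continuous[OF assms(1-3)] unfolding set_integrable_def eq .
qed

lemma dderiv_locally_const:
  assumes "open V" "x \<in> V" "\<And>y. y \<in> V \<Longrightarrow> f y = c"
  shows "dderiv [b] f x = 0"
proof -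
  have "((\<lambda>_. c) has_derivative (\<lambda>_. 0)) (at x)" by simp
  then have "(f has_derivative (\<lambda>_. 0)) (at x)"
    by (rule has_derivative_transform_within_open[OF _ assms(1,2)]) (use assms(3) in auto)
  from frechet_derivative_at[OF this] show ?thesis by (metis dderiv.simps)
qed

lemma dderiv_zero_off:
  assumes "closed K" "\<And>x. x \<notin> K \<Longrightarrow> f x = 0" "x \<notin> K"
  shows "dderiv [b] f x = 0"
  by (rule dderiv_locally_const[of "- K" _ _ 0]) (use assms in auto)

lemma smooth_tensor:
  fixes \<xi> :: "'a::euclidean_space \<Rightarrow> real" and \<theta> :: "real \<Rightarrow> real"
  assumes "smooth \<xi>" "smooth \<theta>"
  shows "smooth (\<lambda>z. \<xi> (fst z) * \<theta> (snd z))"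
  using smooth_affine_compose[OF assms(1) bounded_linear_fst, of 0]
    smooth_affine_compose[OF assms(2) bounded_linear_snd, of 0]
  by (intro smooth_mult) simp_all

lemma frechet_derivative_tensor:
  fixes \<xi> :: "'a::euclidean_space \<Rightarrow> real" and \<theta> :: "real \<Rightarrow> real"
  assumes "smooth \<xi>" "smooth \<theta>"
  shows "frechet_derivative (\<lambda>z. \<xi> (fst z) * \<theta> (snd z)) (at z)
    = (\<lambda>v. \<xi> (fst z) * frechet_derivative \<theta> (at (snd z)) (snd v) + frechet_derivative \<xi> (at (fst z)) (fst v) * \<theta> (snd z))"
proof (rule frechet_derivative_at[symmetric], rule has_derivative_mult)
  show "((\<lambda>z. \<xi> (fst z)) has_derivative (\<lambda>v. frechet_derivative \<xi> (at (fst z)) (fst v))) (at z)"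
    using frechet_derivative_compose_affine[OF smooth_differentiable[OF assms(1)] bounded_linear_fst, where c=0] by simp
  show "((\<lambda>z. \<theta> (snd z)) has_derivative (\<lambda>v. frechet_derivative \<theta> (at (snd z)) (snd v))) (at z)"
    using frechet_derivative_compose_affine[OF smooth_differentiable[OF assms(2)] bounded_linear_snd, where c=0] by simp
qed

lemma dderiv_tensor:
  fixes \<xi> :: "'a::euclidean_space \<Rightarrow> real" and \<theta> :: "real \<Rightarrow> real"
  assumes "smooth \<xi>" "smooth \<theta>"
  shows "dderiv [(b, 0)] (\<lambda>z. \<xi> (fst z) * \<theta> (snd z)) = (\<lambda>z. dderiv [b] \<xi> (fst z) * \<theta> (snd z))"
    and "dderiv [(0, 1)] (\<lambda>z. \<xi> (fst z) * \<theta> (snd z)) = (\<lambda>z. \<xi> (fst z) * dderiv [1] \<theta> (snd z))"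
  using linear_0[OF linear_frechet_derivative[OF smooth_differentiable[OF assms(1)]]]
    linear_0[OF linear_frechet_derivative[OF smooth_differentiable[OF assms(2)]]]
  by (auto simp: frechet_derivative_tensor[OF assms])

lemma test_fun_tensor:
  assumes "smooth \<xi>" "smooth \<theta>" "compact K" "K \<subseteq> \<Omega>" "\<And>x. x \<notin> K \<Longrightarrow> \<xi> x = 0"
    "{a..b} \<subseteq> tint T" "\<And>t. t \<notin> {a..b} \<Longrightarrow> \<theta> t = 0"
  shows "test_fun (cyl \<Omega> T) (\<lambda>z. \<xi> (fst z) * \<theta> (snd z))"
proof -
  have KI: "compact (K \<times> {a..b})" using assms(3) by (intro compact_Times) auto
  have sub: "closure {z. \<xi> (fst z) * \<theta> (snd z) \<noteq> 0} \<subseteq> K \<times> {a..b}"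
  proof (rule closure_minimal[OF _ compact_imp_closed[OF KI]], rule subsetI)
    fix z assume "z \<in> {z. \<xi> (fst z) * \<theta> (snd z) \<noteq> 0}"
    then show "z \<in> K \<times> {a..b}"
      using assms(5)[of "fst z"] assms(7)[of "snd z"] unfolding mem_Times_iff by fastforce
  qed
  have "compact (K \<times> {a..b} \<inter> closure {z. \<xi> (fst z) * \<theta> (snd z) \<noteq> 0})"
    by (rule compact_Int_closed[OF KI closed_closure])
  then have "compact (closure {z. \<xi> (fst z) * \<theta> (snd z) \<noteq> 0})"
    by (simp only: Int_absorb1[OF sub])
  moreover have "K \<times> {a..b} \<subseteq> \<Omega> \<times> tint T" using assms(4,6) by (rule Sigma_mono)
  ultimately show ?thesis
    unfolding test_fun_def cyl_def
    using smooth_tensor[OF assms(1,2)] subset_trans[OF sub] by simp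
qed

lemma tint_down: "t \<in> tint T \<Longrightarrow> 0 < s \<Longrightarrow> s \<le> t \<Longrightarrow> s \<in> tint T"
  unfolding tint_def using le_less_trans[of "ereal s" "ereal t" T] by simp

text \<open>Provides the room to the right of \<open>t\<close> in which a time cut-off can come down
  to 0.\<close>

lemma tint_up:
  assumes "t \<in> tint T"
  obtains t' where "t < t'" "t' \<in> tint T"
proof -
  obtain z where z: "ereal t < z" "z < T" using assms dense by (auto simp: tint_def)
  then obtain r where "z = ereal r" by (cases z) auto
  with z assms show ?thesis by (intro that[of r]) (auto simp: tint_def)
qed

lemma tint_nonempty: "T > 0 \<Longrightarrow> \<exists>t. t \<in> tint T"
proof -
  assume "T > 0"
  then obtain z where z: "0 < z" "z < T" using dense by blast
  then obtain r where "z = ereal r" by (cases z) auto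
  with z show ?thesis by (auto simp: tint_def)
qed

text \<open>\<open>k\<close> is the derivative of a step rising from 0 to 1 on
  \<open>[s, s+w]\<close>, hence a nonnegative kernel of mass 1 carried by that interval.
  Integrating \<open>U\<close> against it is an average of \<open>U\<close> just to the right of
  \<open>s\<close>.\<close>

lemma step_average:
  fixes H U :: "real \<Rightarrow> real"
  assumes H: "smooth H" "\<And>s. s \<le> 0 \<Longrightarrow> H s = 0" "\<And>s. s \<ge> 1 \<Longrightarrow> H s = 1" "\<And>s. dderiv [1] H s \<ge> 0"
    and w: "w > 0" and U: "continuous_on {s..s+w} U" "\<And>\<sigma>. \<sigma> \<in> {s..s+w} \<Longrightarrow> \<bar>U \<sigma> - c\<bar> \<le> \<epsilon>"
  defines "k \<equiv> dderiv [1] (\<lambda>\<sigma>. H ((1/w) * \<sigma> + (- s/w)))"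
  shows "integrable lborel (\<lambda>\<sigma>. U \<sigma> * k \<sigma>)" "\<bar>(LINT \<sigma>|lborel. U \<sigma> * k \<sigma>) - c\<bar> \<le> \<epsilon>"
proof -
  have sm: "smooth (\<lambda>\<sigma>. H ((1/w) * \<sigma> + (- s/w)))"
    by (rule smooth_affine_compose[OF H(1) bounded_linear_mult_right])
  have sk: "smooth k" unfolding k_def by (rule smooth_dderiv[OF sm]) simp
  have D: "((\<lambda>\<sigma>. H ((1/w) * \<sigma> + (- s/w))) has_real_derivative k \<sigma>) (at \<sigma>)" for \<sigma>
    unfolding k_def by (rule smooth_real_derivative[OF sm])
  have k0: "k \<sigma> \<ge> 0" for \<sigma>
  proof -
    have "((\<lambda>\<sigma>. H ((1/w) * \<sigma> + (- s/w))) has_real_derivative dderiv [1] H ((1/w) * \<sigma> + (- s/w)) * (1/w)) (at \<sigma>)"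
      by (rule DERIV_chain2[OF smooth_real_derivative[OF H(1)]]) (use w in \<open>auto intro!: derivative_eq_intros\<close>)
    then have "k \<sigma> = dderiv [1] H ((1/w) * \<sigma> + (- s/w)) * (1/w)" using D DERIV_unique by blast
    then show ?thesis using H(4) w by (simp del: dderiv.simps)
  qed
  have koff: "k \<sigma> = 0" if \<sigma>: "\<sigma> \<notin> {s..s+w}" for \<sigma>
  proof (cases "\<sigma> < s")
    case True
    show ?thesis unfolding k_def
      by (rule dderiv_locally_const[of "{..<s}" _ _ 0])
        (use True w in \<open>auto intro!: H(2) simp: field_simps\<close>)
  next
    case False
    show ?thesis unfolding k_def
      by (rule dderiv_locally_const[of "{s+w<..}" _ _ 1])
        (use False \<sigma> w in \<open>auto intro!: H(3) simp: field_simps\<close>)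
  qed
  have kind: "k \<sigma> * indicator {s..s+w} \<sigma> = k \<sigma>" for \<sigma>
    using koff[of \<sigma>] by (auto simp: indicator_def)
  have "has_bochner_integral lborel (\<lambda>\<sigma>. k \<sigma> * indicator {s..s+w} \<sigma>)
     (H ((1/w) * (s+w) + (- s/w)) - H ((1/w) * s + (- s/w)))"
    by (rule has_bochner_integral_FTC_Icc_real)
      (use w D smooth_continuous_on[OF sk, of UNIV] in \<open>auto simp: continuous_on_eq_continuous_at\<close>)
  moreover have "H ((1/w) * (s+w) + (- s/w)) = 1" "H ((1/w) * s + (- s/w)) = 0"
    using w by (auto intro!: H(2,3) simp: field_simps)
  ultimately have hk: "has_bochner_integral lborel k 1" by (simp add: kind)
  have intU: "set_integrable lborel {s..s+w} U"
    unfolding set_integrable_def by (rule borel_integrable_compact) (use U in auto)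
  show int: "integrable lborel (\<lambda>\<sigma>. U \<sigma> * k \<sigma>)"
    by (rule integrable_mult_compact_support[OF intU]) (auto intro: smooth_continuous_on sk koff)
  have intk: "integrable lborel k" using hk by (rule integrable.intros)
  have "(LINT \<sigma>|lborel. U \<sigma> * k \<sigma>) - c = (LINT \<sigma>|lborel. U \<sigma> * k \<sigma> - c * k \<sigma>)"
    using int intk has_bochner_integral_integral_eq[OF hk] by simp
  also have "\<bar>\<dots>\<bar> \<le> (LINT \<sigma>|lborel. \<epsilon> * k \<sigma>)"
  proof -
    have "norm (LINT \<sigma>|lborel. U \<sigma> * k \<sigma> - c * k \<sigma>) \<le> (LINT \<sigma>|lborel. \<epsilon> * k \<sigma>)"
    proof (rule Bochner_Integration.integral_norm_bound_integral)
      fix \<sigma>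
      show "norm (U \<sigma> * k \<sigma> - c * k \<sigma>) \<le> \<epsilon> * k \<sigma>"
      proof (cases "\<sigma> \<in> {s..s+w}")
        case True
        have "norm (U \<sigma> * k \<sigma> - c * k \<sigma>) = \<bar>U \<sigma> - c\<bar> * k \<sigma>"
          using k0[of \<sigma>] by (simp add: abs_mult left_diff_distrib[symmetric])
        also have "\<dots> \<le> \<epsilon> * k \<sigma>" by (intro mult_right_mono U(2)[OF True] k0)
        finally show ?thesis .
      qed (simp add: koff)
    qed (use int intk in auto)
    then show ?thesis by simp
  qed
  also have "\<dots> = \<epsilon>" using has_bochner_integral_integral_eq[OF hk] by simp
  finally show "\<bar>(LINT \<sigma>|lborel. U \<sigma> * k \<sigma>) - c\<bar> \<le> \<epsilon>" .
qed

lemma dderiv_sum_bound: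
  fixes \<xi> :: "'a::euclidean_space \<Rightarrow> real"
  assumes "smooth \<xi>" "compact K" "\<And>x. x \<notin> K \<Longrightarrow> \<xi> x = 0"
  obtains B where "B > 0" "\<And>x. (\<Sum>b\<in>Basis. \<bar>dderiv [b] \<xi> x\<bar>) \<le> B"
proof -
  have "(\<lambda>x. \<Sum>b\<in>Basis. \<bar>dderiv [b] \<xi> x\<bar>) \<in> Cc UNIV"
  proof (rule Cc_I[OF _ assms(2)])
    show "continuous_on UNIV (\<lambda>x. \<Sum>b\<in>Basis. \<bar>dderiv [b] \<xi> x\<bar>)"
      by (intro continuous_on_sum continuous_on_rabs smooth_continuous_on smooth_dderiv assms(1))
    show "(\<Sum>b\<in>Basis. \<bar>dderiv [b] \<xi> x\<bar>) = 0" if "x \<notin> K" for x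
      using dderiv_zero_off[OF compact_imp_closed[OF assms(2)] assms(3) that] by (simp del: dderiv.simps)
  qed auto
  then obtain B where "B > 0" "\<And>x. \<bar>\<Sum>b\<in>Basis. \<bar>dderiv [b] \<xi> x\<bar>\<bar> \<le> B"
    using Cc_bounded by blast
  then show ?thesis using that abs_le_D1 by blast
qed

section \<open>Weak solutions with a fixed weak gradient\<close>

locale weak_sol =
  fixes q :: real and \<Omega> :: "'a::euclidean_space set" and T :: ereal
    and u :: "'a \<Rightarrow> real \<Rightarrow> real" and g :: "'a \<Rightarrow> real \<Rightarrow> 'a"
  assumes q: "q > 1" and open_\<Omega>: "open \<Omega>" and T: "T > 0"
    and u_slice: "compact K \<Longrightarrow> K \<subseteq> \<Omega> \<Longrightarrow> t \<in> tint T \<Longrightarrow> set_integrable lborel K (\<lambda>x. u x t)"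
    and u_cont: "compact K \<Longrightarrow> K \<subseteq> \<Omega> \<Longrightarrow> t \<in> tint T \<Longrightarrow>
        ((\<lambda>s. LINT x:K|lborel. \<bar>u x s - u x t\<bar>) \<longlongrightarrow> 0) (at t within tint T)"
    and u_loc: "compact D \<Longrightarrow> D \<subseteq> cyl \<Omega> T \<Longrightarrow> set_integrable lborel D (\<lambda>z. u (fst z) (snd z))"
    and g_loc: "compact D \<Longrightarrow> D \<subseteq> cyl \<Omega> T \<Longrightarrow> set_integrable lborel D (\<lambda>z. g (fst z) (snd z))"
    and gq_loc: "compact D \<Longrightarrow> D \<subseteq> cyl \<Omega> T \<Longrightarrow> set_integrable lborel D (\<lambda>z. norm (g (fst z) (snd z)) powr q)"
    and grad: "test_fun (cyl \<Omega> T) \<phi> \<Longrightarrow> b \<in> Basis \<Longrightarrow>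
        (LINT z|lborel. u (fst z) (snd z) * dderiv [(b, 0)] \<phi> z)
          = - (LINT z|lborel. (g (fst z) (snd z) \<bullet> b) * \<phi> z)"
    and eqn: "test_fun (cyl \<Omega> T) \<phi> \<Longrightarrow>
        (LINT z|lborel. - u (fst z) (snd z) * dderiv [(0, 1)] \<phi> z
              - u (fst z) (snd z) * (\<Sum>b\<in>Basis. dderiv [(b, 0), (b, 0)] \<phi> z)
              + norm (g (fst z) (snd z)) powr q * \<phi> z) = 0"
    and u_nonneg: "x \<in> \<Omega> \<Longrightarrow> t \<in> tint T \<Longrightarrow> 0 \<le> u x t"
begin

definition pairing :: "('a \<Rightarrow> real) \<Rightarrow> real \<Rightarrow> real" where
  "pairing \<xi> t = (LINT x|lborel. u x t * \<xi> x)"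

text \<open>This is \<open>\<nabla>u \<cdot> \<nabla>\<xi> + |\<nabla>u|^q \<xi>\<close>, the
  density of the rate at which \<open>pairing \<xi>\<close> decreases in time. The inner product is
  written in coordinates to match \<open>dderiv\<close>.\<close>

definition flux :: "('a \<Rightarrow> real) \<Rightarrow> 'a \<times> real \<Rightarrow> real" where
  "flux \<xi> z = (\<Sum>b\<in>Basis. (g (fst z) (snd z) \<bullet> b) * dderiv [b] \<xi> (fst z))
     + norm (g (fst z) (snd z)) powr q * \<xi> (fst z)"

lemma integrable_pairing:
  assumes "\<xi> \<in> Cc \<Omega>" "t \<in> tint T"
  shows "integrable lborel (\<lambda>x. u x t * \<xi> x)"
proof -
  obtain K where K: "compact K" "K \<subseteq> \<Omega>" "\<And>x. x \<notin> K \<Longrightarrow> \<xi> x = 0"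
    using Cc_E[OF assms(1)] by blast
  show ?thesis
    by (rule integrable_mult_compact_support[OF u_slice[OF K(1,2) assms(2)] K(1) Cc_continuous[OF assms(1)] K(3)])
qed

lemma continuous_on_pairing:
  assumes \<xi>: "\<xi> \<in> Cc \<Omega>"
  shows "continuous_on (tint T) (pairing \<xi>)"
  unfolding continuous_on_def
proof
  fix t assume t: "t \<in> tint T"
  obtain K where K: "compact K" "K \<subseteq> \<Omega>" "\<And>x. x \<notin> K \<Longrightarrow> \<xi> x = 0"
    using Cc_E[OF \<xi>] by blast
  obtain B where B: "B > 0" "\<And>x. \<bar>\<xi> x\<bar> \<le> B" using Cc_bounded[OF \<xi>] by blast
  have le: "norm (pairing \<xi> s - pairing \<xi> t) \<le> B * (LINT x:K|lborel. \<bar>u x s - u x t\<bar>)" if s: "s \<in> tint T" for s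
  proof -
    have "pairing \<xi> s - pairing \<xi> t = (LINT x|lborel. u x s * \<xi> x - u x t * \<xi> x)"
      unfolding pairing_def using integrable_pairing[OF \<xi>] s t by simp
    also have "norm \<dots> \<le> (LINT x|lborel. B * (indicator K x *\<^sub>R \<bar>u x s - u x t\<bar>))"
    proof (rule Bochner_Integration.integral_norm_bound_integral)
      show "integrable lborel (\<lambda>x. u x s * \<xi> x - u x t * \<xi> x)"
        using integrable_pairing[OF \<xi>] s t by simp
      have "set_integrable lborel K (\<lambda>x. u x s - u x t)"
        by (intro set_integral_diff(1) u_slice K s t)
      then have "set_integrable lborel K (\<lambda>x. \<bar>u x s - u x t\<bar>)"
        by (rule set_integrable_abs)
      then show "integrable lborel (\<lambda>x. B * (indicator K x *\<^sub>R \<bar>u x s - u x t\<bar>))"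
        unfolding set_integrable_def by (rule integrable_mult_right)
      fix x
      have "norm (u x s * \<xi> x - u x t * \<xi> x) = \<bar>\<xi> x\<bar> * \<bar>u x s - u x t\<bar>"
        by (simp only: left_diff_distrib[symmetric] abs_mult real_norm_def) (rule mult.commute)
      also have "\<dots> \<le> B * (indicator K x *\<^sub>R \<bar>u x s - u x t\<bar>)"
        using K(3)[of x] B(2)[of x] by (cases "x \<in> K") (auto intro!: mult_right_mono)
      finally show "norm (u x s * \<xi> x - u x t * \<xi> x) \<le> B * (indicator K x *\<^sub>R \<bar>u x s - u x t\<bar>)" .
    qed
    finally show ?thesis by (simp add: set_lebesgue_integral_def)
  qed
  have "((\<lambda>s. pairing \<xi> s - pairing \<xi> t) \<longlongrightarrow> 0) (at t within tint T)"
  proof (rule Lim_null_comparison)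
    show "\<forall>\<^sub>F s in at t within tint T. norm (pairing \<xi> s - pairing \<xi> t) \<le> B * (LINT x:K|lborel. \<bar>u x s - u x t\<bar>)"
      using le by (simp add: eventually_at_filter)
    show "((\<lambda>s. B * (LINT x:K|lborel. \<bar>u x s - u x t\<bar>)) \<longlongrightarrow> 0) (at t within tint T)"
      using tendsto_mult_right_zero[OF u_cont[OF K(1,2) t], of B] .
  qed
  then show "(pairing \<xi> \<longlongrightarrow> pairing \<xi> t) (at t within tint T)"
    by (rule LIM_zero_cancel)
qed

lemma cylinder_subset: "K \<subseteq> \<Omega> \<Longrightarrow> {a..b} \<subseteq> tint T \<Longrightarrow> K \<times> {a..b} \<subseteq> cyl \<Omega> T"
  unfolding cyl_def by (rule Sigma_mono)

lemma cylinder_integrable: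
  assumes K: "compact K" "K \<subseteq> \<Omega>" and ab: "{a..b} \<subseteq> tint T"
    and h: "continuous_on UNIV h"
  shows "set_integrable lborel (K \<times> {a..b}) (\<lambda>z. u (fst z) (snd z) * h z)"
    and "set_integrable lborel (K \<times> {a..b}) (\<lambda>z. (g (fst z) (snd z) \<bullet> v) * h z)"
    and "set_integrable lborel (K \<times> {a..b}) (\<lambda>z. norm (g (fst z) (snd z)) powr q * h z)"
proof -
  have C: "compact (K \<times> {a..b})" using K by (intro compact_Times) auto
  note S = cylinder_subset[OF K(2) ab]
  show "set_integrable lborel (K \<times> {a..b}) (\<lambda>z. u (fst z) (snd z) * h z)"
    by (rule set_integrable_mult_continuous[OF u_loc[OF C S] C h])
  show "set_integrable lborel (K \<times> {a..b}) (\<lambda>z. norm (g (fst z) (snd z)) powr q * h z)"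
    by (rule set_integrable_mult_continuous[OF gq_loc[OF C S] C h])
  have "integrable lborel (\<lambda>z. (indicator (K \<times> {a..b}) z *\<^sub>R g (fst z) (snd z)) \<bullet> v)"
    using g_loc[OF C S] unfolding set_integrable_def by (intro integrable_inner_left) auto
  then have "set_integrable lborel (K \<times> {a..b}) (\<lambda>z. g (fst z) (snd z) \<bullet> v)"
    by (simp add: set_integrable_def)
  then show "set_integrable lborel (K \<times> {a..b}) (\<lambda>z. (g (fst z) (snd z) \<bullet> v) * h z)"
    by (rule set_integrable_mult_continuous[OF _ C h])
qed

text \<open>The equation is tested with \<open>\<xi>(x) \<theta>(t)\<close>. Each second derivative
  in the Laplacian is removed by the definition of the weak gradient, applied to the test function
  \<open>dderiv [b] \<xi>\<close> times \<open>\<theta>\<close>. Only first derivatives of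
  \<open>\<xi>\<close> survive, and they multiply the gradient of \<open>u\<close> instead of
  \<open>u\<close>.\<close>

lemma weak_identity:
  assumes \<xi>: "smooth \<xi>" and K: "compact K" "K \<subseteq> \<Omega>" and off: "\<And>x. x \<notin> K \<Longrightarrow> \<xi> x = 0"
    and \<theta>: "smooth \<theta>" and ab: "{a..b} \<subseteq> tint T" and \<theta>off: "\<And>t. t \<notin> {a..b} \<Longrightarrow> \<theta> t = 0"
  shows "(LINT t|lborel. pairing \<xi> t * dderiv [1] \<theta> t) = (LINT z|lborel. flux \<xi> z * \<theta> (snd z))"
proof -
  let ?u = "\<lambda>z. u (fst z) (snd z)" and ?g = "\<lambda>z. g (fst z) (snd z)"
  let ?\<phi> = "\<lambda>z. \<xi> (fst z) * \<theta> (snd z)"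
  let ?C = "K \<times> {a..b}"
  have s1: "smooth (dderiv [b] \<xi>)" if "b \<in> Basis" for b by (rule smooth_dderiv[OF \<xi> that])
  have s2: "smooth (dderiv [b] (dderiv [b] \<xi>))" if "b \<in> Basis" for b by (rule smooth_dderiv[OF s1[OF that] that])
  have s\<theta>: "smooth (dderiv [1] \<theta>)" by (rule smooth_dderiv[OF \<theta>]) simp
  note off1 = dderiv_zero_off[OF compact_imp_closed[OF K(1)] off]
  note off2 = dderiv_zero_off[OF compact_imp_closed[OF K(1)] off1]
  have \<theta>off1: "dderiv [1] \<theta> t = 0" if "t \<notin> {a..b}" for t
    by (rule dderiv_zero_off[OF _ \<theta>off that]) auto
  have cont: "continuous_on UNIV (\<lambda>z. \<alpha> (fst z) * \<beta> (snd z))" if "smooth \<alpha>" "smooth \<beta>"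
    for \<alpha> :: "'a \<Rightarrow> real" and \<beta> :: "real \<Rightarrow> real"
    by (rule smooth_continuous_on[OF smooth_tensor[OF that]])
  have int: "integrable lborel (\<lambda>z. f z * (\<alpha> (fst z) * \<beta> (snd z)))"
    if "set_integrable lborel ?C (\<lambda>z. f z * (\<alpha> (fst z) * \<beta> (snd z)))"
      "\<And>x. x \<notin> K \<Longrightarrow> \<alpha> x = 0" "\<And>t. t \<notin> {a..b} \<Longrightarrow> \<beta> t = 0"
    for f :: "'a \<times> real \<Rightarrow> real" and \<alpha> :: "'a \<Rightarrow> real" and \<beta> :: "real \<Rightarrow> real"
  proof -
    have "(\<lambda>z. indicator ?C z *\<^sub>R (f z * (\<alpha> (fst z) * \<beta> (snd z)))) = (\<lambda>z. f z * (\<alpha> (fst z) * \<beta> (snd z)))"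
    proof
      fix z show "indicator ?C z *\<^sub>R (f z * (\<alpha> (fst z) * \<beta> (snd z))) = f z * (\<alpha> (fst z) * \<beta> (snd z))"
        using that(2)[of "fst z"] that(3)[of "snd z"]
        by (cases "z \<in> ?C") (auto simp: mem_Times_iff)
    qed
    then show ?thesis using that(1) by (simp add: set_integrable_def)
  qed
  let ?p = "\<lambda>z. ?u z * (\<xi> (fst z) * dderiv [1] \<theta> (snd z))"
  let ?r = "\<lambda>b z. ?u z * (dderiv [b] (dderiv [b] \<xi>) (fst z) * \<theta> (snd z))"
  let ?n = "\<lambda>z. norm (?g z) powr q * (\<xi> (fst z) * \<theta> (snd z))"
  let ?v = "\<lambda>b z. (?g z \<bullet> b) * (dderiv [b] \<xi> (fst z) * \<theta> (snd z))"
  have ip: "integrable lborel ?p"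
    by (rule int[OF cylinder_integrable(1)[OF K ab cont[OF \<xi> s\<theta>]] off \<theta>off1])
  have ir: "integrable lborel (?r b)" if "b \<in> Basis" for b
    by (rule int[OF cylinder_integrable(1)[OF K ab cont[OF s2[OF that] \<theta>]] off2 \<theta>off])
  have inn: "integrable lborel ?n"
    by (rule int[OF cylinder_integrable(3)[OF K ab cont[OF \<xi> \<theta>]] off \<theta>off])
  have iv: "integrable lborel (?v b)" if "b \<in> Basis" for b
    by (rule int[OF cylinder_integrable(2)[OF K ab cont[OF s1[OF that] \<theta>]] off1 \<theta>off])
  have Dbb: "dderiv [(b, 0), (b, 0)] ?\<phi> = (\<lambda>z. dderiv [b] (dderiv [b] \<xi>) (fst z) * \<theta> (snd z))" if "b \<in> Basis" for b
  proof -
    have "dderiv [(b, 0), (b, 0)] ?\<phi> = dderiv [(b, 0)] (dderiv [(b, 0)] ?\<phi>)"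
      using dderiv_append[of "[(b, 0)]" "[(b, 0)]" ?\<phi>] by simp
    then show ?thesis
      by (simp only: dderiv_tensor(1)[OF \<xi> \<theta>] dderiv_tensor(1)[OF s1[OF that] \<theta>])
  qed
  have "0 = (LINT z|lborel. - ?u z * dderiv [(0, 1)] ?\<phi> z
              - ?u z * (\<Sum>b\<in>Basis. dderiv [(b, 0), (b, 0)] ?\<phi> z)
              + norm (?g z) powr q * ?\<phi> z)"
    by (rule eqn[symmetric], rule test_fun_tensor[OF \<xi> \<theta> K off ab \<theta>off])
  also have "\<dots> = (LINT z|lborel. (- ?p z - (\<Sum>b\<in>Basis. ?r b z)) + ?n z)"
    by (intro Bochner_Integration.integral_cong refl)
      (simp add: dderiv_tensor(2)[OF \<xi> \<theta>] Dbb sum_distrib_left del: dderiv.simps)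
  also have "\<dots> = (LINT z|lborel. - ?p z - (\<Sum>b\<in>Basis. ?r b z)) + integral\<^sup>L lborel ?n"
    by (intro Bochner_Integration.integral_add Bochner_Integration.integrable_diff Bochner_Integration.integrable_minus
        Bochner_Integration.integrable_sum ip ir inn)
  also have "(LINT z|lborel. - ?p z - (\<Sum>b\<in>Basis. ?r b z)) = (LINT z|lborel. - ?p z) - (LINT z|lborel. (\<Sum>b\<in>Basis. ?r b z))"
    by (intro Bochner_Integration.integral_diff Bochner_Integration.integrable_minus
        Bochner_Integration.integrable_sum ip ir)
  also have "(LINT z|lborel. (\<Sum>b\<in>Basis. ?r b z)) = (\<Sum>b\<in>Basis. integral\<^sup>L lborel (?r b))"
    by (rule Bochner_Integration.integral_sum[OF ir])
  also have "\<dots> = (\<Sum>b\<in>Basis. - integral\<^sup>L lborel (?v b))"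
  proof (rule sum.cong[OF refl])
    fix b :: 'a assume b: "b \<in> Basis"
    have tf: "test_fun (cyl \<Omega> T) (\<lambda>z. dderiv [b] \<xi> (fst z) * \<theta> (snd z))"
      by (rule test_fun_tensor[OF s1[OF b] \<theta> K off1 ab \<theta>off])
    show "integral\<^sup>L lborel (?r b) = - integral\<^sup>L lborel (?v b)"
      using grad[OF tf b] by (simp only: dderiv_tensor(1)[OF s1[OF b] \<theta>])
  qed
  finally have 1: "integral\<^sup>L lborel ?p = (\<Sum>b\<in>Basis. integral\<^sup>L lborel (?v b)) + integral\<^sup>L lborel ?n"
    by (simp add: sum_negf del: dderiv.simps)
  have "(LINT z|lborel. flux \<xi> z * \<theta> (snd z)) = (LINT z|lborel. (\<Sum>b\<in>Basis. ?v b z) + ?n z)"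
    by (intro Bochner_Integration.integral_cong refl)
      (simp add: flux_def distrib_right sum_distrib_right mult.assoc del: dderiv.simps)
  also have "\<dots> = (LINT z|lborel. (\<Sum>b\<in>Basis. ?v b z)) + integral\<^sup>L lborel ?n"
    by (intro Bochner_Integration.integral_add Bochner_Integration.integrable_sum iv inn)
  also have "(LINT z|lborel. (\<Sum>b\<in>Basis. ?v b z)) = (\<Sum>b\<in>Basis. integral\<^sup>L lborel (?v b))"
    by (rule Bochner_Integration.integral_sum[OF iv])
  finally have 2: "(LINT z|lborel. flux \<xi> z * \<theta> (snd z)) = integral\<^sup>L lborel ?p"
    using 1 by simp
  \<comment> \<open>Fubini's theorem turns the space-time integral into a time integral of
    \<open>pairing\<close>.\<close>
  have "integral\<^sup>L lborel ?p = integral\<^sup>L (lborel \<Otimes>\<^sub>M lborel) (case_prod (\<lambda>x t. u x t * (\<xi> x * dderiv [1] \<theta> t)))"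
    unfolding lborel_prod by (simp add: case_prod_beta' del: dderiv.simps)
  also have "\<dots> = (LINT t|lborel. LINT x|lborel. u x t * (\<xi> x * dderiv [1] \<theta> t))"
    by (rule lborel_pair.integral_snd[symmetric])
      (use ip in \<open>simp add: lborel_prod case_prod_beta' del: dderiv.simps\<close>)
  also have "\<dots> = (LINT t|lborel. pairing \<xi> t * dderiv [1] \<theta> t)"
    unfolding pairing_def by (simp only: mult.assoc[symmetric] integral_mult_left_zero)
  finally show ?thesis using 2 by simp
qed

lemma flux_integrable:
  assumes \<xi>: "smooth \<xi>" and K: "compact K" "K \<subseteq> \<Omega>" and ab: "{a..b} \<subseteq> tint T"
  shows "set_integrable lborel (K \<times> {a..b}) (flux \<xi>)"
proof -
  have c: "continuous_on UNIV (\<lambda>z::'a \<times> real. \<alpha> (fst z))" if "smooth \<alpha>" for \<alpha> :: "'a \<Rightarrow> real"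
    using smooth_continuous_on[OF smooth_tensor[OF that smooth_const[of 1]], of UNIV] by simp
  have "set_integrable lborel (K \<times> {a..b}) (\<lambda>z. \<Sum>v\<in>Basis. (g (fst z) (snd z) \<bullet> v) * dderiv [v] \<xi> (fst z))"
    unfolding set_integrable_def scaleR_sum_right
    by (intro Bochner_Integration.integrable_sum, fold set_integrable_def)
      (intro cylinder_integrable(2)[OF K ab c] smooth_dderiv \<xi>)
  moreover have "set_integrable lborel (K \<times> {a..b}) (\<lambda>z. norm (g (fst z) (snd z)) powr q * \<xi> (fst z))"
    by (rule cylinder_integrable(3)[OF K ab c[OF \<xi>]])
  ultimately show ?thesis
    unfolding flux_def[abs_def] by (rule set_integral_add(1))
qed

lemma flux_off:
  assumes "compact K" "\<And>x. x \<notin> K \<Longrightarrow> \<xi> x = 0" "fst z \<notin> K"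
  shows "flux \<xi> z = 0"
  unfolding flux_def
  using dderiv_zero_off[OF compact_imp_closed[OF assms(1)] assms(2,3)] assms(2)[OF assms(3)]
  by (simp del: dderiv.simps)

end

section \<open>Increments of spatial averages\<close>

lemma step_difference_tendsto:
  fixes H :: "real \<Rightarrow> real"
  assumes H: "\<And>s. s \<le> 0 \<Longrightarrow> H s = 0" "\<And>s. s \<ge> 1 \<Longrightarrow> H s = 1" and "s \<le> t"
    and w: "\<And>n. 0 < w n" "w \<longlonglongrightarrow> 0"
  shows "(\<lambda>n. H ((1/w n) * \<sigma> + (- s/w n)) - H ((1/w n) * \<sigma> + (- t/w n))) \<longlonglongrightarrow> indicator {s<..t} \<sigma>"
proof -
  have wn0: "w n \<noteq> 0" for n using w(1)[of n] by simp
  have small: "\<forall>\<^sub>F n in sequentially. H ((1/w n) * \<sigma> + (- r/w n)) = (if r < \<sigma> then 1 else 0)" for r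
  proof (cases "r < \<sigma>")
    case True
    have "\<forall>\<^sub>F n in sequentially. w n < \<sigma> - r"
      by (rule order_tendstoD(2)[OF w(2)]) (use True in simp)
    then show ?thesis
      by eventually_elim (use True w(1) in \<open>auto intro!: H(2) simp: field_simps wn0\<close>)
  next
    case False
    then show ?thesis
      using w(1) by (auto intro!: always_eventually H(1) simp: field_simps wn0)
  qed
  have "\<forall>\<^sub>F n in sequentially. H ((1/w n) * \<sigma> + (- s/w n)) - H ((1/w n) * \<sigma> + (- t/w n)) = indicator {s<..t} \<sigma>"
    using small[of s] small[of t] by eventually_elim (use \<open>s \<le> t\<close> in \<open>auto simp: indicator_def\<close>)
  then show ?thesis by (rule tendsto_eventually)
qed

context weak_sol
begin

lemma flux_strip_integrable:
  assumes \<xi>: "smooth \<xi>" and K: "compact K" "K \<subseteq> \<Omega>" and off: "\<And>x. x \<notin> K \<Longrightarrow> \<xi> x = 0"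
    and s: "0 < s" and t: "t \<in> tint T"
  shows "integrable lborel (\<lambda>z. flux \<xi> z * indicator {s<..t} (snd z))"
proof -
  have sub: "{s..t} \<subseteq> tint T" using tint_down[OF t] s by auto
  have "set_integrable lborel (K \<times> {s<..t}) (flux \<xi>)"
    by (rule set_integrable_subset[OF flux_integrable[OF \<xi> K sub]])
      (unfold sets_lborel, intro borel_Times, use K(1) in \<open>auto intro: borel_compact\<close>)
  moreover have "(\<lambda>z. indicator (K \<times> {s<..t}) z *\<^sub>R flux \<xi> z) = (\<lambda>z. flux \<xi> z * indicator {s<..t} (snd z))"
  proof
    fix z show "indicator (K \<times> {s<..t}) z *\<^sub>R flux \<xi> z = flux \<xi> z * indicator {s<..t} (snd z)"
      using flux_off[of K \<xi> z, OF K(1) off] by (cases "fst z \<in> K") (auto simp: indicator_def mem_Times_iff)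
  qed
  ultimately show ?thesis by (simp add: set_integrable_def)
qed

text \<open>The cut-off \<open>\<theta> n\<close> rises just after \<open>s\<close> and falls just
  after \<open>t\<close>. Its derivative is a difference of two averaging kernels, so continuity of
  \<open>pairing \<xi>\<close> gives the left side. On the right, \<open>\<theta> n\<close>
  converges at every time to the indicator of \<open>(s,t]\<close>, half-open because the step still
  vanishes at 0, and \<open>|flux \<xi>|\<close> on a compact cylinder dominates.\<close>

lemma pairing_increment:
  assumes \<xi>: "smooth \<xi>" and K: "compact K" "K \<subseteq> \<Omega>" and off: "\<And>x. x \<notin> K \<Longrightarrow> \<xi> x = 0"
    and s: "0 < s" "s < t" and t: "t \<in> tint T"
  shows "pairing \<xi> s - pairing \<xi> t = (LINT z|lborel. flux \<xi> z * indicator {s<..t} (snd z))"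
proof -
  obtain t' where t': "t < t'" "t' \<in> tint T" using tint_up[OF t] by blast
  have sub: "{s..t'} \<subseteq> tint T" using tint_down[OF t'(2)] s by auto
  obtain H :: "real \<Rightarrow> real" where H': "smooth H \<and> (\<forall>s\<le>0. H s = 0) \<and> (\<forall>s\<ge>1. H s = 1) \<and>
    (\<forall>s. dderiv [1] H s \<ge> 0) \<and> (\<forall>s. 0 \<le> H s) \<and> (\<forall>s. H s \<le> 1)"
    by (rule exE[OF smooth_step_exists])
  have H: "smooth H" "\<And>s. s \<le> 0 \<Longrightarrow> H s = 0" "\<And>s. s \<ge> 1 \<Longrightarrow> H s = 1"
    "\<And>s. dderiv [1] H s \<ge> 0" "\<And>s. 0 \<le> H s" "\<And>s. H s \<le> 1"
    using H' by (auto simp del: dderiv.simps)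
  \<comment> \<open>Step widths that tend to 0 and never exceed \<open>t' - t\<close>, so that
    \<open>[r, r + w n]\<close> stays inside \<open>[s, t']\<close> for every \<open>r\<close>
    between \<open>s\<close> and \<open>t\<close>.\<close>
  define w where "w n = (t' - t) * inverse (real (Suc n))" for n
  have w0: "0 < w n" for n using t'(1) by (simp add: w_def)
  have w1: "w n \<le> t' - t" for n
    unfolding w_def using t'(1) by (intro mult_left_le) (auto simp: field_simps)
  have wl: "w \<longlonglongrightarrow> 0"
    unfolding w_def using tendsto_mult_right_zero[OF LIMSEQ_inverse_real_of_nat] by simp
  define h where "h r n = (\<lambda>\<sigma>. H ((1/w n) * \<sigma> + (- r/w n)))" for r n
  define \<theta> where "\<theta> n = (\<lambda>\<sigma>. h s n \<sigma> - h t n \<sigma>)" for n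
  have hs: "smooth (h r n)" for r n
    unfolding h_def by (rule smooth_affine_compose[OF H(1) bounded_linear_mult_right])
  have \<theta>s: "smooth (\<theta> n)" for n unfolding \<theta>_def by (rule smooth_diff[OF hs hs])
  have \<theta>off: "\<theta> n \<sigma> = 0" if \<sigma>: "\<sigma> \<notin> {s..t'}" for n \<sigma>
  proof (cases "\<sigma> < s")
    case True
    then have "h s n \<sigma> = 0" "h t n \<sigma> = 0"
      unfolding h_def using w0[of n] s by (auto intro!: H(2) simp: field_simps)
    then show ?thesis by (simp add: \<theta>_def)
  next
    case False
    then have "\<sigma> > t'" using \<sigma> by auto
    then have "h s n \<sigma> = 1" "h t n \<sigma> = 1"
      unfolding h_def using w0[of n] w1[of n] s by (auto intro!: H(3) simp: field_simps)
    then show ?thesis by (simp add: \<theta>_def)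
  qed
  have \<theta>b: "\<bar>\<theta> n \<sigma>\<bar> \<le> 1" for n \<sigma>
    using H(5,6)[of "(1/w n) * \<sigma> + (- s/w n)"] H(5,6)[of "(1/w n) * \<sigma> + (- t/w n)"]
    unfolding \<theta>_def h_def by linarith
  have \<xi>C: "\<xi> \<in> Cc \<Omega>" by (rule Cc_I[OF smooth_continuous_on[OF \<xi>] K off])
  have Uc: "continuous_on {s..t'} (pairing \<xi>)"
    by (rule continuous_on_subset[OF continuous_on_pairing[OF \<xi>C] sub])
  have avg: "(\<lambda>n. LINT \<sigma>|lborel. pairing \<xi> \<sigma> * dderiv [1] (h r n) \<sigma>) \<longlonglongrightarrow> pairing \<xi> r"
    and avgi: "integrable lborel (\<lambda>\<sigma>. pairing \<xi> \<sigma> * dderiv [1] (h r n) \<sigma>)" if r: "s \<le> r" "r \<le> t" for r n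
  proof -
    have c: "continuous_on {r..r + w n} (pairing \<xi>)" for n
      by (rule continuous_on_subset[OF Uc]) (use r w1[of n] in auto)
    \<comment> \<open>For integrability alone any bound will do: \<open>step_average\<close> is used
      with centre 0 and radius \<open>B\<close>.\<close>
    have "bounded (pairing \<xi> ` {s..t'})"
      by (intro compact_imp_bounded compact_continuous_image Uc) auto
    then obtain B where B: "\<forall>\<sigma>\<in>{s..t'}. \<bar>pairing \<xi> \<sigma>\<bar> \<le> B"
      unfolding bounded_iff by auto
    show "integrable lborel (\<lambda>\<sigma>. pairing \<xi> \<sigma> * dderiv [1] (h r n) \<sigma>)"
      unfolding h_def
      by (rule step_average(1)[OF H(1-4) w0 c, of _ 0 B]) (use B r w1[of n] in auto)
    show "(\<lambda>n. LINT \<sigma>|lborel. pairing \<xi> \<sigma> * dderiv [1] (h r n) \<sigma>) \<longlonglongrightarrow> pairing \<xi> r"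
    proof (rule metric_LIMSEQ_I)
      fix e :: real assume e: "0 < e"
      have "r \<in> {s..t'}" using r t' by auto
      with Uc e obtain d where d: "d > 0" "\<And>\<sigma>. \<sigma> \<in> {s..t'} \<Longrightarrow> dist \<sigma> r < d \<Longrightarrow> dist (pairing \<xi> \<sigma>) (pairing \<xi> r) < e/2"
        unfolding continuous_on_iff by (meson half_gt_zero)
      obtain N where N: "\<And>n. n \<ge> N \<Longrightarrow> w n < d"
        using order_tendstoD(2)[OF wl d(1)] unfolding eventually_sequentially by blast
      have "dist (LINT \<sigma>|lborel. pairing \<xi> \<sigma> * dderiv [1] (h r n) \<sigma>) (pairing \<xi> r) < e" if n: "n \<ge> N" for n
      proof -
        have "\<bar>(LINT \<sigma>|lborel. pairing \<xi> \<sigma> * dderiv [1] (h r n) \<sigma>) - pairing \<xi> r\<bar> \<le> e/2"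
          unfolding h_def
        proof (rule step_average(2)[OF H(1-4) w0 c])
          fix \<sigma> assume "\<sigma> \<in> {r..r + w n}"
          then have "\<sigma> \<in> {s..t'}" "dist \<sigma> r < d" using r w1[of n] N[OF n] by (auto simp: dist_real_def)
          from d(2)[OF this] show "\<bar>pairing \<xi> \<sigma> - pairing \<xi> r\<bar> \<le> e/2" by (simp add: dist_real_def)
        qed
        then show ?thesis using e unfolding dist_real_def by linarith
      qed
      then show "\<exists>N. \<forall>n\<ge>N. dist (LINT \<sigma>|lborel. pairing \<xi> \<sigma> * dderiv [1] (h r n) \<sigma>) (pairing \<xi> r) < e" by blast
    qed
  qed
  have d\<theta>: "dderiv [1] (\<theta> n) \<sigma> = dderiv [1] (h s n) \<sigma> - dderiv [1] (h t n) \<sigma>" for n \<sigma>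
  proof -
    have "(\<theta> n has_real_derivative dderiv [1] (h s n) \<sigma> - dderiv [1] (h t n) \<sigma>) (at \<sigma>)"
      unfolding \<theta>_def by (intro DERIV_diff smooth_real_derivative hs)
    then show ?thesis using smooth_real_derivative[OF \<theta>s] DERIV_unique by blast
  qed
  have "(LINT \<sigma>|lborel. pairing \<xi> \<sigma> * dderiv [1] (\<theta> n) \<sigma>)
      = (LINT \<sigma>|lborel. pairing \<xi> \<sigma> * dderiv [1] (h s n) \<sigma>) - (LINT \<sigma>|lborel. pairing \<xi> \<sigma> * dderiv [1] (h t n) \<sigma>)" for n
    unfolding d\<theta> right_diff_distrib using s by (intro Bochner_Integration.integral_diff avgi) auto
  then have lim1: "(\<lambda>n. LINT \<sigma>|lborel. pairing \<xi> \<sigma> * dderiv [1] (\<theta> n) \<sigma>) \<longlonglongrightarrow> pairing \<xi> s - pairing \<xi> t"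
    using tendsto_diff[OF avg[of s] avg[of t]] s by simp
  have "(\<lambda>n. LINT z|lborel. flux \<xi> z * \<theta> n (snd z)) \<longlonglongrightarrow> (LINT z|lborel. flux \<xi> z * indicator {s<..t} (snd z))"
  proof (rule integral_dominated_convergence)
    let ?C = "K \<times> {s..t'}"
    have fi: "integrable lborel (\<lambda>z. indicator ?C z *\<^sub>R flux \<xi> z)"
      using flux_integrable[OF \<xi> K sub] by (simp add: set_integrable_def)
    then show "integrable lborel (\<lambda>z. \<bar>indicator ?C z *\<^sub>R flux \<xi> z\<bar>)" by (rule integrable_abs)
    show "(\<lambda>z. flux \<xi> z * indicator {s<..t} (snd z)) \<in> borel_measurable lborel"
      by (rule borel_measurable_integrable[OF flux_strip_integrable[OF \<xi> K off s(1) t]])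
    have eq: "flux \<xi> z * \<theta> n (snd z) = indicator ?C z *\<^sub>R flux \<xi> z * \<theta> n (snd z)" for z n
      using flux_off[of K \<xi> z, OF K(1) off] \<theta>off[of "snd z" n] by (cases "z \<in> ?C") (auto simp: mem_Times_iff)
    have "(\<lambda>z. \<theta> n (snd (z :: 'a \<times> real))) \<in> borel_measurable lborel" for n
      using continuous_on_compose2[OF smooth_continuous_on[OF \<theta>s, of UNIV] continuous_on_snd[OF continuous_on_id]]
      by (auto intro!: borel_measurable_continuous_onI)
    then show "(\<lambda>z. flux \<xi> z * \<theta> n (snd z)) \<in> borel_measurable lborel" for n
      unfolding eq using borel_measurable_integrable[OF fi] by (intro borel_measurable_times) auto
    show "AE z in lborel. (\<lambda>n. flux \<xi> z * \<theta> n (snd z)) \<longlonglongrightarrow> flux \<xi> z * indicator {s<..t} (snd z)"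
      unfolding \<theta>_def h_def using s
      by (intro AE_I2 tendsto_mult tendsto_const step_difference_tendsto H w0 wl) auto
    show "AE z in lborel. norm (flux \<xi> z * \<theta> n (snd z)) \<le> \<bar>indicator ?C z *\<^sub>R flux \<xi> z\<bar>" for n
      unfolding eq using \<theta>b by (intro AE_I2) (simp add: abs_mult mult_left_le)
  qed
  moreover have "(LINT z|lborel. flux \<xi> z * \<theta> n (snd z)) = (LINT \<sigma>|lborel. pairing \<xi> \<sigma> * dderiv [1] (\<theta> n) \<sigma>)" for n
    by (rule weak_identity[OF \<xi> K off \<theta>s sub \<theta>off, symmetric])
  ultimately show ?thesis
    using LIMSEQ_unique[OF lim1] by (simp del: dderiv.simps)
qed

end

section \<open>Regular and singular points\<close>

lemma truncated_integral_convergent: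
  fixes F :: "'a::euclidean_space \<times> real \<Rightarrow> real"
  assumes "0 < \<tau>" "\<And>z. 0 \<le> F z"
    and int: "\<And>s. 0 < s \<Longrightarrow> integrable lborel (\<lambda>z. F z * indicator {s<..\<tau>} (snd z))"
    and bound: "\<And>s. 0 < s \<Longrightarrow> s < \<tau> \<Longrightarrow> (LINT z|lborel. F z * indicator {s<..\<tau>} (snd z)) \<le> M"
  shows "\<exists>l. ((\<lambda>s. LINT z|lborel. F z * indicator {s<..\<tau>} (snd z)) \<longlongrightarrow> l) (at_right 0)"
proof (rule bounded_antimono_convergent_at_right[OF assms(1) _ bound])
  fix s t :: real assume st: "0 < s" "s \<le> t"
  show "(LINT z|lborel. F z * indicator {t<..\<tau>} (snd z)) \<le> (LINT z|lborel. F z * indicator {s<..\<tau>} (snd z))"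
    by (intro integral_mono int mult_left_mono assms(2)) (use st in \<open>auto split: split_indicator\<close>)
qed

text \<open>Here \<open>a\<close> is the size of the gradient and \<open>e\<close> the value of a
  cut-off. If \<open>2C \<le> a^(q-1) e\<close>, the left side is at most the absorbed half.
  Otherwise \<open>a \<le> (2C/e)^(1/(q-1))\<close>, and \<open>n \<ge> 1/(q-1)\<close> is exactly
  what lets \<open>e^n\<close> compensate the negative power of \<open>e\<close>; this leaves the
  constant \<open>C (2C)^(1/(q-1))\<close>. The cases \<open>a = 0\<close> and \<open>e = 0\<close>
  are split off to keep powers and quotients meaningful.\<close>

lemma gradient_absorption:
  fixes q C :: real
  assumes q: "q > 1" and C: "C \<ge> 0" and n: "1 \<le> n" "1 / (q - 1) \<le> real n"
  obtains C' where "C' \<ge> 0"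
    "\<And>a e. 0 \<le> a \<Longrightarrow> 0 \<le> e \<Longrightarrow> e \<le> 1 \<Longrightarrow> C * a * e ^ n \<le> (a powr q) * e ^ Suc n / 2 + C'"
proof
  let ?p = "1 / (q - 1)"
  let ?C = "C * (2 * C) powr ?p"
  show C0: "?C \<ge> 0" using C by simp
  fix a e :: real assume a: "0 \<le> a" and e: "0 \<le> e" "e \<le> 1"
  have rhs0: "0 \<le> (a powr q) * e ^ Suc n / 2" using e by simp
  show "C * a * e ^ n \<le> (a powr q) * e ^ Suc n / 2 + ?C"
  proof (cases "a = 0 \<or> e = 0")
    case True
    then have "C * a * e ^ n = 0" using n by auto
    then show ?thesis using rhs0 C0 by linarith
  next
    case False
    then have a: "a > 0" and e0: "e > 0" using a e by auto
    have aq: "a powr q = a powr (q - 1) * a"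
      using a powr_add[of a "q - 1" 1] by simp
    show ?thesis
    proof (cases "2 * C \<le> a powr (q - 1) * e")
      case True
      have "C * (a * e ^ n) \<le> (a powr (q - 1) * e / 2) * (a * e ^ n)"
        using True a e0 by (intro mult_right_mono) auto
      also have "\<dots> = (a powr q) * e ^ Suc n / 2" unfolding aq by simp
      finally show ?thesis using C0 by (simp add: mult.assoc)
    next
      case False
      then have lt: "a powr (q - 1) \<le> 2 * C / e" using e0 by (simp add: field_simps)
      have "a = (a powr (q - 1)) powr ?p" using a q by (simp add: powr_powr)
      also have "\<dots> \<le> (2 * C / e) powr ?p" using lt q by (intro powr_mono2) auto
      also have "\<dots> = (2 * C) powr ?p * e powr (- ?p)"
        using C e0 by (simp add: powr_divide powr_minus_divide)
      finally have "a * e ^ n \<le> (2 * C) powr ?p * e powr (- ?p) * e ^ n"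
        using e0 by (intro mult_right_mono) auto
      also have "\<dots> = (2 * C) powr ?p * e powr (real n - ?p)"
        using e0 by (simp add: powr_diff powr_minus_divide powr_realpow)
      also have "\<dots> \<le> (2 * C) powr ?p * 1"
        using e0 e n by (intro mult_left_mono powr_le1) auto
      finally have "C * (a * e ^ n) \<le> C * (2 * C) powr ?p"
        using C by (intro mult_left_mono) auto
      then show ?thesis using rhs0 by (simp add: mult.assoc)
    qed
  qed
qed

lemma dderiv_power_Suc:
  assumes "smooth \<eta>"
  shows "dderiv [b] (\<lambda>x. \<eta> x ^ Suc n) x = real (Suc n) * \<eta> x ^ n * dderiv [b] \<eta> x"
proof -
  have "(\<eta> has_derivative frechet_derivative \<eta> (at x)) (at x)"
    using smooth_differentiable[OF assms] frechet_derivative_works by blast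
  from has_derivative_power[OF this, of "Suc n"]
  have "((\<lambda>x. \<eta> x ^ Suc n) has_derivative (\<lambda>y. of_nat (Suc n) * frechet_derivative \<eta> (at x) y * \<eta> x ^ n)) (at x)"
    by simp
  from fun_cong[OF frechet_derivative_at[OF this], of b] show ?thesis by (simp add: algebra_simps)
qed

lemma eventually_tint: "T > 0 \<Longrightarrow> \<forall>\<^sub>F t in at_right 0. t \<in> tint T"
proof -
  assume "T > 0"
  then obtain \<tau> where "\<tau> \<in> tint T" using tint_nonempty by blast
  then show ?thesis
    unfolding eventually_at_right_field using tint_down[of \<tau> T] by (intro exI[of _ \<tau>]) (auto simp: tint_def)
qed

section \<open>Energy near time zero: convergence and blow-up\<close>

context weak_sol
begin

definition energy :: "'a set \<Rightarrow> real \<Rightarrow> real \<Rightarrow> real" where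
  "energy K s \<tau> = (LINT z|lborel. norm (g (fst z) (snd z)) powr q * indicator (K \<times> {s<..\<tau>}) z)"

text \<open>Integrability of \<open>|\<nabla>u|^q\<close> down to time 0 is expressed by a bound on
  truncated integrals. The value \<open>energy K 0 \<tau>\<close> could not express it, because the
  integral of a nonintegrable function is 0 by convention.\<close>

definition finite_energy :: "'a set \<Rightarrow> bool" where
  "finite_energy K \<longleftrightarrow> (\<exists>\<tau>\<in>tint T. \<exists>M. \<forall>s. 0 < s \<and> s < \<tau> \<longrightarrow> energy K s \<tau> \<le> M)"

definition regular_set :: "'a set" where
  "regular_set = {x. \<exists>r>0. cball x r \<subseteq> \<Omega> \<and> finite_energy (cball x r)}"

lemma energy_integrable:
  assumes K: "compact K" "K \<subseteq> \<Omega>" and s: "0 < s" and \<tau>: "\<tau> \<in> tint T"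
  shows "integrable lborel (\<lambda>z. norm (g (fst z) (snd z)) powr q * indicator (K \<times> {s<..\<tau>}) z)"
proof -
  have sub: "{s..\<tau>} \<subseteq> tint T" using tint_down[OF \<tau>] s by auto
  have C: "compact (K \<times> {s..\<tau>})" using K by (intro compact_Times) auto
  have "set_integrable lborel (K \<times> {s<..\<tau>}) (\<lambda>z. norm (g (fst z) (snd z)) powr q)"
    by (rule set_integrable_subset[OF gq_loc[OF C cylinder_subset[OF K(2) sub]]])
      (unfold sets_lborel, intro borel_Times, use K(1) in \<open>auto intro: borel_compact\<close>)
  then show ?thesis by (simp add: set_integrable_def mult.commute)
qed

lemma energy_mono:
  assumes "compact K" "compact K'" "K \<subseteq> K'" "K' \<subseteq> \<Omega>" "0 < s'" "s' \<le> s" "\<tau> \<in> tint T"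
  shows "energy K s \<tau> \<le> energy K' s' \<tau>"
  unfolding energy_def
  by (intro integral_mono energy_integrable mult_left_mono) (use assms in \<open>auto split: split_indicator\<close>)

lemma strip_integrable:
  assumes "compact K" "0 \<le> s"
  shows "integrable lborel (indicator (K \<times> {s<..\<tau>}) :: 'a \<times> real \<Rightarrow> real)"
    and "(LINT z|lborel. indicator (K \<times> {s<..\<tau>}) z) \<le> measure lborel (K \<times> {0..\<tau>})"
proof -
  have C: "compact (K \<times> {0..\<tau>})" using assms by (intro compact_Times) auto
  have fin: "emeasure lborel (K \<times> {0..\<tau>}) < \<infinity>"
    using emeasure_bounded_finite[OF compact_imp_bounded[OF C]] by blast
  have sets: "K \<times> {s<..\<tau>} \<in> sets lborel" "K \<times> {0..\<tau>} \<in> sets lborel"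
    unfolding sets_lborel
    using borel_Times[OF borel_compact[OF assms(1)], of "{s<..\<tau>}"] borel_compact[OF C] by simp_all
  have sub: "K \<times> {s<..\<tau>} \<subseteq> K \<times> {0..\<tau>}" using assms(2) by auto
  have "emeasure lborel (K \<times> {s<..\<tau>}) < \<infinity>"
    using emeasure_mono[OF sub sets(2)] fin by (rule le_less_trans)
  then show "integrable lborel (indicator (K \<times> {s<..\<tau>}) :: 'a \<times> real \<Rightarrow> real)"
    using sets(1) by (intro integrable_real_indicator)
  have "measure lborel (K \<times> {s<..\<tau>}) \<le> measure lborel (K \<times> {0..\<tau>})"
    by (rule measure_mono_fmeasurable[OF sub sets(1)]) (use fin sets in \<open>auto simp: fmeasurable_def\<close>)
  then show "(LINT z|lborel. indicator (K \<times> {s<..\<tau>}) z) \<le> measure lborel (K \<times> {0..\<tau>})"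
    using sets(1) by simp
qed

lemma abs_gradient_sum_le:
  "\<bar>\<Sum>b\<in>Basis. (g (fst z) (snd z) \<bullet> b) * dderiv [b] \<xi> (fst z)\<bar>
    \<le> norm (g (fst z) (snd z)) * (\<Sum>b\<in>Basis. \<bar>dderiv [b] \<xi> (fst z)\<bar>)"
proof -
  have "\<bar>\<Sum>b\<in>Basis. (g (fst z) (snd z) \<bullet> b) * dderiv [b] \<xi> (fst z)\<bar>
    \<le> (\<Sum>b\<in>Basis. norm (g (fst z) (snd z)) * \<bar>dderiv [b] \<xi> (fst z)\<bar>)"
    by (rule order_trans[OF sum_abs sum_mono])
      (unfold abs_mult, intro mult_right_mono Basis_le_norm abs_ge_zero)
  then show ?thesis by (simp only: sum_distrib_left)
qed

lemma pairing_convergent_smooth: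
  assumes \<xi>: "smooth \<xi>" and K: "compact K" "K \<subseteq> \<Omega>" and off: "\<And>x. x \<notin> K \<Longrightarrow> \<xi> x = 0"
    and fe: "finite_energy K"
  shows "\<exists>l. (pairing \<xi> \<longlongrightarrow> l) (at_right 0)"
proof -
  obtain \<tau> M where \<tau>: "\<tau> \<in> tint T" and M: "\<And>s. 0 < s \<Longrightarrow> s < \<tau> \<Longrightarrow> energy K s \<tau> \<le> M"
    using fe unfolding finite_energy_def by blast
  have \<tau>0: "0 < \<tau>" using \<tau> by (simp add: tint_def)
  obtain B where B: "B > 0" "\<And>x. (\<Sum>b\<in>Basis. \<bar>dderiv [b] \<xi> x\<bar>) \<le> B"
    using dderiv_sum_bound[OF \<xi> K(1) off] by blast
  have "\<xi> \<in> Cc \<Omega>" by (rule Cc_I[OF smooth_continuous_on[OF \<xi>] K off])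
  then obtain B' where B': "B' > 0" "\<And>x. \<bar>\<xi> x\<bar> \<le> B'" using Cc_bounded by blast
  let ?a = "\<lambda>z. norm (g (fst z) (snd z))"
  \<comment> \<open>\<open>W\<close> and \<open>W + flux \<xi>\<close> are nonnegative, so their truncated integrals are monotone in \<open>s\<close>.\<close>
  define W where "W z = (B + B') * (indicator K (fst z) + ?a z powr q * indicator K (fst z))" for z
  have W0: "0 \<le> W z" for z using B B' by (simp add: W_def)
  have fW: "\<bar>flux \<xi> z\<bar> \<le> W z" for z
  proof (cases "fst z \<in> K")
    case False
    then show ?thesis using flux_off[of K \<xi> z, OF K(1) off] W0 by simp
  next
    case True
    \<comment> \<open>The flux contains the gradient linearly; \<open>q > 1\<close> lets finite
      energy control that term as well.\<close>
    have a1: "?a z \<le> 1 + ?a z powr q"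
    proof (cases "?a z \<le> 1")
      case False
      then have "?a z powr 1 \<le> ?a z powr q" using q by (intro powr_mono) auto
      then show ?thesis by simp
    qed (simp add: add_increasing2)
    have "\<bar>flux \<xi> z\<bar> \<le> ?a z * (\<Sum>b\<in>Basis. \<bar>dderiv [b] \<xi> (fst z)\<bar>) + ?a z powr q * \<bar>\<xi> (fst z)\<bar>"
      unfolding flux_def using abs_gradient_sum_le[of z \<xi>]
      by (intro order_trans[OF abs_triangle_ineq] add_mono) (auto simp: abs_mult)
    also have "\<dots> \<le> (1 + ?a z powr q) * B + (1 + ?a z powr q) * B'"
      using B(1) B'(1) a1 by (intro add_mono mult_mono B(2) B'(2)) (auto simp del: dderiv.simps intro!: sum_nonneg)
    also have "\<dots> = W z" using True by (simp add: W_def algebra_simps)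
    finally show ?thesis .
  qed
  have Weq: "W z * indicator {s<..\<tau>} (snd z) = (B + B') * (indicator (K \<times> {s<..\<tau>}) z + ?a z powr q * indicator (K \<times> {s<..\<tau>}) z)" for s z
    by (cases z) (auto simp: W_def indicator_def)
  have iW: "integrable lborel (\<lambda>z. W z * indicator {s<..\<tau>} (snd z))" if "0 < s" for s
    unfolding Weq using that
    by (intro integrable_mult_right Bochner_Integration.integrable_add strip_integrable(1) energy_integrable K \<tau>) auto
  define M' where "M' = (B + B') * (measure lborel (K \<times> {0..\<tau>}) + M)"
  have bW: "(LINT z|lborel. W z * indicator {s<..\<tau>} (snd z)) \<le> M'" if s: "0 < s" "s < \<tau>" for s
  proof -
    have "(LINT z|lborel. W z * indicator {s<..\<tau>} (snd z)) = (B + B') * ((LINT z|lborel. indicator (K \<times> {s<..\<tau>}) z) + energy K s \<tau>)"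
      unfolding Weq energy_def
      using strip_integrable(1)[OF K(1), of s \<tau>] energy_integrable[OF K s(1) \<tau>] s by simp
    also have "\<dots> \<le> M'"
      unfolding M'_def using B(1) B'(1) M[OF s] strip_integrable(2)[OF K(1), of s \<tau>] s
      by (intro mult_left_mono add_mono) auto
    finally show ?thesis .
  qed
  have iF: "integrable lborel (\<lambda>z. flux \<xi> z * indicator {s<..\<tau>} (snd z))" if "0 < s" for s
    by (rule flux_strip_integrable[OF \<xi> K off that \<tau>])
  have iP: "integrable lborel (\<lambda>z. (W z + flux \<xi> z) * indicator {s<..\<tau>} (snd z))" if "0 < s" for s
    unfolding distrib_right by (intro Bochner_Integration.integrable_add iW iF that)
  have bP: "(LINT z|lborel. (W z + flux \<xi> z) * indicator {s<..\<tau>} (snd z)) \<le> 2 * M'" if s: "0 < s" "s < \<tau>" for s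
  proof -
    have "(LINT z|lborel. (W z + flux \<xi> z) * indicator {s<..\<tau>} (snd z)) \<le> (LINT z|lborel. 2 * (W z * indicator {s<..\<tau>} (snd z)))"
      using fW by (intro integral_mono integrable_mult_right iP iW s) (auto simp: indicator_def abs_le_iff)
    also have "\<dots> \<le> 2 * M'" using bW[OF s] by simp
    finally show ?thesis .
  qed
  obtain l1 where l1: "((\<lambda>s. LINT z|lborel. W z * indicator {s<..\<tau>} (snd z)) \<longlongrightarrow> l1) (at_right 0)"
    using truncated_integral_convergent[OF \<tau>0 W0 iW bW] by blast
  have P0: "0 \<le> W z + flux \<xi> z" for z using fW[of z] by (simp add: abs_le_iff)
  obtain l2 where l2: "((\<lambda>s. LINT z|lborel. (W z + flux \<xi> z) * indicator {s<..\<tau>} (snd z)) \<longlongrightarrow> l2) (at_right 0)"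
    using truncated_integral_convergent[OF \<tau>0 P0 iP bP] by blast
  have eq: "pairing \<xi> s = pairing \<xi> \<tau> + ((LINT z|lborel. (W z + flux \<xi> z) * indicator {s<..\<tau>} (snd z)) - (LINT z|lborel. W z * indicator {s<..\<tau>} (snd z)))"
    if s: "0 < s" "s < \<tau>" for s
    using pairing_increment[OF \<xi> K off s \<tau>] iW[OF s(1)] iF[OF s(1)] by (simp add: distrib_right)
  have "\<forall>\<^sub>F s in at_right 0. pairing \<xi> \<tau> + ((LINT z|lborel. (W z + flux \<xi> z) * indicator {s<..\<tau>} (snd z)) - (LINT z|lborel. W z * indicator {s<..\<tau>} (snd z))) = pairing \<xi> s"
    unfolding eventually_at_right_field by (intro exI[of _ \<tau>] conjI allI impI eq[symmetric] \<tau>0)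
  then have "(pairing \<xi> \<longlongrightarrow> pairing \<xi> \<tau> + (l2 - l1)) (at_right 0)"
    by (rule Lim_transform_eventually[rotated]) (intro tendsto_intros l1 l2)
  then show ?thesis by blast
qed

text \<open>Near a nonregular point the energy is unbounded on every small ball, in particular on
  the ball where \<open>\<xi>\<close> is bounded below by some \<open>c > 0\<close>. After
  absorption half of it still drives \<open>pairing \<xi>\<close> up, against a loss that is uniform
  in \<open>s\<close>. Since the energy grows as \<open>s\<close> decreases, the divergence holds
  along the whole limit and not only along a sequence of times.\<close>

lemma blow_up_outside_regular_set:
  assumes x0: "x0 \<in> \<Omega>" "x0 \<notin> regular_set" and \<epsilon>: "\<epsilon> > 0"
  shows "((\<lambda>t. \<integral>\<^sup>+ x. ennreal (u x t) * indicator (ball x0 \<epsilon> \<inter> \<Omega>) x \<partial>lborel) \<longlongrightarrow> \<infinity>) (at_right 0)"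
proof -
  obtain \<delta> where \<delta>: "\<delta> > 0" "cball x0 \<delta> \<subseteq> \<Omega>"
    using open_\<Omega> x0(1) open_contains_cball by blast
  \<comment> \<open>Half of \<open>\<epsilon>\<close>, as a closed ball has to fit into the open
    ball of radius \<open>\<epsilon>\<close>.\<close>
  define K where "K = cball x0 (min \<delta> (\<epsilon>/2))"
  have K: "compact K" "K \<subseteq> \<Omega>" "K \<subseteq> ball x0 \<epsilon>"
    using \<delta>(2) \<epsilon> by (auto simp: K_def)
  have "min \<delta> (\<epsilon>/2) > 0" using \<delta> \<epsilon> by simp
  then obtain \<eta> r where \<eta>r: "smooth \<eta> \<and> (\<forall>x. 0 \<le> \<eta> x) \<and> (\<forall>x. \<eta> x \<le> 1) \<and>
    (\<forall>x. x \<notin> K \<longrightarrow> \<eta> x = 0) \<and> r > 0 \<and> (\<forall>x\<in>cball x0 r. \<eta> x > 0)"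
    using smooth_bump_exists[of "min \<delta> (\<epsilon>/2)" x0] unfolding K_def by blast
  then have \<eta>: "smooth \<eta>" "\<And>x. 0 \<le> \<eta> x" "\<And>x. \<eta> x \<le> 1"
    "\<And>x. x \<notin> K \<Longrightarrow> \<eta> x = 0" and r: "r > 0" "\<And>x. x \<in> cball x0 r \<Longrightarrow> \<eta> x > 0"
    by auto
  have rK: "cball x0 r \<subseteq> K" using r(2) \<eta>(4) by force
  obtain \<tau> where \<tau>: "\<tau> \<in> tint T" using tint_nonempty[OF T] by blast
  have \<tau>0: "0 < \<tau>" using \<tau> by (simp add: tint_def)
  \<comment> \<open>The exponent required by \<open>gradient_absorption\<close>; the successor
    ensures \<open>1 \<le> n\<close>. The cut-off is the power \<open>n + 1\<close>, since
    differentiation lowers the exponent to \<open>n\<close>.\<close>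
  define n where "n = Suc (nat \<lceil>1 / (q - 1)\<rceil>)"
  have n: "1 \<le> n" "1 / (q - 1) \<le> real n" unfolding n_def by linarith+
  define \<xi> where "\<xi> = (\<lambda>x. \<eta> x ^ Suc n)"
  have \<xi>: "smooth \<xi>" unfolding \<xi>_def by (rule smooth_power[OF \<eta>(1)])
  have off: "\<xi> x = 0" if "x \<notin> K" for x using \<eta>(4)[OF that] by (simp add: \<xi>_def)
  have \<xi>C: "\<xi> \<in> Cc \<Omega>" by (rule Cc_I[OF smooth_continuous_on[OF \<xi>] K(1,2) off])
  have \<xi>01: "0 \<le> \<xi> x" "\<xi> x \<le> 1" for x unfolding \<xi>_def using \<eta>(2,3) by (auto intro: power_le_one simp del: power_Suc)
  obtain B where B: "B > 0" "\<And>x. (\<Sum>b\<in>Basis. \<bar>dderiv [b] \<eta> x\<bar>) \<le> B"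
    using dderiv_sum_bound[OF \<eta>(1) K(1) \<eta>(4)] by blast
  let ?a = "\<lambda>z. norm (g (fst z) (snd z))"
  obtain C' where C': "C' \<ge> 0"
    "\<And>a e. 0 \<le> a \<Longrightarrow> 0 \<le> e \<Longrightarrow> e \<le> 1 \<Longrightarrow> (real (Suc n) * B) * a * e ^ n \<le> (a powr q) * e ^ Suc n / 2 + C'"
    by (rule gradient_absorption[OF q _ n, of "real (Suc n) * B"]) (use B in auto)
  have flux_lower: "?a z powr q * \<xi> (fst z) / 2 - C' \<le> flux \<xi> z" for z
  proof -
    have "(\<Sum>b\<in>Basis. \<bar>dderiv [b] \<xi> (fst z)\<bar>) = real (Suc n) * \<eta> (fst z) ^ n * (\<Sum>b\<in>Basis. \<bar>dderiv [b] \<eta> (fst z)\<bar>)"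
      unfolding \<xi>_def dderiv_power_Suc[OF \<eta>(1)] sum_distrib_left
      using \<eta>(2) by (simp add: abs_mult del: dderiv.simps)
    also have "\<dots> \<le> real (Suc n) * \<eta> (fst z) ^ n * B"
      using \<eta>(2) by (intro mult_left_mono B(2)) auto
    finally have "?a z * (\<Sum>b\<in>Basis. \<bar>dderiv [b] \<xi> (fst z)\<bar>) \<le> ?a z * (real (Suc n) * \<eta> (fst z) ^ n * B)"
      by (intro mult_left_mono) auto
    also have "\<dots> = (real (Suc n) * B) * ?a z * \<eta> (fst z) ^ n" by (simp only: mult_ac)
    also have "\<dots> \<le> ?a z powr q * \<xi> (fst z) / 2 + C'"
      unfolding \<xi>_def by (rule C'(2)) (use \<eta> in auto)
    finally show ?thesis
      using abs_gradient_sum_le[of z \<xi>] unfolding flux_def by linarith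
  qed
  obtain c where c: "c > 0" "\<And>x. x \<in> cball x0 r \<Longrightarrow> c \<le> \<xi> x"
  proof -
    have "cball x0 r \<noteq> {}" using r(1) by auto
    then obtain y where y: "y \<in> cball x0 r" "\<And>x. x \<in> cball x0 r \<Longrightarrow> \<xi> y \<le> \<xi> x"
      using continuous_attains_inf[OF compact_cball _ smooth_continuous_on[OF \<xi>]] by blast
    show ?thesis by (rule that[of "\<xi> y"]) (use y r(2)[OF y(1)] in \<open>auto simp: \<xi>_def\<close>)
  qed
  \<comment> \<open>The total loss caused by the constant \<open>C'\<close>, measured on the full
    cylinder down to time 0 and hence independent of \<open>s\<close>.\<close>
  define V where "V = C' * measure lborel (K \<times> {0..\<tau>})"
  have rO: "cball x0 r \<subseteq> \<Omega>" using rK K(2) by blast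
  have lower: "pairing \<xi> \<tau> + (c/2) * energy (cball x0 r) s \<tau> - V \<le> pairing \<xi> s" if s: "0 < s" "s < \<tau>" for s
  proof -
    have "(c/2) * energy (cball x0 r) s \<tau> - V \<le> (c/2) * energy (cball x0 r) s \<tau> - C' * (LINT z|lborel. indicator (K \<times> {s<..\<tau>}) z)"
      unfolding V_def using strip_integrable(2)[OF K(1), of s \<tau>] s C'(1) by (simp add: mult_left_mono)
    also have "\<dots> = (LINT z|lborel. (c/2) * (?a z powr q * indicator (cball x0 r \<times> {s<..\<tau>}) z) - C' * indicator (K \<times> {s<..\<tau>}) z)"
      unfolding energy_def
      using energy_integrable[OF compact_cball rO s(1) \<tau>] strip_integrable(1)[OF K(1), of s \<tau>] s by simp
    also have "\<dots> \<le> (LINT z|lborel. flux \<xi> z * indicator {s<..\<tau>} (snd z))"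
    proof (rule integral_mono)
      show "integrable lborel (\<lambda>z. (c/2) * (?a z powr q * indicator (cball x0 r \<times> {s<..\<tau>}) z) - C' * indicator (K \<times> {s<..\<tau>}) z)"
        using energy_integrable[OF compact_cball rO s(1) \<tau>] strip_integrable(1)[OF K(1), of s \<tau>] s by simp
      show "integrable lborel (\<lambda>z. flux \<xi> z * indicator {s<..\<tau>} (snd z))"
        by (rule flux_strip_integrable[OF \<xi> K(1,2) off s(1) \<tau>])
      fix z :: "'a \<times> real"
      show "(c/2) * (?a z powr q * indicator (cball x0 r \<times> {s<..\<tau>}) z) - C' * indicator (K \<times> {s<..\<tau>}) z
          \<le> flux \<xi> z * indicator {s<..\<tau>} (snd z)"
      proof (cases "z \<in> K \<times> {s<..\<tau>}")
        case False
        then have "z \<notin> cball x0 r \<times> {s<..\<tau>}" using rK by auto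
        with False show ?thesis
          using flux_off[of K \<xi> z, OF K(1) off] by (cases "fst z \<in> K") (auto simp: mem_Times_iff)
      next
        case True
        have "c * indicator (cball x0 r \<times> {s<..\<tau>}) z \<le> \<xi> (fst z)"
          using c(2) \<xi>01(1) by (cases z) (auto simp: indicator_def)
        then have "?a z powr q * (c * indicator (cball x0 r \<times> {s<..\<tau>}) z) \<le> ?a z powr q * \<xi> (fst z)"
          by (intro mult_left_mono) auto
        then have "(c/2) * (?a z powr q * indicator (cball x0 r \<times> {s<..\<tau>}) z) \<le> ?a z powr q * \<xi> (fst z) / 2"
          by (simp add: mult_ac)
        then show ?thesis using flux_lower[of z] True by (auto simp: mem_Times_iff)
      qed
    qed
    also have "\<dots> = pairing \<xi> s - pairing \<xi> \<tau>"
      by (rule pairing_increment[OF \<xi> K(1,2) off s \<tau>, symmetric])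
    finally show ?thesis by simp
  qed
  have big: "\<forall>\<^sub>F s in at_right 0. N < pairing \<xi> s" for N
  proof -
    have "\<not> finite_energy (cball x0 r)"
      using x0(2) r(1) rO unfolding regular_set_def by blast
    \<comment> \<open>Lack of finite energy excludes every pair of a time and a bound, so it can be
      used with the \<open>\<tau>\<close> already chosen. The threshold is the inequality
      \<open>lower\<close> solved for \<open>pairing \<xi> s > N\<close>.\<close>
    then obtain s0 where s0: "0 < s0" "s0 < \<tau>" "2 / c * (N + V - pairing \<xi> \<tau>) < energy (cball x0 r) s0 \<tau>"
      unfolding finite_energy_def using \<tau> by (meson not_le)
    have "N < pairing \<xi> s" if s: "0 < s" "s < s0" for s
    proof -
      have "2 / c * (N + V - pairing \<xi> \<tau>) < energy (cball x0 r) s \<tau>"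
        using s0(3) energy_mono[OF compact_cball compact_cball order_refl rO s(1) _ \<tau>, of s0] s by simp
      then have "N + V - pairing \<xi> \<tau> < (c/2) * energy (cball x0 r) s \<tau>"
        using c(1) by (simp add: field_simps)
      then show ?thesis using lower[of s] s s0 by simp
    qed
    then show ?thesis unfolding eventually_at_right_field using s0(1) by blast
  qed
  \<comment> \<open>\<open>u\<close> is only locally integrable in \<open>\<Omega>\<close> and the
    ball may reach the boundary, so its mass may be infinite. It is therefore bounded from below as
    an extended value, using \<open>0 \<le> \<xi> \<le> 1\<close> with support in
    \<open>K\<close>.\<close>
  have nnle: "ennreal (pairing \<xi> t) \<le> (\<integral>\<^sup>+ x. ennreal (u x t) * indicator (ball x0 \<epsilon> \<inter> \<Omega>) x \<partial>lborel)" if t: "t \<in> tint T" for t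
  proof -
    have nn: "0 \<le> u x t * \<xi> x" for x
      using off[of x] \<xi>01(1)[of x] u_nonneg[OF _ t, of x] K(2) by (cases "x \<in> K") auto
    have "ennreal (pairing \<xi> t) = (\<integral>\<^sup>+ x. ennreal (u x t * \<xi> x) \<partial>lborel)"
      unfolding pairing_def
      using nn_integral_eq_integral[OF integrable_pairing[OF \<xi>C t]] nn by simp
    also have "\<dots> \<le> (\<integral>\<^sup>+ x. ennreal (u x t) * indicator (ball x0 \<epsilon> \<inter> \<Omega>) x \<partial>lborel)"
    proof (rule nn_integral_mono)
      fix x
      show "ennreal (u x t * \<xi> x) \<le> ennreal (u x t) * indicator (ball x0 \<epsilon> \<inter> \<Omega>) x"
      proof (cases "x \<in> K")
        case True
        then have "u x t * \<xi> x \<le> u x t"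
          using K(2) \<xi>01[of x] u_nonneg[OF _ t, of x] by (intro mult_left_le) auto
        moreover have "x \<in> ball x0 \<epsilon> \<inter> \<Omega>" using True K(2,3) by blast
        ultimately show ?thesis by (simp add: ennreal_leI)
      qed (simp add: off)
    qed
    finally show ?thesis .
  qed
  show ?thesis
    unfolding infinity_ennreal_def tendsto_top_iff_ennreal
  proof (intro allI impI)
    fix l :: real assume l: "0 \<le> l"
    show "\<forall>\<^sub>F t in at_right 0. ennreal l < (\<integral>\<^sup>+ x. ennreal (u x t) * indicator (ball x0 \<epsilon> \<inter> \<Omega>) x \<partial>lborel)"
      using big[of l] eventually_tint[OF T]
    proof eventually_elim
      case (elim t)
      have "ennreal l < ennreal (pairing \<xi> t)" using elim(1) l by (simp add: ennreal_less_iff)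
      also note nnle[OF elim(2)]
      finally show ?case .
    qed
  qed
qed

section \<open>The trace functional on the regular set\<close>

lemma regular_set_subset: "regular_set \<subseteq> \<Omega>"
  unfolding regular_set_def by force

lemma finite_energy_mono:
  assumes "compact K" "compact K'" "K \<subseteq> K'" "K' \<subseteq> \<Omega>" "finite_energy K'"
  shows "finite_energy K"
proof -
  obtain \<tau> M where \<tau>: "\<tau> \<in> tint T" and M: "\<And>s. 0 < s \<Longrightarrow> s < \<tau> \<Longrightarrow> energy K' s \<tau> \<le> M"
    using assms(5) unfolding finite_energy_def by blast
  have "energy K s \<tau> \<le> M" if "0 < s" "s < \<tau>" for s
    using energy_mono[OF assms(1-4) that(1) order_refl \<tau>] M[OF that] by linarith
  then show ?thesis unfolding finite_energy_def using \<tau> by blast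
qed

lemma open_regular_set: "open regular_set"
  unfolding open_contains_ball
proof
  fix x assume "x \<in> regular_set"
  then obtain r where r: "r > 0" "cball x r \<subseteq> \<Omega>" "finite_energy (cball x r)"
    unfolding regular_set_def by blast
  have "y \<in> regular_set" if y: "y \<in> ball x (r/2)" for y
  proof -
    have sub: "cball y (r/2) \<subseteq> cball x r"
    proof
      fix z assume "z \<in> cball y (r/2)"
      then show "z \<in> cball x r" using y dist_triangle[of x z y] by simp
    qed
    then show ?thesis
      unfolding regular_set_def using r finite_energy_mono[OF compact_cball compact_cball sub r(2,3)]
      by (intro CollectI exI[of _ "r/2"]) auto
  qed
  then show "\<exists>e>0. ball x e \<subseteq> regular_set" using r(1) by (intro exI[of _ "r/2"]) auto
qed

lemma pairing_add:
  assumes "f \<in> Cc \<Omega>" "h \<in> Cc \<Omega>" "t \<in> tint T"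
  shows "pairing (\<lambda>x. f x + h x) t = pairing f t + pairing h t"
  unfolding pairing_def
  using integrable_pairing[OF assms(1,3)] integrable_pairing[OF assms(2,3)] by (simp add: distrib_left)

lemma pairing_cmult: "pairing (\<lambda>x. c * f x) t = c * pairing f t"
proof -
  have "(\<lambda>x. u x t * (c * f x)) = (\<lambda>x. c * (u x t * f x))" by (simp add: mult_ac)
  then show ?thesis unfolding pairing_def by simp
qed

lemma pairing_sum:
  assumes "\<And>i. i \<in> I \<Longrightarrow> f i \<in> Cc \<Omega>" "t \<in> tint T"
  shows "pairing (\<lambda>x. \<Sum>i\<in>I. f i x) t = (\<Sum>i\<in>I. pairing (f i) t)"
  unfolding pairing_def sum_distrib_left
  by (rule Bochner_Integration.integral_sum) (use assms integrable_pairing in blast)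

lemma pairing_nonneg:
  assumes "f \<in> Cc \<Omega>" "\<And>x. 0 \<le> f x" "t \<in> tint T"
  shows "0 \<le> pairing f t"
  unfolding pairing_def
proof (rule Bochner_Integration.integral_nonneg)
  obtain K where K: "compact K" "K \<subseteq> \<Omega>" "\<And>x. x \<notin> K \<Longrightarrow> f x = 0"
    using Cc_E[OF assms(1)] by blast
  show "0 \<le> u x t * f x" for x
    using u_nonneg[OF _ assms(3), of x] assms(2)[of x] K(2) K(3)[of x] by (cases "x \<in> K") auto
qed

lemma pairing_mono:
  assumes "f \<in> Cc \<Omega>" "h \<in> Cc \<Omega>" "\<And>x. f x \<le> h x" "t \<in> tint T"
  shows "pairing f t \<le> pairing h t"
  using pairing_nonneg[OF Cc_diff[OF assms(2,1)] _ assms(4)] assms(3)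
    pairing_add[OF Cc_diff[OF assms(2,1)] assms(1,4)] by simp

lemma Cc_subset: "A \<subseteq> B \<Longrightarrow> Cc A \<subseteq> Cc B"
  unfolding Cc_def by blast

text \<open>Finitely many bumps cover the compact set. They are kept separate instead of being added
  into one function because finite energy is known on each ball by itself, with its own time, and
  \<open>pairing_convergent_smooth\<close> needs one such set carrying the whole support.\<close>

lemma regular_cutoff:
  assumes "compact K" "K \<subseteq> regular_set"
  shows "\<exists>X (\<eta> :: 'a \<Rightarrow> 'a \<Rightarrow> real) D. finite X \<and>
    (\<forall>x\<in>X. smooth (\<eta> x) \<and> compact (D x) \<and> D x \<subseteq> \<Omega> \<and> finite_energy (D x) \<and>
      (\<forall>y. y \<notin> D x \<longrightarrow> \<eta> x y = 0) \<and> (\<forall>y. 0 \<le> \<eta> x y)) \<and>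
    (\<forall>y\<in>K. 0 < (\<Sum>x\<in>X. \<eta> x y))"
proof -
  have "\<exists>\<eta> r D. smooth \<eta> \<and> compact D \<and> D \<subseteq> \<Omega> \<and> finite_energy D \<and> (\<forall>y. y \<notin> D \<longrightarrow> \<eta> y = 0) \<and>
      (\<forall>y. 0 \<le> \<eta> y) \<and> 0 < r \<and> (\<forall>y\<in>cball x r. 0 < \<eta> y)" if x: "x \<in> K" for x
  proof -
    obtain \<delta> where \<delta>: "\<delta> > 0" "cball x \<delta> \<subseteq> \<Omega>" "finite_energy (cball x \<delta>)"
      using x assms(2) unfolding regular_set_def by blast
    obtain \<eta> r where "smooth \<eta> \<and> (\<forall>y. 0 \<le> \<eta> y) \<and> (\<forall>y. \<eta> y \<le> 1) \<and>
      (\<forall>y. y \<notin> cball x \<delta> \<longrightarrow> \<eta> y = 0) \<and> r > 0 \<and> (\<forall>y\<in>cball x r. \<eta> y > 0)"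
      using smooth_bump_exists[OF \<delta>(1), of x] by blast
    with \<delta> show ?thesis
      by (intro exI[of _ \<eta>] exI[of _ r] exI[of _ "cball x \<delta>"]) auto
  qed
  then obtain \<eta> r D where P: "\<And>x. x \<in> K \<Longrightarrow> smooth (\<eta> x) \<and> compact (D x) \<and> D x \<subseteq> \<Omega> \<and> finite_energy (D x) \<and>
      (\<forall>y. y \<notin> D x \<longrightarrow> \<eta> x y = 0) \<and> (\<forall>y. 0 \<le> \<eta> x y) \<and> 0 < r x \<and> (\<forall>y\<in>cball x (r x). 0 < \<eta> x y)"
    by metis
  have cover: "K \<subseteq> (\<Union>x\<in>K. ball x (r x))"
  proof
    fix x assume "x \<in> K"
    then show "x \<in> (\<Union>x\<in>K. ball x (r x))" using P[of x] by (intro UN_I[of x]) auto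
  qed
  obtain X where X: "X \<subseteq> K" "finite X" "K \<subseteq> (\<Union>x\<in>X. ball x (r x))"
    by (rule compactE_image[OF assms(1) open_ball cover])
  have PX: "smooth (\<eta> x) \<and> compact (D x) \<and> D x \<subseteq> \<Omega> \<and> finite_energy (D x) \<and>
      (\<forall>y. y \<notin> D x \<longrightarrow> \<eta> x y = 0) \<and> (\<forall>y. 0 \<le> \<eta> x y) \<and> 0 < r x \<and> (\<forall>y\<in>cball x (r x). 0 < \<eta> x y)" if "x \<in> X" for x
    by (rule P) (use X that in blast)
  have "0 < (\<Sum>x\<in>X. \<eta> x y)" if y: "y \<in> K" for y
  proof -
    obtain x where x: "x \<in> X" "y \<in> ball x (r x)" using X(3) y by blast
    then have "0 < \<eta> x y" using PX[OF x(1)] by auto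
    also have "\<dots> \<le> (\<Sum>x\<in>X. \<eta> x y)"
      using PX by (intro member_le_sum x X) auto
    finally show ?thesis .
  qed
  then show ?thesis
    by (intro exI[of _ X] exI[of _ \<eta>] exI[of _ D] conjI ballI X(2)) (simp_all add: PX)
qed

lemma pairing_convergent_Cc:
  assumes \<psi>: "\<psi> \<in> Cc regular_set"
  shows "\<exists>l. (pairing \<psi> \<longlongrightarrow> l) (at_right 0)"
proof -
  obtain K where K: "compact K" "K \<subseteq> regular_set" "\<And>x. x \<notin> K \<Longrightarrow> \<psi> x = 0"
    using Cc_E[OF \<psi>] by blast
  obtain X and \<eta> :: "'a \<Rightarrow> 'a \<Rightarrow> real" and D where "finite X \<and>
    (\<forall>x\<in>X. smooth (\<eta> x) \<and> compact (D x) \<and> D x \<subseteq> \<Omega> \<and> finite_energy (D x) \<and>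
      (\<forall>y. y \<notin> D x \<longrightarrow> \<eta> x y = 0) \<and> (\<forall>y. 0 \<le> \<eta> x y)) \<and>
    (\<forall>y\<in>K. 0 < (\<Sum>x\<in>X. \<eta> x y))"
    using regular_cutoff[OF K(1,2)] by blast
  then have X: "finite X" "\<And>x. x \<in> X \<Longrightarrow> smooth (\<eta> x)" "\<And>x. x \<in> X \<Longrightarrow> compact (D x)"
    "\<And>x. x \<in> X \<Longrightarrow> D x \<subseteq> \<Omega>" "\<And>x. x \<in> X \<Longrightarrow> finite_energy (D x)"
    "\<And>x y. x \<in> X \<Longrightarrow> y \<notin> D x \<Longrightarrow> \<eta> x y = (0::real)" "\<And>x y. x \<in> X \<Longrightarrow> 0 \<le> \<eta> x y"
    "\<And>y. y \<in> K \<Longrightarrow> 0 < (\<Sum>x\<in>X. \<eta> x y)"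
    by auto
  define \<zeta> where "\<zeta> y = (\<Sum>x\<in>X. \<eta> x y)" for y
  have \<zeta>c: "continuous_on UNIV \<zeta>"
    unfolding \<zeta>_def by (intro continuous_on_sum smooth_continuous_on X(2))
  have \<zeta>0: "0 \<le> \<zeta> y" for y unfolding \<zeta>_def by (intro sum_nonneg X(7))
  have \<eta>C: "\<eta> x \<in> Cc \<Omega>" if "x \<in> X" for x
    by (rule Cc_I[OF smooth_continuous_on[OF X(2)] X(3,4,6)]) (use that in auto)
  have \<zeta>C: "\<zeta> \<in> Cc \<Omega>" unfolding \<zeta>_def by (rule Cc_sum[OF \<eta>C])
  have \<psi>C: "\<psi> \<in> Cc \<Omega>" using \<psi> Cc_subset[OF regular_set_subset] by blast
  define DD where "DD = (\<Union>x\<in>X. D x)"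
  have DD: "compact DD" unfolding DD_def using X(1,3) by (rule compact_UN)
  have \<zeta>off: "\<zeta> y = 0" if "y \<notin> DD" for y
    unfolding \<zeta>_def using that by (intro sum.neutral ballI X(6)) (auto simp: DD_def)
  have conv: "\<exists>l. (pairing (\<lambda>y. \<zeta> y * p y) \<longlongrightarrow> l) (at_right 0)" if p: "smooth p" for p
  proof -
    have "\<exists>l. (pairing (\<lambda>y. \<eta> x y * p y) \<longlongrightarrow> l) (at_right 0)" if x: "x \<in> X" for x
      by (rule pairing_convergent_smooth[OF smooth_mult[OF X(2)[OF x] p] X(3,4)[OF x] _ X(5)[OF x]])
        (simp add: X(6)[OF x])
    then obtain l where l: "\<And>x. x \<in> X \<Longrightarrow> (pairing (\<lambda>y. \<eta> x y * p y) \<longlongrightarrow> l x) (at_right 0)"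
      by metis
    have "((\<lambda>t. \<Sum>x\<in>X. pairing (\<lambda>y. \<eta> x y * p y) t) \<longlongrightarrow> (\<Sum>x\<in>X. l x)) (at_right 0)"
      by (intro tendsto_sum l)
    moreover have "\<forall>\<^sub>F t in at_right 0. (\<Sum>x\<in>X. pairing (\<lambda>y. \<eta> x y * p y) t) = pairing (\<lambda>y. \<zeta> y * p y) t"
      using eventually_tint[OF T]
    proof eventually_elim
      case (elim t)
      show ?case
        unfolding \<zeta>_def sum_distrib_right
        by (rule pairing_sum[symmetric, OF Cc_mult[OF \<eta>C smooth_continuous_on[OF p]] elim])
    qed
    ultimately show ?thesis using Lim_transform_eventually by blast
  qed
  \<comment> \<open>The case \<open>p = 1\<close>. It bounds the \<open>\<zeta>\<close>-weighted
    mass of \<open>u\<close> for all small times, which controls the approximation error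
    below.\<close>
  obtain l\<zeta> where l\<zeta>: "(pairing \<zeta> \<longlongrightarrow> l\<zeta>) (at_right 0)"
    using conv[OF smooth_const[of 1]] by auto
  define f where "f y = (if y \<in> K then \<psi> y / \<zeta> y else 0)" for y
  \<comment> \<open>The quotient is continuous where \<open>\<zeta>\<close> is positive and 0 off
    \<open>K\<close>. These two open sets cover the space, and the formulas agree on the overlap
    because \<open>\<psi>\<close> vanishes off \<open>K\<close>.\<close>
  have fc: "continuous_on UNIV f"
  proof -
    have "continuous_on {y. 0 < \<zeta> y} f"
    proof (rule continuous_on_eq)
      show "continuous_on {y. 0 < \<zeta> y} (\<lambda>y. \<psi> y / \<zeta> y)"
        by (intro continuous_on_divide continuous_on_subset[OF \<zeta>c] continuous_on_subset[OF Cc_continuous[OF \<psi>]]) auto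
      show "\<psi> y / \<zeta> y = f y" if "y \<in> {y. 0 < \<zeta> y}" for y
        using K(3)[of y] by (auto simp: f_def)
    qed
    moreover have "continuous_on (- K) f"
      by (rule continuous_on_eq[OF continuous_on_const[of _ 0]]) (auto simp: f_def)
    moreover have "open {y. 0 < \<zeta> y}" by (intro open_Collect_less continuous_intros \<zeta>c)
    moreover have "open (- K)" using compact_imp_closed[OF K(1)] by auto
    ultimately have "continuous_on ({y. 0 < \<zeta> y} \<union> - K) f" by (intro continuous_on_open_Un)
    moreover have "{y. 0 < \<zeta> y} \<union> - K = UNIV" using X(8) by (auto simp: \<zeta>_def)
    ultimately show ?thesis by simp
  qed
  have \<psi>f: "\<psi> y = \<zeta> y * f y" for y
  proof (cases "y \<in> K")
    case True
    then have "0 < \<zeta> y" using X(8) by (simp add: \<zeta>_def)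
    then show ?thesis using True by (simp add: f_def)
  qed (simp add: K(3) f_def)
  show ?thesis
  proof (rule convergent_of_approx)
    show "at_right (0::real) \<noteq> bot" by simp
    fix e :: real assume e: "e > 0"
    define M where "M = \<bar>l\<zeta>\<bar> + 1"
    have M: "M > 0" "l\<zeta> < M" by (auto simp: M_def)
    \<comment> \<open>\<open>M\<close> eventually exceeds \<open>pairing \<zeta>\<close>, so the
      approximation error costs at most \<open>d * M = e/2\<close>. The other half of
      \<open>e\<close> is left for the convergence of the polynomial part.\<close>
    define d where "d = e / (2 * M)"
    have d: "d > 0" using e M by (simp add: d_def)
    \<comment> \<open>Approximation on \<open>DD\<close> is enough: off \<open>DD\<close> the weight
      \<open>\<zeta>\<close> vanishes, and with it both \<open>\<psi>\<close> and
      \<open>\<zeta> p\<close>.\<close>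
    obtain p where p: "real_polynomial_function p" "\<And>y. y \<in> DD \<Longrightarrow> \<bar>f y - p y\<bar> < d"
      using Stone_Weierstrass_real_polynomial_function[OF DD continuous_on_subset[OF fc subset_UNIV] d] by blast
    have ps: "smooth p" by (rule smooth_real_polynomial_function[OF p(1)])
    have pC: "(\<lambda>y. \<zeta> y * p y) \<in> Cc \<Omega>" by (rule Cc_mult[OF \<zeta>C smooth_continuous_on[OF ps]])
    have close: "\<bar>\<psi> y - \<zeta> y * p y\<bar> \<le> d * \<zeta> y" for y
    proof (cases "y \<in> DD")
      case True
      have "\<bar>\<psi> y - \<zeta> y * p y\<bar> = \<zeta> y * \<bar>f y - p y\<bar>"
        unfolding \<psi>f using \<zeta>0[of y] by (simp add: right_diff_distrib[symmetric] abs_mult)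
      also have "\<dots> \<le> \<zeta> y * d" using p(2)[OF True] \<zeta>0 by (intro mult_left_mono) auto
      finally show ?thesis by (simp add: mult.commute)
    qed (simp add: \<psi>f \<zeta>off)
    have pd: "\<bar>pairing \<psi> t - pairing (\<lambda>y. \<zeta> y * p y) t\<bar> \<le> d * pairing \<zeta> t" if t: "t \<in> tint T" for t
    proof -
      have C1: "(\<lambda>y. \<zeta> y * p y + d * \<zeta> y) \<in> Cc \<Omega>" "(\<lambda>y. \<psi> y + d * \<zeta> y) \<in> Cc \<Omega>"
        by (intro Cc_add Cc_cmult pC \<zeta>C \<psi>C)+
      have "pairing \<psi> t \<le> pairing (\<lambda>y. \<zeta> y * p y + d * \<zeta> y) t"
        by (rule pairing_mono[OF \<psi>C C1(1) _ t]) (use close in \<open>simp add: abs_le_iff algebra_simps\<close>)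
      moreover have "pairing (\<lambda>y. \<zeta> y * p y) t \<le> pairing (\<lambda>y. \<psi> y + d * \<zeta> y) t"
        by (rule pairing_mono[OF pC C1(2) _ t]) (use close in \<open>simp add: abs_le_iff algebra_simps\<close>)
      ultimately show ?thesis
        unfolding pairing_add[OF pC Cc_cmult[OF \<zeta>C] t] pairing_add[OF \<psi>C Cc_cmult[OF \<zeta>C] t] pairing_cmult
        by linarith
    qed
    obtain l where l: "(pairing (\<lambda>y. \<zeta> y * p y) \<longlongrightarrow> l) (at_right 0)" using conv[OF ps] by blast
    have "\<forall>\<^sub>F t in at_right 0. \<bar>pairing \<psi> t - l\<bar> < e"
      using eventually_tint[OF T] order_tendstoD(2)[OF l\<zeta> M(2)] tendstoD[OF l half_gt_zero[OF e]]
    proof eventually_elim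
      case (elim t)
      have "d * pairing \<zeta> t \<le> d * M" using elim(2) d by (intro mult_left_mono) auto
      also have "\<dots> = e / 2" using M by (simp add: d_def)
      finally show ?case using pd[OF elim(1)] elim(3) unfolding dist_real_def by linarith
    qed
    then show "\<exists>l. \<forall>\<^sub>F t in at_right 0. \<bar>pairing \<psi> t - l\<bar> < e" by blast
  qed
qed

text \<open>\<open>Lim\<close> is meaningful only where the limit exists, which
  \<open>pairing_convergent_Cc\<close> ensures on \<open>Cc regular_set\<close>; the definition is
  used only there.\<close>

definition initial_trace :: "('a \<Rightarrow> real) \<Rightarrow> real" where
  "initial_trace \<psi> = Lim (at_right 0) (pairing \<psi>)"

lemma tendsto_initial_trace: "\<psi> \<in> Cc regular_set \<Longrightarrow> (pairing \<psi> \<longlongrightarrow> initial_trace \<psi>) (at_right 0)"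
  unfolding initial_trace_def using pairing_convergent_Cc[of \<psi>] tendsto_Lim[of "at_right (0::real)" "pairing \<psi>"] by force

lemma positive_functional_initial_trace: "positive_functional regular_set initial_trace"
proof
  have sub: "f \<in> Cc \<Omega>" if "f \<in> Cc regular_set" for f
    using that Cc_subset[OF regular_set_subset] by blast
  show "open regular_set" by (rule open_regular_set)
  show "initial_trace (\<lambda>x. f x + h x) = initial_trace f + initial_trace h" if f: "f \<in> Cc regular_set" and h: "h \<in> Cc regular_set" for f h
  proof (rule tendsto_unique[OF _ tendsto_initial_trace[OF Cc_add[OF f h]]])
    have "\<forall>\<^sub>F t in at_right 0. pairing f t + pairing h t = pairing (\<lambda>x. f x + h x) t"
      using eventually_tint[OF T] by eventually_elim (rule pairing_add[symmetric, OF sub[OF f] sub[OF h]])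
    then show "(pairing (\<lambda>x. f x + h x) \<longlongrightarrow> initial_trace f + initial_trace h) (at_right 0)"
      by (rule Lim_transform_eventually[OF tendsto_add[OF tendsto_initial_trace[OF f] tendsto_initial_trace[OF h]]])
  qed simp
  show "initial_trace (\<lambda>x. c * f x) = c * initial_trace f" if f: "f \<in> Cc regular_set" for f c
  proof (rule tendsto_unique[OF _ tendsto_initial_trace[OF Cc_cmult[OF f]]])
    show "(pairing (\<lambda>x. c * f x) \<longlongrightarrow> c * initial_trace f) (at_right 0)"
      unfolding pairing_cmult[abs_def] by (intro tendsto_mult tendsto_const tendsto_initial_trace f)
  qed simp
  show "0 \<le> initial_trace f" if f: "f \<in> Cc regular_set" and f0: "\<And>x. 0 \<le> f x" for f
  proof (rule tendsto_lowerbound[OF tendsto_initial_trace[OF f]])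
    show "\<forall>\<^sub>F t in at_right 0. 0 \<le> pairing f t"
      using eventually_tint[OF T] by eventually_elim (rule pairing_nonneg[OF sub[OF f] f0])
  qed simp
qed

end

text \<open>Extension by zero is continuous on the two open sets \<open>R\<close> and
  \<open>- K\<close>, which together cover the space. This connects functions whose values off
  \<open>R\<close> are irrelevant with the global functions to which the trace applies.\<close>

lemma Cc_of_Cc_on:
  assumes "open R" "Cc_on R \<psi>"
  shows "(\<lambda>x. indicator R x *\<^sub>R \<psi> x) \<in> Cc R"
proof -
  obtain K where K: "compact K" "K \<subseteq> R" "\<And>x. x \<in> R - K \<Longrightarrow> \<psi> x = 0" and c: "continuous_on R \<psi>"
    using assms(2) unfolding Cc_on_def by blast
  let ?f = "\<lambda>x. indicator R x *\<^sub>R \<psi> x"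
  have off: "?f x = 0" if "x \<notin> K" for x
    using K(3)[of x] that by (cases "x \<in> R") auto
  have "continuous_on R ?f" by (rule continuous_on_eq[OF c]) auto
  moreover have "continuous_on (- K) ?f" by (rule continuous_on_eq[OF continuous_on_const[of _ 0]]) (use off in auto)
  moreover have "open (- K)" using compact_imp_closed[OF K(1)] by auto
  ultimately have "continuous_on (R \<union> - K) ?f" using assms(1) by (intro continuous_on_open_Un)
  moreover have "R \<union> - K = UNIV" using K(2) by blast
  ultimately show ?thesis using Cc_I[OF _ K(1,2) off] by simp
qed

theorem theorem1p1:
  fixes q :: real and \<Omega> :: "'a::euclidean_space set" and T :: ereal
    and u :: "'a \<Rightarrow> real \<Rightarrow> real"
  assumes "q > 1"
    and "open \<Omega>" and "connected \<Omega>" and "\<Omega> \<noteq> {}"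
    and "T > 0"
    and "weak_solution q \<Omega> T u"
    and "\<forall>x\<in>\<Omega>. \<forall>t\<in>tint T. u x t \<ge> 0"
  shows "\<exists>S \<subseteq> \<Omega>. open (\<Omega> - S) \<and>
    (\<exists>u0. radon_pos_on (\<Omega> - S) u0 \<and>
      (\<forall>\<psi>. Cc_on (\<Omega> - S) \<psi> \<longrightarrow>
         ((\<lambda>t. LINT x:(\<Omega> - S)|lborel. u x t * \<psi> x)
            \<longlongrightarrow> set_lebesgue_integral u0 (\<Omega> - S) \<psi>) (at_right 0)) \<and>
      (\<forall>x0\<in>S. \<forall>\<epsilon>>0.
         ((\<lambda>t. \<integral>\<^sup>+ x. ennreal (u x t) * indicator (ball x0 \<epsilon> \<inter> \<Omega>) x \<partial>lborel)
            \<longlongrightarrow> \<infinity>) (at_right 0)))"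
proof -
  note W = assms(6)[unfolded weak_solution_def]
  obtain g :: "'a \<Rightarrow> real \<Rightarrow> 'a" where
    loc: "\<forall>K. compact K \<and> K \<subseteq> cyl \<Omega> T \<longrightarrow>
          set_integrable lborel K (\<lambda>z. u (fst z) (snd z)) \<and>
          set_integrable lborel K (\<lambda>z. g (fst z) (snd z)) \<and>
          set_integrable lborel K (\<lambda>z. norm (g (fst z) (snd z)) powr q)"
    and grad: "\<forall>\<phi> b. test_fun (cyl \<Omega> T) \<phi> \<and> b \<in> Basis \<longrightarrow>
          (LINT z|lborel. u (fst z) (snd z) * dderiv [(b, 0)] \<phi> z)
            = - (LINT z|lborel. (g (fst z) (snd z) \<bullet> b) * \<phi> z)"
    and eqn: "\<forall>\<phi>. test_fun (cyl \<Omega> T) \<phi> \<longrightarrow>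
          (LINT z|lborel. - u (fst z) (snd z) * dderiv [(0, 1)] \<phi> z
              - u (fst z) (snd z) * (\<Sum>b\<in>Basis. dderiv [(b, 0), (b, 0)] \<phi> z)
              + norm (g (fst z) (snd z)) powr q * \<phi> z) = 0"
    using conjunct2[OF W] by (elim exE conjE)
  interpret weak_sol q \<Omega> T u g
  proof
    show "set_integrable lborel K (\<lambda>x. u x t)" if "compact K" "K \<subseteq> \<Omega>" "t \<in> tint T" for K t
      using conjunct1[OF W] that by blast
    show "((\<lambda>s. LINT x:K|lborel. \<bar>u x s - u x t\<bar>) \<longlongrightarrow> 0) (at t within tint T)"
      if "compact K" "K \<subseteq> \<Omega>" "t \<in> tint T" for K t
      using conjunct1[OF W] that by blast
  qed (use assms(1,2,5,7) loc grad eqn in \<open>auto simp del: dderiv.simps\<close>)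
  let ?R = regular_set
  have R: "\<Omega> - (\<Omega> - ?R) = ?R" using regular_set_subset by blast
  obtain u0 where u0: "radon_pos_on ?R u0" "\<forall>f\<in>Cc ?R. integral\<^sup>L u0 f = initial_trace f"
    using riesz_representation[OF positive_functional_initial_trace] by blast
  have lim: "((\<lambda>t. LINT x:?R|lborel. u x t * \<psi> x) \<longlongrightarrow> set_lebesgue_integral u0 ?R \<psi>) (at_right 0)"
    if "Cc_on ?R \<psi>" for \<psi>
  proof -
    note C = Cc_of_Cc_on[OF open_regular_set that]
    \<comment> \<open>The indicator in the set integral is moved from the product to
      \<open>\<psi>\<close>, which makes the integral a pairing with the extension by zero.\<close>
    have "(\<lambda>t. LINT x:?R|lborel. u x t * \<psi> x) = pairing (\<lambda>x. indicator ?R x *\<^sub>R \<psi> x)"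
      unfolding pairing_def[abs_def] set_lebesgue_integral_def by (simp add: mult_ac)
    then show ?thesis
      using tendsto_initial_trace[OF C] bspec[OF u0(2) C] by (simp add: set_lebesgue_integral_def)
  qed
  show ?thesis
    by (rule exI[of _ "\<Omega> - ?R"], unfold R, intro conjI exI[of _ u0])
      (use open_regular_set u0(1) lim blow_up_outside_regular_set in auto)
qed

end
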